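(* Let $p\in[1,\infty]$, let $\omega$ be a regular majorant, and let $f$ be a complex-valued harmonic function in $\mathbb{D}$ that is continuous up to the boundary $\mathbb{T}$. Suppose that the boundary function of $|f|$ belongs to $\Lambda_{\omega,p}(\mathbb{T})$ and that $f$ is $K$-quasiregular in $\mathbb{D}$ for some constant $K\in[1,\infty)$. Then the following statements are equivalent. (D1) $f\in\Lambda_{\omega,p}(\mathbb{D})$. (D2) There is a constant $M>0$ such that for all $z\in\mathbb{D}$: $\left(\int_0^{2\pi}\left(P[|f|](ze^{i\eta})-|f(ze^{i\eta})|\right)^p d\eta\right)^{1/p}\le M\omega(d_{\mathbb{D}}(z))$ if $p\in[1,\infty)$, and $P[|f|](z)-|f(z)|\le M\omega(d_{\mathbb{D}}(z))$ if $p=\infty$.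
   Context: $\mathbb{D}$ is the open unit disk in $\mathbb{C}$, $\mathbb{T}=\partial\mathbb{D}$, $d_{\mathbb{D}}(z)=1-|z|$. A majorant is a continuous increasing function $\omega:[0,\infty)\to[0,\infty)$ with $\omega(0)=0$ such that $\omega(t)/t$ is non-increasing for $t>0$. It is regular if, for some $\delta_0>0$ and $M>0$, both $\int_0^\delta\frac{\omega(t)}{t}\,dt\le M\omega(\delta)$ and $\delta\int_\delta^\infty\frac{\omega(t)}{t^2}\,dt\le M\omega(\delta)$ hold for all $0<\delta<\delta_0$. For $p\in(0,\infty)$ put $\mathcal{L}_p[F](z_1,z_2)=\left(\int_0^{2\pi}|F(e^{i\eta}z_1)-F(e^{i\eta}z_2)|^p\,d\eta\right)^{1/p}$, and $\mathcal{L}_\infty[F](z_1,z_2)=|F(z_1)-F(z_2)|$. $\Lambda_{\omega,p}(\mathbb{T})$ consists of those $F\in L^p(\mathbb{T})$ for which there is $M>0$ with $\mathcal{L}_p[F](\xi_1,\xi_2)\le M\omega(|\xi_1-\xi_2|)$ for all $\xi_1,\xi_2\in\mathbb{T}$. $\Lambda_{\omega,p}(\mathbb{D})$ is the class of Borel functions $F:\mathbb{D}\to\mathbb{C}$ for which there is $M>0$ with $\mathcal{L}_p[F](z_1,z_2)\le M\omega(|z_1-z_2|)$ for all $z_1,z_2\in\mathbb{D}$. A sense-preserving continuous mapping $f:\mathbb{D}\to\mathbb{C}$ is $K$-quasiregular if (1) $f$ is absolutely continuous on lines with locally $L^2$ partial derivatives ($ACL^2$) in $\mathbb{D}$ and $J_f=|f_z|^2-|f_{\overline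 z}|^2>0$ a.e. in $\mathbb{D}$; (2) $(|f_z|+|f_{\overline z}|)^2\le KJ_f$ a.e. in $\mathbb{D}$, with $K\ge1$. $P[\varphi](z)=\frac1{2\pi}\int_0^{2\pi}\varphi(e^{i\tau})\frac{1-|z|^2}{|e^{i\tau}-z|^2}\,d\tau$ is the Poisson integral, and $P[|f|]$ denotes the Poisson integral of the boundary function of $|f|$ (it satisfies $P[|f|]-|f|\ge0$ in $\mathbb{D}$ since $|f|$ is subharmonic). *)

theory Defs
  imports "HOL-Complex_Analysis.Complex_Analysis"
begin

section \<open>Majorants\<close>

text \<open>``Increasing'' is read in the weak sense. Only the values of \<open>\<omega>\<close> on \<open>[0,\<infinity>)\<close> are ever used.\<close>

definition majorant :: "(real \<Rightarrow> real) \<Rightarrow> bool" where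
  "majorant \<omega> \<longleftrightarrow>
     continuous_on {0..} \<omega> \<and> mono_on {0..} \<omega> \<and> (\<forall>t\<ge>0. 0 \<le> \<omega> t) \<and> \<omega> 0 = 0 \<and>
     (\<forall>s t. 0 < s \<longrightarrow> s \<le> t \<longrightarrow> \<omega> t / t \<le> \<omega> s / s)"

text \<open>The integrals are taken in \<open>[0,\<infinity>]\<close>, so each bound includes convergence.\<close>

definition regular_majorant :: "(real \<Rightarrow> real) \<Rightarrow> bool" where
  "regular_majorant \<omega> \<longleftrightarrow> majorant \<omega> \<and>
     (\<exists>\<delta>\<^sub>0>0. \<exists>M>0. \<forall>\<delta>. 0 < \<delta> \<and> \<delta> < \<delta>\<^sub>0 \<longrightarrow>
        (\<integral>\<^sup>+t\<in>{0<..\<delta>}. ennreal (\<omega> t / t) \<partial>lborel) \<le> ennreal (M * \<omega> \<delta>) \<and>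
        ennreal \<delta> * (\<integral>\<^sup>+t\<in>{\<delta>..}. ennreal (\<omega> t / t\<^sup>2) \<partial>lborel) \<le> ennreal (M * \<omega> \<delta>))"


section \<open>Lipschitz-type classes\<close>

text \<open>For \<open>g \<ge> 0\<close> on \<open>[0,2\<pi>]\<close> and \<open>0 < q < \<infinity>\<close> this is \<open>(\<integral> g(\<eta>)^q d\<eta>)^(1/q)\<close> as a value in \<open>[0,\<infinity>]\<close>.\<close>

definition circle_Lp :: "real \<Rightarrow> (real \<Rightarrow> real) \<Rightarrow> ennreal" where
  "circle_Lp q g =
     (let I = \<integral>\<^sup>+\<eta>. ennreal (g \<eta> powr q) \<partial>lebesgue_on {0..2*pi}
      in if I = \<infinity> then \<infinity> else ennreal (enn2real I powr (1 / q)))"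

definition Lp_diff ::
    "ennreal \<Rightarrow> (complex \<Rightarrow> 'a::real_normed_vector) \<Rightarrow> complex \<Rightarrow> complex \<Rightarrow> ennreal" where
  "Lp_diff p F z1 z2 =
     (if p = \<infinity> then ennreal (norm (F z1 - F z2))
      else circle_Lp (enn2real p) (\<lambda>\<eta>. norm (F (cis \<eta> * z1) - F (cis \<eta> * z2))))"

definition Lp_circle :: "ennreal \<Rightarrow> (complex \<Rightarrow> 'a::real_normed_vector) set" where
  "Lp_circle p = {F.
     (\<lambda>\<eta>. F (cis \<eta>)) \<in> borel_measurable (lebesgue_on {0..2*pi}) \<and>
     (if p = \<infinity> then (\<exists>C. AE \<eta> in lebesgue_on {0..2*pi}. norm (F (cis \<eta>)) \<le> C)
      else circle_Lp (enn2real p) (\<lambda>\<eta>. norm (F (cis \<eta>))) < \<infinity>)}"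

definition Lambda_circle ::
    "(real \<Rightarrow> real) \<Rightarrow> ennreal \<Rightarrow> (complex \<Rightarrow> 'a::real_normed_vector) set" where
  "Lambda_circle \<omega> p = {F. F \<in> Lp_circle p \<and>
     (\<exists>M>0. \<forall>\<xi>1\<in>sphere 0 1. \<forall>\<xi>2\<in>sphere 0 1.
        Lp_diff p F \<xi>1 \<xi>2 \<le> ennreal (M * \<omega> (cmod (\<xi>1 - \<xi>2))))}"

definition Lambda_disk :: "(real \<Rightarrow> real) \<Rightarrow> ennreal \<Rightarrow> (complex \<Rightarrow> complex) set" where
  "Lambda_disk \<omega> p = {F. F \<in> borel_measurable (restrict_space borel (ball 0 1)) \<and>
     (\<exists>M>0. \<forall>z1\<in>ball 0 1. \<forall>z2\<in>ball 0 1.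
        Lp_diff p F z1 z2 \<le> ennreal (M * \<omega> (cmod (z1 - z2))))}"


section \<open>Partial derivatives and harmonic functions\<close>

definition partial_x :: "(complex \<Rightarrow> complex) \<Rightarrow> complex \<Rightarrow> complex" where
  "partial_x f z = vector_derivative (\<lambda>t. f (z + of_real t)) (at 0)"

definition partial_y :: "(complex \<Rightarrow> complex) \<Rightarrow> complex \<Rightarrow> complex" where
  "partial_y f z = vector_derivative (\<lambda>t. f (z + \<i> * of_real t)) (at 0)"

definition C1_on :: "complex set \<Rightarrow> (complex \<Rightarrow> complex) \<Rightarrow> bool" where
  "C1_on S f \<longleftrightarrow> (\<forall>z\<in>S. f differentiable (at z)) \<and>
     continuous_on S (partial_x f) \<and> continuous_on S (partial_y f)"

definition harmonic_on :: "complex set \<Rightarrow> (complex \<Rightarrow> complex) \<Rightarrow> bool" where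
  "harmonic_on S f \<longleftrightarrow> C1_on S f \<and> C1_on S (partial_x f) \<and> C1_on S (partial_y f) \<and>
     (\<forall>z\<in>S. partial_x (partial_x f) z + partial_y (partial_y f) z = 0)"


section \<open>Quasiregular mappings\<close>

definition wirtinger :: "(complex \<Rightarrow> complex) \<Rightarrow> complex \<Rightarrow> complex" where
  "wirtinger f z = (partial_x f z - \<i> * partial_y f z) / 2"

definition wirtinger_bar :: "(complex \<Rightarrow> complex) \<Rightarrow> complex \<Rightarrow> complex" where
  "wirtinger_bar f z = (partial_x f z + \<i> * partial_y f z) / 2"

definition jacobian_planar :: "(complex \<Rightarrow> complex) \<Rightarrow> complex \<Rightarrow> real" where
  "jacobian_planar f z = (cmod (wirtinger f z))\<^sup>2 - (cmod (wirtinger_bar f z))\<^sup>2"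

text \<open>Absolute continuity on \<open>[a,b]\<close>; \<open>D\<close> is a finite family of non-overlapping subintervals,
  each given by its pair of endpoints.\<close>

definition abs_continuous_on_interval :: "real \<Rightarrow> real \<Rightarrow> (real \<Rightarrow> complex) \<Rightarrow> bool" where
  "abs_continuous_on_interval a b g \<longleftrightarrow>
     (\<forall>\<epsilon>>0. \<exists>\<delta>>0. \<forall>D :: (real \<times> real) set.
        finite D \<and> (\<forall>(s,t)\<in>D. a \<le> s \<and> s \<le> t \<and> t \<le> b) \<and>
        pairwise (\<lambda>I J. disjnt {fst I<..<snd I} {fst J<..<snd J}) D \<and>
        (\<Sum>(s,t)\<in>D. t - s) < \<delta>
        \<longrightarrow> (\<Sum>(s,t)\<in>D. norm (g t - g s)) < \<epsilon>)"

text \<open>Absolute continuity on almost every horizontal and vertical segment of each closed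
  rectangle contained in \<open>S\<close>.\<close>

definition ACL_on :: "complex set \<Rightarrow> (complex \<Rightarrow> complex) \<Rightarrow> bool" where
  "ACL_on S f \<longleftrightarrow>
     (\<forall>a b c d. a < b \<and> c < d \<and> (\<forall>x\<in>{a..b}. \<forall>y\<in>{c..d}. Complex x y \<in> S) \<longrightarrow>
        (AE y in lebesgue_on {c..d}. abs_continuous_on_interval a b (\<lambda>x. f (Complex x y))) \<and>
        (AE x in lebesgue_on {a..b}. abs_continuous_on_interval c d (\<lambda>y. f (Complex x y))))"

definition locally_L2_on :: "complex set \<Rightarrow> (complex \<Rightarrow> complex) \<Rightarrow> bool" where
  "locally_L2_on S g \<longleftrightarrow>
     (\<forall>C. compact C \<and> C \<subseteq> S \<longrightarrow>
        g \<in> borel_measurable (lebesgue_on C) \<and>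
        integrable (lebesgue_on C) (\<lambda>z. (cmod (g z))\<^sup>2))"

text \<open>The partial derivatives of an ACL function exist almost everywhere, so the arbitrary
  values of \<^const>\<open>partial_x\<close> and \<^const>\<open>partial_y\<close> at the other points play no role.\<close>

definition ACL2_on :: "complex set \<Rightarrow> (complex \<Rightarrow> complex) \<Rightarrow> bool" where
  "ACL2_on S f \<longleftrightarrow> ACL_on S f \<and> locally_L2_on S (partial_x f) \<and> locally_L2_on S (partial_y f)"

text \<open>Sense-preserving in the topological sense: positive local degree on Jordan domains. For a
  positively oriented Jordan curve \<open>\<gamma>\<close>, the degree of \<open>f\<close> on the inside of \<open>\<gamma>\<close> at a
  point \<open>w\<close> off \<open>f(\<gamma>)\<close> is the winding number of \<open>f \<circ> \<gamma>\<close> about \<open>w\<close>.\<close>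

definition sense_preserving_on :: "complex set \<Rightarrow> (complex \<Rightarrow> complex) \<Rightarrow> bool" where
  "sense_preserving_on S f \<longleftrightarrow>
     (\<forall>\<gamma> w. simple_path \<gamma> \<and> pathfinish \<gamma> = pathstart \<gamma> \<and>
        path_image \<gamma> \<union> inside (path_image \<gamma>) \<subseteq> S \<and>
        (\<forall>z\<in>inside (path_image \<gamma>). winding_number \<gamma> z = 1) \<and>
        w \<in> f ` inside (path_image \<gamma>) - f ` path_image \<gamma>
        \<longrightarrow> Re (winding_number (f \<circ> \<gamma>) w) > 0)"

definition quasiregular_on :: "real \<Rightarrow> complex set \<Rightarrow> (complex \<Rightarrow> complex) \<Rightarrow> bool" where
  "quasiregular_on K S f \<longleftrightarrow>
     K \<ge> 1 \<and> continuous_on S f \<and> sense_preserving_on S f \<and> ACL2_on S f \<and>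
     (AE z in lebesgue_on S. jacobian_planar f z > 0) \<and>
     (AE z in lebesgue_on S.
        (cmod (wirtinger f z) + cmod (wirtinger_bar f z))\<^sup>2 \<le> K * jacobian_planar f z)"


section \<open>Poisson integral\<close>

definition poisson :: "(complex \<Rightarrow> real) \<Rightarrow> complex \<Rightarrow> real" where
  "poisson \<phi> z = 1 / (2 * pi) *
     (LINT \<tau>:{0..2*pi}|lborel. \<phi> (cis \<tau>) * ((1 - (cmod z)\<^sup>2) / (cmod (cis \<tau> - z))\<^sup>2))"

end

theory Submission
  imports Defs
begin

text \<open>
  Write \<open>d = 1 - \<bar>z\<bar>\<close>, let \<open>f = h + cnj g\<close> with \<open>h\<close> and \<open>g\<close> holomorphic, so that \<open>h'\<close> and \<open>cnj g'\<close> are the Wirtinger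
  derivatives of \<open>f\<close>, and call \<open>P[\<bar>f\<bar>] - \<bar>f\<bar>\<close> the Poisson defect. All norms are \<open>L\<^sup>p\<close> norms over the rotations of the
  points involved. Minkowski's integral inequality (\<open>Lp_bounded_integral\<close>) turns pointwise bounds by integrals into norm
  bounds, and the second regularity condition on \<open>\<omega>\<close> gives
  \<open>\<integral> \<omega>(\<bar>\<xi> - z\<bar>) / \<bar>\<xi> - z\<bar>\<^sup>2 \<le> C \<omega>(d) / d\<close> over the circle (\<open>kernel_majorant\<close>).

  From smoothness to the defect: the Poisson kernel has mean one, so the defect at \<open>z\<close> is at most the Poisson average of
  \<open>\<bar>f(\<xi>) - f(z)\<bar>\<close>. The norm of this difference is at most \<open>M \<omega>(\<bar>\<xi> - z\<bar>)\<close>, and the kernel estimate yields a multiple of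
  \<open>\<omega>(d)\<close> (\<open>poisson_defect_bound\<close>).

  From the defect to smoothness: fix \<open>z\<close> and a unimodular \<open>w\<close> with \<open>w f(z) = \<bar>f(z)\<bar>\<close>. On the circle
  \<open>\<psi> = \<bar>f\<bar> - Re (w f)\<close> is nonnegative, and its Poisson integral at \<open>z\<close> is exactly the defect. The gradient of the Poisson
  integral of a nonnegative function is at most \<open>2 / (1 - \<bar>z\<bar>\<^sup>2)\<close> times its value. Hence the gradient of \<open>Re (w f)\<close> at
  \<open>z\<close> is at most that of \<open>P[\<bar>f\<bar>]\<close>, which the smoothness of \<open>\<bar>f\<bar>\<close> on the circle controls, plus \<open>2 / d\<close> times the defect
  (\<open>derivative_gap_le\<close>). A quasiregular map distorts all directions comparably: the gradient of \<open>Re (w f)\<close> is at least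
  \<open>\<bar>h'\<bar> - \<bar>g'\<bar>\<close>, and \<open>\<bar>h'\<bar> + \<bar>g'\<bar> \<le> K (\<bar>h'\<bar> - \<bar>g'\<bar>)\<close>. So the norm of the full derivative is \<open>O(\<omega>(d) / d)\<close>
  (\<open>derivative_Lp_bound\<close>). Integration along two radii and a segment, with the first regularity condition on the radii,
  gives the smoothness of \<open>f\<close> (\<open>smoothness_from_derivative\<close>).
\<close>

section \<open>Minkowski's integral inequality\<close>

lemma powr_above_tangent:
  fixes c x q :: real
  assumes "0 < c" "0 \<le> x" "1 \<le> q"
  shows "q * c powr (q - 1) * x \<le> x powr q + (q - 1) * c powr q"
proof (cases "x = 0")
  case True
  with assms show ?thesis by simp
next
  case False
  with assms have x: "0 < x" by simp
  have "x powr q - c powr q \<ge> (q * c powr (q - 1)) * (x - c)"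
    using assms x
    by (intro convex_on_imp_above_tangent[OF powr_convex[OF \<open>1 \<le> q\<close>]])
       (auto intro!: derivative_eq_intros simp: interior_open)
  moreover have "c powr (q - 1) * c = c powr q"
    using assms by (simp add: powr_diff)
  then have "q * c powr (q - 1) * c = q * c powr q" by (simp add: mult.assoc)
  ultimately show ?thesis
    by (simp only: right_diff_distrib left_diff_distrib)
qed

text \<open>Jensen's inequality for the probability density \<open>m / A\<close> and the function \<open>A F / m\<close>, written with weights.
  It follows by integrating the tangent line inequality with its point of contact \<open>c = g\<close>; the term
  \<open>(q - 1) g\<^sup>q\<close> then occurs on both sides and cancels, since it is finite.\<close>

lemma powr_le_weighted_nn_integral:
  fixes g :: real and F m :: "'b \<Rightarrow> real"
  assumes q: "1 \<le> q"
    and F: "F \<in> borel_measurable N" "\<And>t. t \<in> space N \<Longrightarrow> 0 \<le> F t"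
    and m: "m \<in> borel_measurable N" "\<And>t. t \<in> space N \<Longrightarrow> 0 < m t"
    and A: "0 < A" "(\<integral>\<^sup>+t. ennreal (m t) \<partial>N) \<le> ennreal A"
    and g: "0 \<le> g" "ennreal g \<le> (\<integral>\<^sup>+t. ennreal (F t) \<partial>N)"
  shows "ennreal (g powr q) \<le> (\<integral>\<^sup>+t. ennreal (F t powr q * (A / m t) powr (q - 1)) \<partial>N)"
proof (cases "g = 0")
  case False
  with g have g0: "0 < g" by simp
  define c where "c = g powr (q - 1)"
  have c: "0 < c" "c * g = g powr q" using g0 by (auto simp: c_def powr_diff)
  note [measurable] = F(1) m(1)
  have pt: "q * c * F t \<le> F t powr q * (A / m t) powr (q - 1) + ((q - 1) * g powr q / A) * m t"
    if t: "t \<in> space N" for t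
  proof -
    have Am: "0 < A / m t" using A m(2)[OF t] by simp
    have "q * c * (F t * (A / m t)) \<le> (F t * (A / m t)) powr q + (q - 1) * g powr q"
      using powr_above_tangent[OF g0 mult_nonneg_nonneg[OF F(2)[OF t] less_imp_le[OF Am]] q]
      unfolding c_def .
    then have "q * c * (F t * (A / m t)) / (A / m t)
        \<le> ((F t * (A / m t)) powr q + (q - 1) * g powr q) / (A / m t)"
      using Am by (intro divide_right_mono) auto
    moreover have "q * c * (F t * (A / m t)) / (A / m t) = q * c * F t"
      using Am A m(2)[OF t] by auto
    moreover have "(F t * (A / m t)) powr q / (A / m t) = F t powr q * (A / m t) powr (q - 1)"
    proof -
      have "(F t * (A / m t)) powr q = F t powr q * (A / m t) powr q"
        by (rule powr_mult)
      then show ?thesis using Am by (simp only: powr_diff powr_one times_divide_eq_right)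
    qed
    moreover have "(q - 1) * g powr q / (A / m t) = ((q - 1) * g powr q / A) * m t"
      using A m(2)[OF t] by (simp add: field_simps)
    ultimately show ?thesis
      by (simp only: add_divide_distrib)
  qed
  have "ennreal (q * g powr q) = ennreal (q * c) * ennreal g"
    using c q g0 by (simp add: ennreal_mult' [symmetric] mult.assoc)
  also have "\<dots> \<le> ennreal (q * c) * (\<integral>\<^sup>+t. ennreal (F t) \<partial>N)"
    by (intro mult_left_mono g) simp
  also have "\<dots> = (\<integral>\<^sup>+t. ennreal (q * c * F t) \<partial>N)"
    using q c by (subst nn_integral_cmult[symmetric]) (auto simp: ennreal_mult')
  also have "\<dots> \<le> (\<integral>\<^sup>+t. ennreal (F t powr q * (A / m t) powr (q - 1))
                      + ennreal (((q - 1) * g powr q / A) * m t) \<partial>N)"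
  proof (rule nn_integral_mono)
    fix t assume t: "t \<in> space N"
    have "0 \<le> (q - 1) * g powr q / A * m t" using q A m(2)[OF t] by simp
    then show "ennreal (q * c * F t) \<le> ennreal (F t powr q * (A / m t) powr (q - 1))
        + ennreal (((q - 1) * g powr q / A) * m t)"
      using pt[OF t] by (subst ennreal_plus[symmetric]) (auto intro!: ennreal_leI simp del: ennreal_plus)
  qed
  also have "\<dots> = (\<integral>\<^sup>+t. ennreal (F t powr q * (A / m t) powr (q - 1)) \<partial>N)
                   + ennreal ((q - 1) * g powr q / A) * (\<integral>\<^sup>+t. ennreal (m t) \<partial>N)"
  proof -
    have "(\<integral>\<^sup>+t. ennreal (((q - 1) * g powr q / A) * m t) \<partial>N)
        = (\<integral>\<^sup>+t. ennreal ((q - 1) * g powr q / A) * ennreal (m t) \<partial>N)"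
      using q A by (intro nn_integral_cong ennreal_mult') simp
    then show ?thesis
      by (subst nn_integral_add) (auto simp: nn_integral_cmult)
  qed
  also have "\<dots> \<le> (\<integral>\<^sup>+t. ennreal (F t powr q * (A / m t) powr (q - 1)) \<partial>N)
                   + ennreal ((q - 1) * g powr q / A) * ennreal A"
    by (intro add_left_mono mult_left_mono A) simp
  also have "ennreal ((q - 1) * g powr q / A) * ennreal A = ennreal ((q - 1) * g powr q)"
    using A q by (simp add: ennreal_mult'[symmetric])
  also have "ennreal (q * g powr q) = ennreal (g powr q) + ennreal ((q - 1) * g powr q)"
  proof -
    have "q * g powr q = g powr q + (q - 1) * g powr q" by (simp add: algebra_simps)
    then show ?thesis using q by (simp only: ennreal_plus powr_ge_zero mult_nonneg_nonneg diff_ge_0_iff_ge)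
  qed
  finally have "ennreal (g powr q) + ennreal ((q - 1) * g powr q)
      \<le> (\<integral>\<^sup>+t. ennreal (F t powr q * (A / m t) powr (q - 1)) \<partial>N) + ennreal ((q - 1) * g powr q)" .
  then show ?thesis
    unfolding add.commute[of _ "ennreal ((q - 1) * g powr q)"] ennreal_add_left_cancel_le by simp
qed simp

text \<open>The weight \<open>m\<close> is the bound for the slice norms themselves. With this choice Tonelli's theorem turns
  Jensen's inequality, integrated over \<open>x\<close>, into \<open>A\<^bsup>q - 1\<^esup> \<integral> m\<^bsup>1 - q\<^esup> m\<^sup>q = A\<^bsup>q - 1\<^esup> \<integral> m\<close>.\<close>

lemma minkowski_integral_pos:
  fixes G :: "'a \<Rightarrow> 'b \<Rightarrow> real" and m :: "'b \<Rightarrow> real"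
  assumes M: "sigma_finite_measure M" and N: "sigma_finite_measure N" and q: "1 \<le> q"
    and G: "(\<lambda>(x, t). G x t) \<in> borel_measurable (M \<Otimes>\<^sub>M N)"
      "\<And>x t. x \<in> space M \<Longrightarrow> t \<in> space N \<Longrightarrow> 0 \<le> G x t"
    and m: "m \<in> borel_measurable N" "\<And>t. t \<in> space N \<Longrightarrow> 0 < m t"
    and A: "0 < A" "(\<integral>\<^sup>+t. ennreal (m t) \<partial>N) \<le> ennreal A"
    and slice: "\<And>t. t \<in> space N \<Longrightarrow> (\<integral>\<^sup>+x. ennreal (G x t powr q) \<partial>M) \<le> ennreal (m t powr q)"
    and g: "\<And>x. x \<in> space M \<Longrightarrow> 0 \<le> g x"
      "\<And>x. x \<in> space M \<Longrightarrow> ennreal (g x) \<le> (\<integral>\<^sup>+t. ennreal (G x t) \<partial>N)"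
  shows "(\<integral>\<^sup>+x. ennreal (g x powr q) \<partial>M) \<le> ennreal (A powr q)"
proof -
  interpret M: sigma_finite_measure M by fact
  interpret N: sigma_finite_measure N by fact
  interpret MN: pair_sigma_finite M N ..
  note [measurable] = G(1) m(1)
  have Gt: "(\<lambda>t. G x t) \<in> borel_measurable N" if "x \<in> space M" for x
    using measurable_Pair2[OF G(1) that] by simp
  have Gx: "(\<lambda>x. G x t) \<in> borel_measurable M" if "t \<in> space N" for t
    using measurable_Pair1[OF G(1) that] by simp
  have "(\<integral>\<^sup>+x. ennreal (g x powr q) \<partial>M)
      \<le> (\<integral>\<^sup>+x. (\<integral>\<^sup>+t. ennreal (G x t powr q * (A / m t) powr (q - 1)) \<partial>N) \<partial>M)"
    using q G(2) m A g Gt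
    by (intro nn_integral_mono powr_le_weighted_nn_integral) auto
  also have "\<dots> = (\<integral>\<^sup>+t. (\<integral>\<^sup>+x. ennreal (G x t powr q * (A / m t) powr (q - 1)) \<partial>M) \<partial>N)"
    by (rule MN.Fubini'[symmetric]) measurable
  also have "\<dots> \<le> (\<integral>\<^sup>+t. ennreal (A powr (q - 1)) * ennreal (m t) \<partial>N)"
  proof (rule nn_integral_mono)
    fix t assume t: "t \<in> space N"
    note [measurable] = Gx[OF t]
    have "(\<integral>\<^sup>+x. ennreal (G x t powr q * (A / m t) powr (q - 1)) \<partial>M)
        = (\<integral>\<^sup>+x. ennreal (G x t powr q) \<partial>M) * ennreal ((A / m t) powr (q - 1))"
      by (subst nn_integral_multc[symmetric]) (auto simp: ennreal_mult')
    also have "\<dots> \<le> ennreal (m t powr q) * ennreal ((A / m t) powr (q - 1))"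
      by (intro mult_right_mono slice t) simp
    also have "\<dots> = ennreal (A powr (q - 1) * m t)"
      using A m(2)[OF t]
      by (subst ennreal_mult'[symmetric]) (auto simp: powr_divide powr_diff field_simps)
    also have "\<dots> = ennreal (A powr (q - 1)) * ennreal (m t)"
      by (simp add: ennreal_mult')
    finally show "(\<integral>\<^sup>+x. ennreal (G x t powr q * (A / m t) powr (q - 1)) \<partial>M)
        \<le> ennreal (A powr (q - 1)) * ennreal (m t)" .
  qed
  also have "\<dots> = ennreal (A powr (q - 1)) * (\<integral>\<^sup>+t. ennreal (m t) \<partial>N)"
    by (simp add: nn_integral_cmult)
  also have "\<dots> \<le> ennreal (A powr (q - 1)) * ennreal A"
    by (intro mult_left_mono A) simp
  also have "\<dots> = ennreal (A powr q)"
    using A by (simp add: ennreal_mult'[symmetric] powr_diff)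
  finally show ?thesis .
qed

lemma ennreal_powr_le_limit:
  assumes "1 \<le> q" "0 \<le> A" "0 \<le> c"
    and le: "\<And>\<epsilon>. 0 < \<epsilon> \<Longrightarrow> I \<le> ennreal ((A + \<epsilon> * c) powr q)"
  shows "I \<le> ennreal (A powr q)"
proof (rule tendsto_lowerbound)
  show "((\<lambda>\<epsilon>. ennreal ((A + \<epsilon> * c) powr q)) \<longlongrightarrow> ennreal (A powr q)) (at_right 0)"
  proof (intro tendsto_ennrealI)
    have "continuous (at_right 0) (\<lambda>\<epsilon>. (A + \<epsilon> * c) powr q)"
      using assms
      by (auto intro!: continuous_intros tendsto_eq_intros simp: continuous_within eventually_at_filter)
    then show "((\<lambda>\<epsilon>. (A + \<epsilon> * c) powr q) \<longlongrightarrow> A powr q) (at_right 0)"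
      by (simp add: continuous_within)
  qed
  show "\<forall>\<^sub>F \<epsilon> in at_right 0. I \<le> ennreal ((A + \<epsilon> * c) powr q)"
    by (auto simp: eventually_at_filter intro!: always_eventually le)
qed simp

text \<open>A bound \<open>m\<close> that may vanish is reached from \<open>m + \<epsilon>\<close>; finiteness of \<open>N\<close> makes the added mass tend to \<open>0\<close>.\<close>

lemma minkowski_integral:
  fixes G :: "'a \<Rightarrow> 'b \<Rightarrow> real" and m :: "'b \<Rightarrow> real"
  assumes M: "sigma_finite_measure M" and N: "finite_measure N" and q: "1 \<le> q"
    and G: "(\<lambda>(x, t). G x t) \<in> borel_measurable (M \<Otimes>\<^sub>M N)"
      "\<And>x t. x \<in> space M \<Longrightarrow> t \<in> space N \<Longrightarrow> 0 \<le> G x t"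
    and m: "m \<in> borel_measurable N" "\<And>t. t \<in> space N \<Longrightarrow> 0 \<le> m t"
    and A: "0 \<le> A" "(\<integral>\<^sup>+t. ennreal (m t) \<partial>N) \<le> ennreal A"
    and slice: "\<And>t. t \<in> space N \<Longrightarrow> (\<integral>\<^sup>+x. ennreal (G x t powr q) \<partial>M) \<le> ennreal (m t powr q)"
    and g: "\<And>x. x \<in> space M \<Longrightarrow> 0 \<le> g x"
      "\<And>x. x \<in> space M \<Longrightarrow> ennreal (g x) \<le> (\<integral>\<^sup>+t. ennreal (G x t) \<partial>N)"
  shows "(\<integral>\<^sup>+x. ennreal (g x powr q) \<partial>M) \<le> ennreal (A powr q)"
proof -
  interpret N: finite_measure N by fact
  define c where "c = 1 + measure N (space N)"
  have c: "0 < c" unfolding c_def by (simp add: add_pos_nonneg)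
  have step: "(\<integral>\<^sup>+x. ennreal (g x powr q) \<partial>M) \<le> ennreal ((A + \<epsilon> * c) powr q)"
    if \<epsilon>: "0 < \<epsilon>" for \<epsilon>
  proof (rule minkowski_integral_pos[OF M _ q G, where m = "\<lambda>t. m t + \<epsilon>"])
    show "sigma_finite_measure N" ..
    show "(\<lambda>t. m t + \<epsilon>) \<in> borel_measurable N" using m(1) by measurable
    show "0 < m t + \<epsilon>" if "t \<in> space N" for t using m(2)[OF that] \<epsilon> by simp
    show "0 < A + \<epsilon> * c" using A \<epsilon> c by (simp add: add_nonneg_pos)
    have "(\<integral>\<^sup>+t. ennreal (m t + \<epsilon>) \<partial>N) = (\<integral>\<^sup>+t. ennreal (m t) + ennreal \<epsilon> \<partial>N)"
      using m(2) \<epsilon> by (intro nn_integral_cong) (simp add: ennreal_plus)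
    also have "\<dots> = (\<integral>\<^sup>+t. ennreal (m t) \<partial>N) + ennreal (\<epsilon> * measure N (space N))"
      using m(1) \<epsilon> by (simp add: nn_integral_add N.emeasure_eq_measure ennreal_mult'[symmetric])
    also have "\<dots> \<le> ennreal A + ennreal (\<epsilon> * measure N (space N))"
      by (intro add_right_mono A)
    also have "\<dots> \<le> ennreal (A + \<epsilon> * c)"
      using A \<epsilon> by (simp add: ennreal_plus[symmetric] c_def algebra_simps del: ennreal_plus)
    finally show "(\<integral>\<^sup>+t. ennreal (m t + \<epsilon>) \<partial>N) \<le> ennreal (A + \<epsilon> * c)" .
    show "(\<integral>\<^sup>+x. ennreal (G x t powr q) \<partial>M) \<le> ennreal ((m t + \<epsilon>) powr q)"
      if "t \<in> space N" for t
      using slice[OF that] m(2)[OF that] \<epsilon> q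
      by (rule_tac order_trans[OF _ ennreal_leI[OF powr_mono2[of q "m t"]]]) auto
  qed (use g in auto)
  show ?thesis
    by (rule ennreal_powr_le_limit[OF q A(1) less_imp_le[OF c] step])
qed

section \<open>Bounds in \<open>L\<^sup>p\<close> of the circle of rotations\<close>

definition rotations :: "real measure" where
  "rotations = restrict_space lborel {0..2*pi}"

text \<open>The upper bound \<open>B\<close> for the \<open>L\<^sup>p\<close> norm of a nonnegative function of the rotation angle. For \<open>p = \<infinity>\<close> the
  bound is required at every angle, not only almost everywhere, because the conditions of the theorem are pointwise
  in that case.\<close>

definition Lp_bounded :: "ennreal \<Rightarrow> (real \<Rightarrow> real) \<Rightarrow> real \<Rightarrow> bool" where
  "Lp_bounded p g B \<longleftrightarrow>
     (if p = \<infinity> then (\<forall>\<eta>. g \<eta> \<le> B) else circle_Lp (enn2real p) g \<le> ennreal B)"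

lemma finite_measure_restrict_lborel:
  assumes "S \<in> sets borel" "bounded S"
  shows "finite_measure (restrict_space lborel (S :: real set))"
  using assms emeasure_bounded_finite[OF assms(2)]
  by (intro finite_measureI) (auto simp: emeasure_restrict_space)

lemma finite_measure_rotations: "finite_measure rotations"
  unfolding rotations_def by (rule finite_measure_restrict_lborel) auto

lemma circle_Lp_le_iff:
  assumes q: "0 < q" and B: "0 \<le> B"
  shows "circle_Lp q g \<le> ennreal B \<longleftrightarrow>
    (\<integral>\<^sup>+\<eta>. ennreal (g \<eta> powr q) \<partial>rotations) \<le> ennreal (B powr q)"
proof -
  define I where "I = (\<integral>\<^sup>+\<eta>. ennreal (g \<eta> powr q) \<partial>rotations)"
  have eq: "(\<integral>\<^sup>+\<eta>. ennreal (g \<eta> powr q) \<partial>lebesgue_on {0..2*pi}) = I"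
    unfolding I_def rotations_def
    by (simp add: nn_integral_restrict_space nn_integral_completion)
  show ?thesis
  proof (cases "I = \<infinity>")
    case True
    then show ?thesis
      unfolding circle_Lp_def eq I_def[symmetric] by (simp add: ennreal_neq_top top_unique)
  next
    case False
    then obtain r where r: "I = ennreal r" "0 \<le> r" by (cases I) auto
    have "r powr (1 / q) \<le> B \<longleftrightarrow> r \<le> B powr q"
    proof
      assume "r powr (1 / q) \<le> B"
      then have "(r powr (1 / q)) powr q \<le> B powr q"
        using q by (intro powr_mono2) auto
      then show "r \<le> B powr q" using q r by (simp add: powr_powr)
    next
      assume "r \<le> B powr q"
      then have "r powr (1 / q) \<le> (B powr q) powr (1 / q)"
        using q r by (intro powr_mono2) auto
      then show "r powr (1 / q) \<le> B" using q B by (simp add: powr_powr)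
    qed
    then show ?thesis
      unfolding circle_Lp_def eq I_def[symmetric] using r B by (simp add: ennreal_le_iff)
  qed
qed

lemma enn2real_ge_1: "1 \<le> p \<Longrightarrow> p \<noteq> \<infinity> \<Longrightarrow> 1 \<le> enn2real p"
  by (cases p) auto

lemma Lp_bounded_finite_iff:
  assumes "1 \<le> p" "p \<noteq> \<infinity>" "0 \<le> B"
  shows "Lp_bounded p g B \<longleftrightarrow>
    (\<integral>\<^sup>+\<eta>. ennreal (g \<eta> powr enn2real p) \<partial>rotations) \<le> ennreal (B powr enn2real p)"
  using enn2real_ge_1[OF assms(1,2)] assms by (simp add: Lp_bounded_def circle_Lp_le_iff)

lemma Lp_bounded_mono:
  assumes p: "1 \<le> p" and g: "Lp_bounded p g B" and B: "0 \<le> B"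
    and h: "\<And>\<eta>. 0 \<le> h \<eta>" "\<And>\<eta>. h \<eta> \<le> g \<eta>" "B \<le> C"
  shows "Lp_bounded p h C"
proof (cases "p = \<infinity>")
  case True
  with g h show ?thesis by (auto simp: Lp_bounded_def) (meson order_trans)
next
  case False
  note q = enn2real_ge_1[OF p False]
  have "(\<integral>\<^sup>+\<eta>. ennreal (h \<eta> powr enn2real p) \<partial>rotations)
      \<le> (\<integral>\<^sup>+\<eta>. ennreal (g \<eta> powr enn2real p) \<partial>rotations)"
    using q h by (intro nn_integral_mono ennreal_leI powr_mono2) auto
  also have "\<dots> \<le> ennreal (B powr enn2real p)"
    using g p False B by (simp add: Lp_bounded_finite_iff)
  also have "\<dots> \<le> ennreal (C powr enn2real p)"
    using q h B by (intro ennreal_leI powr_mono2) auto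
  finally show ?thesis using p False B h by (simp add: Lp_bounded_finite_iff)
qed

text \<open>Minkowski's integral inequality for all exponents at once, in the form in which it lifts a pointwise bound by an
  integral to the \<open>L\<^sup>p\<close> norm.\<close>

lemma Lp_bounded_integral:
  fixes G :: "real \<Rightarrow> 'b \<Rightarrow> real" and m :: "'b \<Rightarrow> real"
  assumes p: "1 \<le> p" and N: "finite_measure N"
    and G: "(\<lambda>(x, t). G x t) \<in> borel_measurable (borel \<Otimes>\<^sub>M N)"
      "\<And>\<eta> t. t \<in> space N \<Longrightarrow> 0 \<le> G \<eta> t"
    and m: "m \<in> borel_measurable N" "\<And>t. t \<in> space N \<Longrightarrow> 0 \<le> m t"
    and A: "0 \<le> A" "(\<integral>\<^sup>+t. ennreal (m t) \<partial>N) \<le> ennreal A"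
    and slice: "\<And>t. t \<in> space N \<Longrightarrow> Lp_bounded p (\<lambda>\<eta>. G \<eta> t) (m t)"
    and g: "\<And>\<eta>. 0 \<le> g \<eta>" "\<And>\<eta>. ennreal (g \<eta>) \<le> (\<integral>\<^sup>+t. ennreal (G \<eta> t) \<partial>N)"
  shows "Lp_bounded p g A"
proof (cases "p = \<infinity>")
  case True
  have "g \<eta> \<le> A" for \<eta>
  proof -
    have "ennreal (g \<eta>) \<le> (\<integral>\<^sup>+t. ennreal (G \<eta> t) \<partial>N)" by (rule g)
    also have "\<dots> \<le> (\<integral>\<^sup>+t. ennreal (m t) \<partial>N)"
      using slice True by (intro nn_integral_mono ennreal_leI) (auto simp: Lp_bounded_def)
    also have "\<dots> \<le> ennreal A" by (rule A)
    finally show ?thesis using A by (simp add: ennreal_le_iff)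
  qed
  then show ?thesis using True by (simp add: Lp_bounded_def)
next
  case False
  note q = enn2real_ge_1[OF p False]
  have "(\<integral>\<^sup>+\<eta>. ennreal (g \<eta> powr enn2real p) \<partial>rotations) \<le> ennreal (A powr enn2real p)"
  proof (rule minkowski_integral[OF _ N q _ _ m A])
    show "sigma_finite_measure rotations"
      using finite_measure_rotations by (simp add: finite_measure_def)
    have "(\<lambda>z. z) \<in> rotations \<Otimes>\<^sub>M N \<rightarrow>\<^sub>M borel \<Otimes>\<^sub>M N"
    proof -
      have "(\<lambda>z. (fst z, snd z)) \<in> rotations \<Otimes>\<^sub>M N \<rightarrow>\<^sub>M borel \<Otimes>\<^sub>M N"
      proof (rule measurable_Pair)
        have "(\<lambda>x. x) \<in> rotations \<rightarrow>\<^sub>M borel"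
          unfolding rotations_def by (rule measurable_restrict_space1) simp
        then show "fst \<in> rotations \<Otimes>\<^sub>M N \<rightarrow>\<^sub>M borel"
          using measurable_compose[OF measurable_fst] by blast
      qed measurable
      then show ?thesis by simp
    qed
    from measurable_compose[OF this G(1)]
    show "(\<lambda>(x, t). G x t) \<in> borel_measurable (rotations \<Otimes>\<^sub>M N)" by simp
  qed (use G g slice m p False in \<open>auto simp: Lp_bounded_finite_iff\<close>)
  then show ?thesis using p False A by (simp add: Lp_bounded_finite_iff)
qed

text \<open>The triangle inequality is Minkowski's inequality for an integral over two points.\<close>

lemma Lp_bounded_add:
  assumes p: "1 \<le> p"
    and g: "Lp_bounded p g1 B1" "Lp_bounded p g2 B2" "0 \<le> B1" "0 \<le> B2"
    and meas: "g1 \<in> borel_measurable borel" "g2 \<in> borel_measurable borel"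
    and nonneg: "\<And>\<eta>. 0 \<le> g1 \<eta>" "\<And>\<eta>. 0 \<le> g2 \<eta>"
  shows "Lp_bounded p (\<lambda>\<eta>. g1 \<eta> + g2 \<eta>) (B1 + B2)"
proof (rule Lp_bounded_integral[OF p, where N = "count_space (UNIV :: bool set)"
      and G = "\<lambda>\<eta> b. if b then g1 \<eta> else g2 \<eta>" and m = "\<lambda>b. if b then B1 else B2"])
  show "finite_measure (count_space (UNIV :: bool set))"
    by (rule finite_measure_count_space) simp
  show "(\<lambda>(\<eta>, b). if b then g1 \<eta> else g2 \<eta>) \<in> borel_measurable (borel \<Otimes>\<^sub>M count_space (UNIV :: bool set))"
    using meas by measurable
qed (use g nonneg in \<open>auto simp: nn_integral_count_space_finite UNIV_bool\<close>)

lemma Lp_bounded_cmult: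
  assumes p: "1 \<le> p" and g: "Lp_bounded p g B" "0 \<le> B" "\<And>\<eta>. 0 \<le> g \<eta>" and c: "0 \<le> c"
    and meas: "g \<in> borel_measurable borel"
  shows "Lp_bounded p (\<lambda>\<eta>. c * g \<eta>) (c * B)"
proof (cases "p = \<infinity>")
  case True
  with g c show ?thesis by (auto simp: Lp_bounded_def intro!: mult_left_mono)
next
  case False
  have [measurable]: "g \<in> borel_measurable rotations"
    unfolding rotations_def using meas by (intro measurable_restrict_space1) simp
  have "(\<integral>\<^sup>+\<eta>. ennreal ((c * g \<eta>) powr enn2real p) \<partial>rotations)
      = ennreal (c powr enn2real p) * (\<integral>\<^sup>+\<eta>. ennreal (g \<eta> powr enn2real p) \<partial>rotations)"
    using c g(3) by (subst nn_integral_cmult[symmetric]) (auto simp: powr_mult ennreal_mult')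
  also have "\<dots> \<le> ennreal (c powr enn2real p) * ennreal (B powr enn2real p)"
    using g p False by (intro mult_left_mono) (auto simp: Lp_bounded_finite_iff)
  also have "\<dots> = ennreal ((c * B) powr enn2real p)"
    using c g by (simp add: powr_mult ennreal_mult')
  finally show ?thesis using p False c g by (simp add: Lp_bounded_finite_iff)
qed

text \<open>Fatou's lemma.\<close>

lemma Lp_bounded_tendsto:
  assumes p: "1 \<le> p" and lim: "\<And>\<eta>. (\<lambda>n. g n \<eta>) \<longlonglongrightarrow> h \<eta>" "B \<longlonglongrightarrow> C"
    and g: "\<And>n. Lp_bounded p (g n) (B n)" "\<And>n. 0 \<le> B n" "\<And>n. g n \<in> borel_measurable borel"
      "\<And>n \<eta>. 0 \<le> g n \<eta>"
  shows "Lp_bounded p h C"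
proof (cases "p = \<infinity>")
  case True
  then have "h \<eta> \<le> C" for \<eta>
    using g(1) by (intro LIMSEQ_le[OF lim]) (auto simp: Lp_bounded_def)
  with True show ?thesis by (simp add: Lp_bounded_def)
next
  case False
  note q = enn2real_ge_1[OF p False]
  have C: "0 \<le> C" using g(2) lim(2) by (intro LIMSEQ_le_const) auto
  have [measurable]: "g n \<in> borel_measurable rotations" for n
    unfolding rotations_def using g(3) by (intro measurable_restrict_space1) simp
  have lims: "(\<lambda>n. ennreal (g n \<eta> powr enn2real p)) \<longlonglongrightarrow> ennreal (h \<eta> powr enn2real p)" for \<eta>
    using q g(4) lim(1)[of \<eta>] by (intro tendsto_ennrealI tendsto_powr') auto
  have "(\<integral>\<^sup>+\<eta>. ennreal (h \<eta> powr enn2real p) \<partial>rotations)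
      = (\<integral>\<^sup>+\<eta>. liminf (\<lambda>n. ennreal (g n \<eta> powr enn2real p)) \<partial>rotations)"
    by (intro nn_integral_cong lim_imp_Liminf[symmetric] lims) simp
  also have "\<dots> \<le> liminf (\<lambda>n. \<integral>\<^sup>+\<eta>. ennreal (g n \<eta> powr enn2real p) \<partial>rotations)"
    by (rule nn_integral_liminf) measurable
  also have "\<dots> \<le> liminf (\<lambda>n. ennreal (B n powr enn2real p))"
    using g p False by (intro Liminf_mono always_eventually) (auto simp: Lp_bounded_finite_iff)
  also have "\<dots> = ennreal (C powr enn2real p)"
    using q g(2) lim by (intro lim_imp_Liminf tendsto_ennrealI tendsto_powr') auto
  finally show ?thesis using p False C by (simp add: Lp_bounded_finite_iff)
qed

section \<open>Majorants\<close>

lemma majorant_nonneg: "majorant \<omega> \<Longrightarrow> 0 \<le> t \<Longrightarrow> 0 \<le> \<omega> t"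
  by (simp add: majorant_def)

lemma majorant_mono: "majorant \<omega> \<Longrightarrow> 0 \<le> s \<Longrightarrow> s \<le> t \<Longrightarrow> \<omega> s \<le> \<omega> t"
  by (auto simp: majorant_def mono_on_def)

lemma majorant_ratio: "majorant \<omega> \<Longrightarrow> 0 < s \<Longrightarrow> s \<le> t \<Longrightarrow> \<omega> t / t \<le> \<omega> s / s"
  by (simp add: majorant_def)

lemma majorant_ratio_square:
  assumes \<omega>: "majorant \<omega>" and s: "0 < s" "s \<le> t"
  shows "\<omega> t / t\<^sup>2 \<le> \<omega> s / s\<^sup>2"
proof -
  have "\<omega> t / t * (1 / t) \<le> \<omega> s / s * (1 / s)"
    using s majorant_nonneg[OF \<omega>, of s] majorant_nonneg[OF \<omega>, of t]
    by (intro mult_mono majorant_ratio[OF \<omega>]) (auto simp: field_simps)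
  then show ?thesis by (simp add: power2_eq_square)
qed

lemma majorant_double:
  assumes \<omega>: "majorant \<omega>" and s: "0 \<le> s" "s \<le> 2 * t"
  shows "\<omega> s \<le> 2 * \<omega> t"
proof (cases "t = 0")
  case True
  with s \<omega> show ?thesis by (simp add: majorant_def)
next
  case False
  with s have t: "0 < t" by auto
  have "\<omega> (2 * t) / (2 * t) \<le> \<omega> t / t" using t by (intro majorant_ratio[OF \<omega>]) auto
  then have "\<omega> (2 * t) \<le> 2 * \<omega> t" using t by (simp add: field_simps)
  then show ?thesis using majorant_mono[OF \<omega> s] by simp
qed

lemma continuous_on_majorant:
  assumes "majorant \<omega>" "continuous_on S g" "\<And>x. x \<in> S \<Longrightarrow> 0 \<le> g x"
  shows "continuous_on S (\<lambda>x. \<omega> (g x))"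
  using assms by (intro continuous_on_compose2[of "{0..}" \<omega> S g]) (auto simp: majorant_def)

section \<open>The kernel \<open>1 / \<bar>e\<^sup>i\<^sup>\<tau> - r\<bar>\<^sup>2\<close> against a regular majorant\<close>

lemma dist_cis_ge:
  assumes "0 \<le> r" "r < 1"
  shows "1 - r \<le> cmod (cis \<tau> - of_real r)"
  using norm_triangle_ineq2[of "cis \<tau>" "of_real r"] assms by simp

text \<open>The point \<open>r\<close> is no farther from \<open>1\<close> than from any other point of the circle, so distances to \<open>r\<close> and
  to its radial projection \<open>1\<close> are comparable.\<close>

lemma norm_cis_minus_1_le:
  assumes "0 \<le> r" "r < 1"
  shows "cmod (cis \<tau> - 1) \<le> 2 * cmod (cis \<tau> - of_real r)"
proof -
  have "cmod (cis \<tau> - 1) \<le> cmod (cis \<tau> - of_real r) + cmod (of_real r - 1)"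
    using norm_triangle_ineq[of "cis \<tau> - of_real r" "of_real r - 1"] by simp
  also have "cmod (of_real r - 1) = 1 - r"
    using assms by (metis abs_minus_commute abs_of_nonneg diff_ge_0_iff_ge less_imp_le norm_of_real of_real_1 of_real_diff)
  finally show ?thesis using dist_cis_ge[OF assms, of \<tau>] by simp
qed

lemma sin_half_ge:
  fixes \<tau> :: real
  assumes "0 \<le> \<tau>" "\<tau> \<le> pi"
  shows "\<tau> / pi \<le> sin (\<tau> / 2)"
proof -
  have "concave_on {0..pi} sin"
    unfolding concave_on_def
    by (rule f''_ge0_imp_convex[where f' = "\<lambda>x. - cos x" and f'' = sin])
       (auto intro!: derivative_eq_intros sin_ge_zero)
  then have "sin ((1 - \<tau> / pi) * 0 + (\<tau> / pi) * (pi / 2)) \<ge> (1 - \<tau> / pi) * sin 0 + (\<tau> / pi) * sin (pi / 2)"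
    using assms by (intro concave_onD[where A = "{0..pi}", unfolded real_scaleR_def]) (auto simp: field_simps)
  then show ?thesis by simp
qed

lemma norm_cis_minus_1:
  "cmod (cis \<tau> - 1) = 2 * \<bar>sin (\<tau> / 2)\<bar>"
proof -
  have "(cmod (cis \<tau> - 1))\<^sup>2 = (cos \<tau> - 1)\<^sup>2 + (sin \<tau>)\<^sup>2"
    by (simp add: cmod_power2)
  also have "\<dots> = 2 * (1 - cos \<tau>)"
    using sin_cos_squared_add[of \<tau>] by (simp add: power2_eq_square algebra_simps)
  also have "\<dots> = (2 * \<bar>sin (\<tau> / 2)\<bar>)\<^sup>2"
    using cos_double_sin[of "\<tau> / 2"] by (simp add: power_mult_distrib)
  finally show ?thesis by (rule power2_eq_imp_eq) auto
qed

text \<open>By the comparison with the point \<open>1\<close>, half of the chord \<open>2 sin (\<tau> / 2)\<close> is a lower bound, and the sine is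
  concave on \<open>[0, \<pi>]\<close>.\<close>

lemma dist_cis_ge_angle:
  assumes r: "0 \<le> r" "r < 1" and \<tau>: "0 \<le> \<tau>" "\<tau> \<le> 2 * pi"
  shows "min \<tau> (2 * pi - \<tau>) / pi \<le> cmod (cis \<tau> - of_real r)"
proof -
  have "min \<tau> (2 * pi - \<tau>) / pi \<le> sin (\<tau> / 2)"
  proof (cases "\<tau> \<le> pi")
    case True
    then show ?thesis using sin_half_ge[of \<tau>] \<tau> by (simp add: min_def)
  next
    case False
    have "sin ((2 * pi - \<tau>) / 2) = sin (\<tau> / 2)"
      using sin_pi_minus[of "\<tau> / 2"] by (simp add: diff_divide_distrib)
    then show ?thesis using sin_half_ge[of "2 * pi - \<tau>"] \<tau> False by (simp add: min_def)
  qed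
  also have "\<dots> \<le> cmod (cis \<tau> - of_real r)"
    using norm_cis_minus_1_le[OF r, of \<tau>] unfolding norm_cis_minus_1 by simp
  finally show ?thesis .
qed

text \<open>The quotient \<open>\<omega>(t) / t\<^sup>2\<close> decreases, and the distance from \<open>e\<^sup>i\<^sup>\<tau>\<close> to \<open>r\<close> is at least \<open>d = 1 - r\<close> and at least
  the angle divided by \<open>\<pi>\<close>. So each half of the circle contributes at most \<open>\<pi>\<close> times the integral of
  \<open>\<omega>(t) / t\<^sup>2\<close> over \<open>t \<ge> d\<close> plus that of the constant \<open>\<omega>(d) / d\<^sup>2\<close> over \<open>[0, d]\<close>.\<close>

lemma kernel_majorant_small:
  assumes \<omega>: "majorant \<omega>" and d: "0 < d" and r: "0 \<le> r" "d = 1 - r" and M: "0 \<le> M"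
    and tail: "ennreal d * (\<integral>\<^sup>+t\<in>{d..}. ennreal (\<omega> t / t\<^sup>2) \<partial>lborel) \<le> ennreal (M * \<omega> d)"
  shows "(\<integral>\<^sup>+\<tau>. ennreal (\<omega> (cmod (cis \<tau> - of_real r)) / (cmod (cis \<tau> - of_real r))\<^sup>2) \<partial>rotations)
    \<le> ennreal (2 * pi * (1 + M) * (\<omega> d / d))"
proof -
  define \<Omega> where "\<Omega> = (\<lambda>t. \<omega> (max d t) / (max d t)\<^sup>2)"
  have "continuous_on UNIV \<Omega>"
    unfolding \<Omega>_def using d by (intro continuous_intros continuous_on_majorant[OF \<omega>]) auto
  then have [measurable]: "\<Omega> \<in> borel_measurable borel"
    by (rule borel_measurable_continuous_onI)
  have \<Omega>0: "0 \<le> \<Omega> t" for t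
    unfolding \<Omega>_def using d majorant_nonneg[OF \<omega>, of "max d t"] by simp
  define H where "H = (\<lambda>t. ennreal (\<Omega> t) * indicator {0..} t)"
  have [measurable]: "H \<in> borel_measurable borel" unfolding H_def by measurable
  have \<omega>d: "0 \<le> \<omega> d" using d majorant_nonneg[OF \<omega>] by simp
  have tail': "(\<integral>\<^sup>+t\<in>{d..}. ennreal (\<omega> t / t\<^sup>2) \<partial>lborel) \<le> ennreal (M * (\<omega> d / d))"
  proof -
    have "(\<integral>\<^sup>+t\<in>{d..}. ennreal (\<omega> t / t\<^sup>2) \<partial>lborel)
        = ennreal (1 / d) * (ennreal d * (\<integral>\<^sup>+t\<in>{d..}. ennreal (\<omega> t / t\<^sup>2) \<partial>lborel))"
      using d by (simp add: mult.assoc[symmetric] ennreal_mult'[symmetric])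
    also have "\<dots> \<le> ennreal (1 / d) * ennreal (M * \<omega> d)"
      by (intro mult_left_mono tail) simp
    also have "\<dots> = ennreal (M * (\<omega> d / d))"
      using d by (simp add: ennreal_mult'[symmetric])
    finally show ?thesis .
  qed
  have H_int: "(\<integral>\<^sup>+t. H t \<partial>lborel) \<le> ennreal ((1 + M) * (\<omega> d / d))"
  proof -
    have tail_meas: "(\<lambda>t. ennreal (\<omega> t / t\<^sup>2) * indicator {d..} t) \<in> borel_measurable borel"
    proof -
      have "(\<lambda>t. ennreal (\<Omega> t) * indicator {d..} t) \<in> borel_measurable borel" by measurable
      also have "(\<lambda>t. ennreal (\<Omega> t) * indicator {d..} t) = (\<lambda>t. ennreal (\<omega> t / t\<^sup>2) * indicator {d..} t)"
        by (auto simp: \<Omega>_def fun_eq_iff max_def split: split_indicator)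
      finally show ?thesis .
    qed
    have "(\<integral>\<^sup>+t. H t \<partial>lborel) \<le> (\<integral>\<^sup>+t. ennreal (\<omega> d / d\<^sup>2) * indicator {0..d} t
        + ennreal (\<omega> t / t\<^sup>2) * indicator {d..} t \<partial>lborel)"
      using d by (intro nn_integral_mono) (auto simp: H_def \<Omega>_def max_def split: split_indicator)
    also have "\<dots> = ennreal (\<omega> d / d\<^sup>2) * ennreal d + (\<integral>\<^sup>+t\<in>{d..}. ennreal (\<omega> t / t\<^sup>2) \<partial>lborel)"
      using tail_meas d by (subst nn_integral_add) (auto simp: nn_integral_cmult_indicator)
    also have "\<dots> \<le> ennreal (\<omega> d / d\<^sup>2) * ennreal d + ennreal (M * (\<omega> d / d))"
      by (intro add_left_mono tail')
    also have "\<dots> = ennreal ((1 + M) * (\<omega> d / d))"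
      using d \<omega>d M by (simp add: ennreal_mult'[symmetric] ennreal_plus[symmetric] 
          power2_eq_square algebra_simps add_divide_distrib del: ennreal_plus)
    finally show ?thesis .
  qed
  define s where "s = (\<lambda>\<tau>. cmod (cis \<tau> - of_real r))"
  have r1: "r < 1" using d r by simp
  have s_d: "d \<le> s \<tau>" for \<tau>
    unfolding s_def using dist_cis_ge[of r \<tau>] r r1 by simp
  have bound: "ennreal (\<omega> (s \<tau>) / (s \<tau>)\<^sup>2) * indicator {0..2*pi} \<tau>
      \<le> H (0 + (1 / pi) * \<tau>) + H (2 + (- 1 / pi) * \<tau>)" for \<tau>
  proof (cases "\<tau> \<in> {0..2*pi}")
    case True
    have ang: "min \<tau> (2 * pi - \<tau>) / pi \<le> s \<tau>"
      unfolding s_def using dist_cis_ge_angle[of r \<tau>] r r1 True by simp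
    have key: "ennreal (\<omega> (s \<tau>) / (s \<tau>)\<^sup>2) \<le> H t" if "0 \<le> t" "t \<le> s \<tau>" for t
    proof -
      have "\<omega> (s \<tau>) / (s \<tau>)\<^sup>2 \<le> \<Omega> t"
        unfolding \<Omega>_def using d that s_d[of \<tau>] by (intro majorant_ratio_square[OF \<omega>]) auto
      then show ?thesis using that by (simp add: H_def ennreal_leI)
    qed
    show ?thesis
    proof (cases "\<tau> \<le> pi")
      case True
      then have "ennreal (\<omega> (s \<tau>) / (s \<tau>)\<^sup>2) \<le> H (0 + (1 / pi) * \<tau>)"
        using ang \<open>\<tau> \<in> {0..2*pi}\<close> by (intro key) (auto simp: min_def)
      then show ?thesis using \<open>\<tau> \<in> {0..2*pi}\<close> by (simp add: add_increasing2)
    next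
      case False
      then have "ennreal (\<omega> (s \<tau>) / (s \<tau>)\<^sup>2) \<le> H (2 + (- 1 / pi) * \<tau>)"
        using ang \<open>\<tau> \<in> {0..2*pi}\<close> by (intro key) (auto simp: min_def field_simps)
      then show ?thesis using \<open>\<tau> \<in> {0..2*pi}\<close> by (simp add: add_increasing)
    qed
  qed simp
  have affine: "(\<integral>\<^sup>+\<tau>. H (t + c * \<tau>) \<partial>lborel) \<le> ennreal (pi * ((1 + M) * (\<omega> d / d)))"
    if "\<bar>c\<bar> = 1 / pi" for t c
  proof -
    have c: "c \<noteq> 0" using that by auto
    have "ennreal (pi * \<bar>c\<bar>) = 1" using that by simp
    then have "(\<integral>\<^sup>+\<tau>. H (t + c * \<tau>) \<partial>lborel) = ennreal pi * (ennreal \<bar>c\<bar> * (\<integral>\<^sup>+\<tau>. H (t + c * \<tau>) \<partial>lborel))"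
      by (simp add: mult.assoc[symmetric] ennreal_mult'[symmetric])
    also have "\<dots> = ennreal pi * (\<integral>\<^sup>+t. H t \<partial>lborel)"
      using c by (subst nn_integral_real_affine[of H c t]) auto
    also have "\<dots> \<le> ennreal pi * ennreal ((1 + M) * (\<omega> d / d))"
      by (intro mult_left_mono H_int) simp
    also have "\<dots> = ennreal (pi * ((1 + M) * (\<omega> d / d)))"
      by (rule ennreal_mult'[symmetric]) simp
    finally show ?thesis .
  qed
  have "(\<integral>\<^sup>+\<tau>. ennreal (\<omega> (s \<tau>) / (s \<tau>)\<^sup>2) \<partial>rotations)
      = (\<integral>\<^sup>+\<tau>. ennreal (\<omega> (s \<tau>) / (s \<tau>)\<^sup>2) * indicator {0..2*pi} \<tau> \<partial>lborel)"
    unfolding rotations_def by (subst nn_integral_restrict_space) auto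
  also have "\<dots> \<le> (\<integral>\<^sup>+\<tau>. H (0 + (1 / pi) * \<tau>) + H (2 + (- 1 / pi) * \<tau>) \<partial>lborel)"
    by (intro nn_integral_mono bound)
  also have "\<dots> = (\<integral>\<^sup>+\<tau>. H (0 + (1 / pi) * \<tau>) \<partial>lborel) + (\<integral>\<^sup>+\<tau>. H (2 + (- 1 / pi) * \<tau>) \<partial>lborel)"
    by (intro nn_integral_add) measurable
  also have "\<dots> \<le> ennreal (pi * ((1 + M) * (\<omega> d / d))) + ennreal (pi * ((1 + M) * (\<omega> d / d)))"
    by (intro add_mono affine) auto
  also have "\<dots> = ennreal (2 * pi * (1 + M) * (\<omega> d / d))"
    using d \<omega>d M by (simp add: ennreal_plus[symmetric] del: ennreal_plus)
  finally show ?thesis unfolding s_def .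
qed

text \<open>For \<open>d\<close> below the threshold of the regularity condition the previous lemma applies. For the other \<open>d\<close> the
  integrand is at most \<open>\<omega>(d) / d\<^sup>2\<close>, and one factor \<open>1 / d\<close> is bounded.\<close>

lemma kernel_majorant:
  assumes "regular_majorant \<omega>"
  obtains C where "0 < C" "\<And>r. 0 \<le> r \<Longrightarrow> r < 1 \<Longrightarrow>
    (\<integral>\<^sup>+\<tau>. ennreal (\<omega> (cmod (cis \<tau> - of_real r)) / (cmod (cis \<tau> - of_real r))\<^sup>2) \<partial>rotations)
    \<le> ennreal (C * (\<omega> (1 - r) / (1 - r)))"
proof -
  from assms obtain \<delta>0 M where \<omega>: "majorant \<omega>" and \<delta>0: "0 < \<delta>0" and M: "0 < M"
    and tail: "\<And>\<delta>. 0 < \<delta> \<Longrightarrow> \<delta> < \<delta>0 \<Longrightarrow>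
      ennreal \<delta> * (\<integral>\<^sup>+t\<in>{\<delta>..}. ennreal (\<omega> t / t\<^sup>2) \<partial>lborel) \<le> ennreal (M * \<omega> \<delta>)"
    unfolding regular_majorant_def by blast
  \<comment> \<open>The first summand serves small \<open>1 - r\<close>, the second the range \<open>1 - r \<ge> \<delta>0\<close>.\<close>
  define C where "C = 2 * pi * (1 + M) + 2 * pi / \<delta>0"
  have C: "0 < C" unfolding C_def using M \<delta>0 by (intro add_pos_pos) auto
  have "(\<integral>\<^sup>+\<tau>. ennreal (\<omega> (cmod (cis \<tau> - of_real r)) / (cmod (cis \<tau> - of_real r))\<^sup>2) \<partial>rotations)
    \<le> ennreal (C * (\<omega> (1 - r) / (1 - r)))" if r: "0 \<le> r" "r < 1" for r
  proof -
    define d where "d = 1 - r"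
    have d: "0 < d" "d = 1 - r" using r by (auto simp: d_def)
    have \<omega>d: "0 \<le> \<omega> d / d" using d majorant_nonneg[OF \<omega>, of d] by simp
    show ?thesis
    proof (cases "d < \<delta>0")
      case True
      have "(\<integral>\<^sup>+\<tau>. ennreal (\<omega> (cmod (cis \<tau> - of_real r)) / (cmod (cis \<tau> - of_real r))\<^sup>2) \<partial>rotations)
        \<le> ennreal (2 * pi * (1 + M) * (\<omega> d / d))"
        using \<omega> d r M True by (intro kernel_majorant_small tail) auto
      also have "\<dots> \<le> ennreal (C * (\<omega> d / d))"
        using \<delta>0 \<omega>d by (intro ennreal_leI mult_right_mono) (auto simp: C_def)
      finally show ?thesis by (simp add: d_def)
    next
      case False
      have "(\<integral>\<^sup>+\<tau>. ennreal (\<omega> (cmod (cis \<tau> - of_real r)) / (cmod (cis \<tau> - of_real r))\<^sup>2) \<partial>rotations)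
        \<le> (\<integral>\<^sup>+\<tau>. ennreal (\<omega> d / d\<^sup>2) \<partial>rotations)"
        using d r dist_cis_ge[OF r]
        by (intro nn_integral_mono ennreal_leI majorant_ratio_square[OF \<omega>]) auto
      also have "\<dots> = ennreal (2 * pi * (\<omega> d / d\<^sup>2))"
        using d majorant_nonneg[OF \<omega>, of d]
        by (simp add: rotations_def emeasure_restrict_space ennreal_mult'[symmetric] mult.commute)
      also have "\<dots> \<le> ennreal (C * (\<omega> d / d))"
      proof (rule ennreal_leI)
        have "\<omega> d / d\<^sup>2 \<le> \<omega> d / d * (1 / \<delta>0)"
          using \<omega>d d False \<delta>0 
          by (subst power2_eq_square, subst divide_divide_eq_left[symmetric])
             (metis divide_inverse inverse_eq_divide le_imp_inverse_le mult_left_mono not_le)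
        then have "2 * pi * (\<omega> d / d\<^sup>2) \<le> 2 * pi * (\<omega> d / d * (1 / \<delta>0))"
          by (intro mult_left_mono) auto
        also have "\<dots> = 2 * pi / \<delta>0 * (\<omega> d / d)" by simp
        also have "\<dots> \<le> C * (\<omega> d / d)"
          using \<omega>d M by (intro mult_right_mono) (auto simp: C_def)
        finally show "2 * pi * (\<omega> d / d\<^sup>2) \<le> C * (\<omega> d / d)" .
      qed
      finally show ?thesis by (simp add: d_def)
    qed
  qed
  with C show ?thesis by (rule that)
qed

text \<open>Substitution of \<open>t = \<delta> u\<close>, where \<open>dt / t = du / u\<close>.\<close>

lemma radial_majorant_integral:
  assumes \<omega>: "majorant \<omega>" and \<delta>: "0 < \<delta>"
  shows "(\<integral>\<^sup>+u. ennreal (\<omega> (\<delta> * u) / u) \<partial>restrict_space lborel {0<..1})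
    = (\<integral>\<^sup>+t\<in>{0<..\<delta>}. ennreal (\<omega> t / t) \<partial>lborel)"
proof -
  define F where "F = (\<lambda>t. ennreal (\<omega> t / t) * indicator {0<..\<delta>} t)"
  have "continuous_on {0<..\<delta>} (\<lambda>t. \<omega> t / t)"
    by (intro continuous_intros continuous_on_majorant[OF \<omega>]) auto
  then have "(\<lambda>t. indicator {0<..\<delta>} t *\<^sub>R (\<omega> t / t)) \<in> borel_measurable borel"
    by (intro borel_measurable_continuous_on_indicator) auto
  then have "(\<lambda>t. ennreal (indicator {0<..\<delta>} t *\<^sub>R (\<omega> t / t))) \<in> borel_measurable borel"
    by measurable
  also have "(\<lambda>t. ennreal (indicator {0<..\<delta>} t *\<^sub>R (\<omega> t / t))) = F"
    by (auto simp: F_def fun_eq_iff split: split_indicator)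
  finally have [measurable]: "F \<in> borel_measurable borel" .
  have "(\<integral>\<^sup>+t. F t \<partial>lborel) = ennreal \<delta> * (\<integral>\<^sup>+u. F (0 + \<delta> * u) \<partial>lborel)"
    using \<delta> by (subst nn_integral_real_affine[where c = \<delta> and t = 0]) auto
  also have "\<dots> = (\<integral>\<^sup>+u. ennreal \<delta> * F (0 + \<delta> * u) \<partial>lborel)"
    by (rule nn_integral_cmult[symmetric]) measurable
  also have "\<dots> = (\<integral>\<^sup>+u. ennreal (\<omega> (\<delta> * u) / u) * indicator {0<..1} u \<partial>lborel)"
  proof (rule nn_integral_cong)
    fix u :: real
    have "\<delta> * u \<in> {0<..\<delta>} \<longleftrightarrow> u \<in> {0<..1}"
      using \<delta> by (auto simp: zero_less_mult_iff)
    then show "ennreal \<delta> * F (0 + \<delta> * u) = ennreal (\<omega> (\<delta> * u) / u) * indicator {0<..1} u"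
      using \<delta> by (auto simp: F_def ennreal_mult'[symmetric] split: split_indicator)
  qed
  finally show ?thesis
    by (subst nn_integral_restrict_space) (auto simp: F_def)
qed

section \<open>Integrals over the unit circle\<close>

lemma continuous_on_cis_compose:
  assumes "continuous_on (sphere 0 1) \<phi>" "continuous_on S a"
  shows "continuous_on S (\<lambda>\<tau>. \<phi> (cis (a \<tau>)))"
  by (rule continuous_on_compose2[OF assms(1)]) (auto intro!: continuous_intros assms(2))

lemma cis_minus_nonzero: "cmod z < 1 \<Longrightarrow> cis \<tau> - z \<noteq> 0"
  by (metis eq_iff_diff_eq_0 norm_cis less_irrefl)

lemma one_minus_cnj_mult_nonzero:
  assumes "cmod z < 1" "cmod u \<le> 1"
  shows "1 - cnj z * u \<noteq> 0"
proof -
  have "cmod (cnj z * u) < 1"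
    using assms by (metis complex_mod_cnj mult_left_le norm_ge_zero norm_mult order_le_less_trans)
  then show ?thesis by (metis eq_iff_diff_eq_0 norm_one less_irrefl)
qed

lemma has_integral_of_circlepath:
  assumes "(F has_contour_integral (\<i> * I)) (circlepath 0 1)"
  shows "((\<lambda>\<tau>. F (cis \<tau>) * cis \<tau>) has_integral I) {0..2*pi}"
proof -
  have "((\<lambda>\<tau>. F (cis \<tau>) * \<i> * cis \<tau>) has_integral (\<i> * I)) {0..2*pi}"
    using assms unfolding circlepath_def
    by (subst (asm) has_contour_integral_part_circlepath_iff) auto
  then have "((\<lambda>\<tau>. - \<i> * (F (cis \<tau>) * \<i> * cis \<tau>)) has_integral (- \<i> * (\<i> * I))) {0..2*pi}"
    by (rule has_integral_mult_right)
  moreover have "- \<i> * (a * \<i> * b) = a * b" "- \<i> * (\<i> * b) = b" for a b :: complex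
    by (simp_all add: complex_eq_iff)
  ultimately show ?thesis by (simp only:)
qed

context
  fixes F :: "complex \<Rightarrow> complex"
  assumes cont: "continuous_on (cball 0 1) F" and holo: "F holomorphic_on ball 0 1"
begin

lemma cauchy_integral_cis:
  assumes "cmod z < 1"
  shows "((\<lambda>\<tau>. F (cis \<tau>) * (cis \<tau> / (cis \<tau> - z))) has_integral (2 * pi * F z)) {0..2*pi}"
proof -
  have "((\<lambda>u. F u / (u - z)) has_contour_integral (\<i> * (2 * pi * F z))) (circlepath 0 1)"
    using Cauchy_integral_circlepath[OF cont holo, of z] assms by (simp add: mult_ac)
  from has_integral_of_circlepath[OF this] show ?thesis by simp
qed

lemma cauchy_deriv_integral_cis:
  assumes "cmod z < 1"
  shows "((\<lambda>\<tau>. F (cis \<tau>) * (cis \<tau> / (cis \<tau> - z)\<^sup>2)) has_integral (2 * pi * deriv F z)) {0..2*pi}"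
proof -
  have z: "z \<in> ball 0 1" using assms by simp
  note D = Cauchy_derivative_integral_circlepath[OF cont holo z]
  have "contour_integral (circlepath 0 1) (\<lambda>u. F u / (u - z)\<^sup>2) = \<i> * (2 * pi * deriv F z)"
    using DERIV_imp_deriv[OF D(2)] by simp
  then have "((\<lambda>u. F u / (u - z)\<^sup>2) has_contour_integral (\<i> * (2 * pi * deriv F z))) (circlepath 0 1)"
    using has_contour_integral_integral[OF D(1)] by simp
  from has_integral_of_circlepath[OF this] show ?thesis by simp
qed

end

lemma mean_value_cis:
  fixes F :: "complex \<Rightarrow> complex"
  assumes "continuous_on (cball 0 1) F" "F holomorphic_on ball 0 1"
  shows "((\<lambda>\<tau>. F (cis \<tau>)) has_integral (2 * pi * F 0)) {0..2*pi}"
  using cauchy_integral_cis[OF assms, of 0] by (simp add: cis_neq_zero)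

definition poisson_kernel :: "complex \<Rightarrow> real \<Rightarrow> real" where
  "poisson_kernel z \<tau> = (1 - (cmod z)\<^sup>2) / (cmod (cis \<tau> - z))\<^sup>2"

lemma poisson_kernel_nonneg: "cmod z < 1 \<Longrightarrow> 0 \<le> poisson_kernel z \<tau>"
  by (simp add: poisson_kernel_def abs_square_le_1 power_le_one)

lemma cis_times_cnj_reflect: "cis \<tau> * cnj (cis \<tau> - z) = 1 - cnj z * cis \<tau>"
  by (simp add: algebra_simps cis_cnj cis_mult)

text \<open>The Poisson kernel is the Cauchy kernel plus the boundary value of a holomorphic function that vanishes at the
  origin, so on holomorphic functions it acts like the Cauchy kernel.\<close>

lemma poisson_kernel_split:
  assumes "cmod z < 1"
  shows "complex_of_real (poisson_kernel z \<tau>)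
    = cis \<tau> / (cis \<tau> - z) + cnj z * cis \<tau> / (1 - cnj z * cis \<tau>)"
proof -
  define u where "u = cis \<tau>"
  have u: "u - z \<noteq> 0" "1 - cnj z * u \<noteq> 0" "u \<noteq> 0"
    using cis_minus_nonzero[OF assms] one_minus_cnj_mult_nonzero[OF assms, of u]
    by (auto simp: u_def cis_neq_zero)
  have c: "u * cnj (u - z) = 1 - cnj z * u" unfolding u_def by (rule cis_times_cnj_reflect)
  have "complex_of_real (poisson_kernel z \<tau>) = (1 - z * cnj z) / ((u - z) * cnj (u - z))"
    by (simp add: poisson_kernel_def u_def complex_norm_square[symmetric] del: complex_cnj_diff)
  also have "\<dots> = u * (1 - z * cnj z) / ((u - z) * (1 - cnj z * u))"
    using u unfolding c[symmetric] by simp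
  also have "\<dots> = u / (u - z) + cnj z * u / (1 - cnj z * u)"
    using u by (simp add: divide_simps) (simp add: algebra_simps)
  finally show ?thesis by (simp add: u_def)
qed

text \<open>On the circle the conjugate of the kernel of \<open>F'(z)\<close> is the boundary value of a function of \<open>cis \<tau>\<close> that is
  holomorphic in the disk and vanishes at the origin. This makes conjugates of holomorphic functions invisible to
  the kernel.\<close>

lemma cnj_derivative_kernel:
  assumes "cmod z < 1"
  shows "cnj (cis \<tau> / (cis \<tau> - z)\<^sup>2) = cis \<tau> / (1 - cnj z * cis \<tau>)\<^sup>2"
proof -
  have "cis \<tau> / (1 - cnj z * cis \<tau>)\<^sup>2 = cis \<tau> / (cis \<tau> * cnj (cis \<tau> - z))\<^sup>2"
    by (simp only: cis_times_cnj_reflect)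
  also have "\<dots> = cnj (cis \<tau>) / (cnj (cis \<tau> - z))\<^sup>2"
    by (simp add: power_mult_distrib power2_eq_square cis_cnj cis_mult divide_inverse cis_inverse
        flip: mult.assoc)
  finally show ?thesis by simp
qed

lemma poisson_holomorphic:
  fixes F :: "complex \<Rightarrow> complex"
  assumes cont: "continuous_on (cball 0 1) F" and holo: "F holomorphic_on ball 0 1"
    and z: "cmod z < 1"
  shows "((\<lambda>\<tau>. F (cis \<tau>) * poisson_kernel z \<tau>) has_integral (2 * pi * F z)) {0..2*pi}"
proof -
  have "((\<lambda>\<tau>. F (cis \<tau>) * (cnj z * cis \<tau> / (1 - cnj z * cis \<tau>))) has_integral
      (2 * pi * (F 0 * (cnj z * 0 / (1 - cnj z * 0))))) {0..2*pi}"
  proof (rule mean_value_cis[where F = "\<lambda>u. F u * (cnj z * u / (1 - cnj z * u))"])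
    show "continuous_on (cball 0 1) (\<lambda>u. F u * (cnj z * u / (1 - cnj z * u)))"
      using one_minus_cnj_mult_nonzero[OF z] by (intro continuous_intros cont) auto
    show "(\<lambda>u. F u * (cnj z * u / (1 - cnj z * u))) holomorphic_on ball 0 1"
      using one_minus_cnj_mult_nonzero[OF z] by (intro holomorphic_intros holo) auto
  qed
  from has_integral_add[OF cauchy_integral_cis[OF cont holo z] this]
  show ?thesis by (simp add: poisson_kernel_split[OF z] algebra_simps)
qed

text \<open>The integral of \<open>F\<close> against the kernel is \<open>2 \<pi> F'(z)\<close> and that of \<open>cnj F\<close> is \<open>0\<close>; their half sum concerns
  \<open>Re F\<close>.\<close>

lemma real_part_derivative_integral:
  fixes F :: "complex \<Rightarrow> complex"
  assumes cont: "continuous_on (cball 0 1) F" and holo: "F holomorphic_on ball 0 1"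
    and z: "cmod z < 1"
  shows "((\<lambda>\<tau>. of_real (Re (F (cis \<tau>))) * (cis \<tau> / (cis \<tau> - z)\<^sup>2)) has_integral (pi * deriv F z)) {0..2*pi}"
proof -
  have "((\<lambda>\<tau>. F (cis \<tau>) * (cis \<tau> / (1 - cnj z * cis \<tau>)\<^sup>2)) has_integral
      (2 * pi * (F 0 * (0 / (1 - cnj z * 0)\<^sup>2)))) {0..2*pi}"
  proof (rule mean_value_cis[where F = "\<lambda>u. F u * (u / (1 - cnj z * u)\<^sup>2)"])
    show "continuous_on (cball 0 1) (\<lambda>u. F u * (u / (1 - cnj z * u)\<^sup>2))"
      using one_minus_cnj_mult_nonzero[OF z] by (intro continuous_intros cont) auto
    show "(\<lambda>u. F u * (u / (1 - cnj z * u)\<^sup>2)) holomorphic_on ball 0 1"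
      using one_minus_cnj_mult_nonzero[OF z] by (intro holomorphic_intros holo) auto
  qed
  then have "((\<lambda>\<tau>. F (cis \<tau>) * cnj (cis \<tau> / (cis \<tau> - z)\<^sup>2)) has_integral 0) {0..2*pi}"
    unfolding cnj_derivative_kernel[OF z] by simp
  then have "(cnj \<circ> (\<lambda>\<tau>. F (cis \<tau>) * cnj (cis \<tau> / (cis \<tau> - z)\<^sup>2)) has_integral cnj 0) {0..2*pi}"
    by (simp only: has_integral_cnj)
  then have "((\<lambda>\<tau>. cnj (F (cis \<tau>)) * (cis \<tau> / (cis \<tau> - z)\<^sup>2)) has_integral 0) {0..2*pi}"
    by (simp add: o_def)
  from has_integral_mult_right[OF has_integral_add[OF cauchy_deriv_integral_cis[OF cont holo z] this], of "1/2"]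
  have "((\<lambda>\<tau>. 1/2 * (F (cis \<tau>) * (cis \<tau> / (cis \<tau> - z)\<^sup>2) + cnj (F (cis \<tau>)) * (cis \<tau> / (cis \<tau> - z)\<^sup>2)))
      has_integral (pi * deriv F z)) {0..2*pi}" by simp
  moreover have "1/2 * (F (cis \<tau>) * k + cnj (F (cis \<tau>)) * k) = of_real (Re (F (cis \<tau>))) * k" for \<tau> k
    using complex_add_cnj[of "F (cis \<tau>)"] by (simp add: distrib_right[symmetric])
  ultimately show ?thesis by (simp only:)
qed

lemma continuous_on_scaled:
  assumes "continuous_on (cball 0 1) (u :: complex \<Rightarrow> 'a::topological_space)"
  shows "continuous_on ({0..1} \<times> T) (\<lambda>(\<rho>, \<tau>). u (of_real \<rho> * cis \<tau>))"
  unfolding case_prod_unfold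
  by (rule continuous_on_compose2[OF assms]) (auto intro!: continuous_intros simp: norm_mult)

text \<open>The function \<open>L\<close> itself may fail to extend to the boundary. The formulas hold for the dilations
  \<open>z \<mapsto> L(\<rho> z)\<close> with \<open>\<rho> < 1\<close>, and both sides are continuous in \<open>\<rho> \<in> [0, 1]\<close> because only \<open>u = Re L\<close> enters
  the boundary integrals.\<close>

lemma real_part_boundary_formulas:
  fixes u :: "complex \<Rightarrow> real" and L :: "complex \<Rightarrow> complex"
  assumes u: "continuous_on (cball 0 1) u" and holo: "L holomorphic_on ball 0 1"
    and Re: "\<And>z. z \<in> ball 0 1 \<Longrightarrow> u z = Re (L z)" and z: "cmod z < 1"
  shows "((\<lambda>\<tau>. of_real (u (cis \<tau>)) * (cis \<tau> / (cis \<tau> - z)\<^sup>2)) has_integral (pi * deriv L z)) {0..2*pi}"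
    and "((\<lambda>\<tau>. u (cis \<tau>) * poisson_kernel z \<tau>) has_integral (2 * pi * u z)) {0..2*pi}"
proof -
  have scaled: "of_real \<rho> * w \<in> ball 0 1" if "0 \<le> \<rho>" "\<rho> < 1" "cmod w \<le> 1" for \<rho> :: real and w
    using that mult_left_le[of "cmod w" \<rho>] by (simp add: norm_mult)
  have cl: "closure {0..<1::real} = {0..1}" by simp
  have zs: "of_real \<rho> * z \<in> ball 0 1" if "0 \<le> \<rho>" "\<rho> \<le> 1" for \<rho> :: real
    using that z mult_left_le_one_le[of "cmod z" \<rho>] by (simp add: norm_mult abs_mult)
  have dil: "continuous_on (cball 0 1) (\<lambda>w. L (of_real \<rho> * w))"
    "(\<lambda>w. L (of_real \<rho> * w)) holomorphic_on ball 0 1"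
    "deriv (\<lambda>w. L (of_real \<rho> * w)) z = of_real \<rho> * deriv L (of_real \<rho> * z)"
    if \<rho>: "0 \<le> \<rho>" "\<rho> < 1" for \<rho> :: real
  proof -
    show "continuous_on (cball 0 1) (\<lambda>w. L (of_real \<rho> * w))"
      by (rule continuous_on_compose2[OF holomorphic_on_imp_continuous_on[OF holo]])
         (use scaled[OF \<rho>] in \<open>auto intro!: continuous_intros\<close>)
    have "(L \<circ> (\<lambda>w. of_real \<rho> * w)) holomorphic_on ball 0 1"
      by (rule holomorphic_on_compose_gen[OF _ holo])
         (use scaled[OF \<rho>] in \<open>auto intro!: holomorphic_intros\<close>)
    then show "(\<lambda>w. L (of_real \<rho> * w)) holomorphic_on ball 0 1" by (simp add: o_def)
    have "((\<lambda>w. L (of_real \<rho> * w)) has_field_derivative (deriv L (of_real \<rho> * z) * of_real \<rho>)) (at z)"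
      by (rule DERIV_chain2[OF holomorphic_derivI[OF holo]])
         (use zs[of \<rho>] \<rho> in \<open>auto intro!: derivative_eq_intros\<close>)
    then show "deriv (\<lambda>w. L (of_real \<rho> * w)) z = of_real \<rho> * deriv L (of_real \<rho> * z)"
      by (simp add: DERIV_imp_deriv mult.commute)
  qed
  have cont_u: "continuous_on ({0..1} \<times> cbox 0 (2*pi)) (\<lambda>(\<rho>, \<tau>). u (of_real \<rho> * cis \<tau>))"
    by (rule continuous_on_scaled[OF u])
  have cont_k: "continuous_on T (\<lambda>x. cis (snd x) / (cis (snd x) - z)\<^sup>2)" for T :: "(real \<times> real) set"
    using cis_minus_nonzero[OF z] by (intro continuous_intros) auto
  have cont_p: "continuous_on T (\<lambda>x. poisson_kernel z (snd x))" for T :: "(real \<times> real) set"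
    unfolding poisson_kernel_def using cis_minus_nonzero[OF z] by (intro continuous_intros) auto

  let ?I = "\<lambda>\<rho>. integral (cbox 0 (2*pi)) (\<lambda>\<tau>. of_real (u (of_real \<rho> * cis \<tau>)) * (cis \<tau> / (cis \<tau> - z)\<^sup>2))"
  have int1: "continuous_on ({0..1} \<times> cbox 0 (2*pi))
      (\<lambda>(\<rho>, \<tau>). of_real (u (of_real \<rho> * cis \<tau>)) * (cis \<tau> / (cis \<tau> - z)\<^sup>2))"
    using continuous_on_mult[OF continuous_on_of_real[OF cont_u] cont_k] by (simp add: case_prod_unfold)
  have "?I 1 - pi * (of_real 1 * deriv L (of_real 1 * z)) = 0"
  proof (rule continuous_constant_on_closure[where S = "{0..<1::real}"
        and f = "\<lambda>\<rho>. ?I \<rho> - pi * (of_real \<rho> * deriv L (of_real \<rho> * z))"])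
    have dL: "deriv L holomorphic_on ball 0 1" by (intro holomorphic_deriv holo) auto
    have "continuous_on {0..1} (\<lambda>\<rho>. deriv L (of_real \<rho> * z))"
      by (rule continuous_on_compose2[OF holomorphic_on_imp_continuous_on[OF dL]])
         (use zs in \<open>auto intro!: continuous_intros\<close>)
    then show "continuous_on (closure {0..<1}) (\<lambda>\<rho>. ?I \<rho> - pi * (of_real \<rho> * deriv L (of_real \<rho> * z)))"
      unfolding cl by (intro continuous_intros integral_continuous_on_param int1)
    fix \<rho> :: real assume "\<rho> \<in> {0..<1}"
    then have \<rho>: "0 \<le> \<rho>" "\<rho> < 1" by auto
    have "((\<lambda>\<tau>. of_real (u (of_real \<rho> * cis \<tau>)) * (cis \<tau> / (cis \<tau> - z)\<^sup>2))
        has_integral (pi * (of_real \<rho> * deriv L (of_real \<rho> * z)))) {0..2*pi}"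
      using real_part_derivative_integral[OF dil(1,2)[OF \<rho>] z] Re[OF scaled[OF \<rho>]]
      by (simp add: dil(3)[OF \<rho>])
    then show "?I \<rho> - pi * (of_real \<rho> * deriv L (of_real \<rho> * z)) = 0"
      by (simp add: integral_unique)
  qed auto
  moreover have "(\<lambda>\<tau>. of_real (u (cis \<tau>)) * (cis \<tau> / (cis \<tau> - z)\<^sup>2)) integrable_on {0..2*pi}"
    using cis_minus_nonzero[OF z]
    by (intro integrable_continuous_interval continuous_intros continuous_on_cis_compose
        continuous_on_subset[OF u]) auto
  ultimately show "((\<lambda>\<tau>. of_real (u (cis \<tau>)) * (cis \<tau> / (cis \<tau> - z)\<^sup>2)) has_integral (pi * deriv L z)) {0..2*pi}"
    by (simp add: has_integral_integrable_integral)

  let ?J = "\<lambda>\<rho>. integral (cbox 0 (2*pi)) (\<lambda>\<tau>. u (of_real \<rho> * cis \<tau>) * poisson_kernel z \<tau>)"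
  have int2: "continuous_on ({0..1} \<times> cbox 0 (2*pi))
      (\<lambda>(\<rho>, \<tau>). u (of_real \<rho> * cis \<tau>) * poisson_kernel z \<tau>)"
    using continuous_on_mult[OF cont_u cont_p] by (simp add: case_prod_unfold)
  have "?J 1 - 2 * pi * u (of_real 1 * z) = 0"
  proof (rule continuous_constant_on_closure[where S = "{0..<1::real}"
        and f = "\<lambda>\<rho>. ?J \<rho> - 2 * pi * u (of_real \<rho> * z)"])
    have "continuous_on {0..1} (\<lambda>\<rho>. u (of_real \<rho> * z))"
    proof (rule continuous_on_compose2[OF u])
      show "continuous_on {0..1} (\<lambda>\<rho>. of_real \<rho> * z)" by (intro continuous_intros)
      show "(\<lambda>\<rho>. of_real \<rho> * z) ` {0..1::real} \<subseteq> cball 0 1" using zs by (auto simp: less_imp_le)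
    qed
    then show "continuous_on (closure {0..<1}) (\<lambda>\<rho>. ?J \<rho> - 2 * pi * u (of_real \<rho> * z))"
      unfolding cl by (intro continuous_intros integral_continuous_on_param int2)
    fix \<rho> :: real assume "\<rho> \<in> {0..<1}"
    then have \<rho>: "0 \<le> \<rho>" "\<rho> < 1" by auto
    have "((\<lambda>\<tau>. Re (L (of_real \<rho> * cis \<tau>) * poisson_kernel z \<tau>))
        has_integral Re (2 * pi * L (of_real \<rho> * z))) {0..2*pi}"
      by (rule has_integral_Re[OF poisson_holomorphic[OF dil(1,2)[OF \<rho>] z]])
    then have "((\<lambda>\<tau>. u (of_real \<rho> * cis \<tau>) * poisson_kernel z \<tau>)
        has_integral (2 * pi * u (of_real \<rho> * z))) {0..2*pi}"
      using Re[OF scaled[OF \<rho>]] z by simp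
    then show "?J \<rho> - 2 * pi * u (of_real \<rho> * z) = 0"
      by (simp add: integral_unique)
  qed auto
  moreover have "(\<lambda>\<tau>. u (cis \<tau>) * poisson_kernel z \<tau>) integrable_on {0..2*pi}"
    unfolding poisson_kernel_def using cis_minus_nonzero[OF z]
    by (intro integrable_continuous_interval continuous_intros continuous_on_cis_compose
        continuous_on_subset[OF u]) auto
  ultimately show "((\<lambda>\<tau>. u (cis \<tau>) * poisson_kernel z \<tau>) has_integral (2 * pi * u z)) {0..2*pi}"
    by (simp add: has_integral_integrable_integral)
qed

text \<open>Only the part of the shifted period beyond \<open>2 \<pi>\<close> has to be moved back by periodicity.\<close>

lemma integral_cis_rotate:
  fixes \<phi> :: "complex \<Rightarrow> real"
  assumes \<phi>: "continuous_on (sphere 0 1) \<phi>" and \<zeta>: "cmod \<zeta> = 1"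
  shows "integral {0..2*pi} (\<lambda>\<tau>. \<phi> (\<zeta> * cis \<tau>)) = integral {0..2*pi} (\<lambda>\<tau>. \<phi> (cis \<tau>))"
proof -
  define \<alpha> where "\<alpha> = Arg2pi \<zeta>"
  have \<alpha>: "0 \<le> \<alpha>" "\<alpha> < 2 * pi" "\<zeta> = cis \<alpha>"
    using Arg2pi[of \<zeta>] \<zeta> by (auto simp: \<alpha>_def is_Arg_def cis_conv_exp)
  have int: "(\<lambda>\<tau>. \<phi> (cis \<tau>)) integrable_on {a..b}" for a b
    by (intro integrable_continuous_interval continuous_on_cis_compose[OF \<phi>] continuous_intros)
  have shift: "integral {a+c..b+c} (\<lambda>\<tau>. \<phi> (cis \<tau>)) = integral {a..b} (\<lambda>\<tau>. \<phi> (cis (c + \<tau>)))" for a b c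
    using integral_shift_Icc_real[of a b "\<lambda>\<tau>. \<phi> (cis \<tau>)" c] by (simp add: o_def)
  have "integral {0..2*pi} (\<lambda>\<tau>. \<phi> (\<zeta> * cis \<tau>)) = integral {\<alpha>..2*pi + \<alpha>} (\<lambda>\<tau>. \<phi> (cis \<tau>))"
    using shift[of 0 \<alpha> "2*pi"] by (simp add: \<alpha> cis_mult)
  also have "\<dots> = integral {\<alpha>..2*pi} (\<lambda>\<tau>. \<phi> (cis \<tau>)) + integral {2*pi..2*pi + \<alpha>} (\<lambda>\<tau>. \<phi> (cis \<tau>))"
    using \<alpha> Henstock_Kurzweil_Integration.integral_combine[of \<alpha> "2*pi" "2*pi + \<alpha>" "\<lambda>\<tau>. \<phi> (cis \<tau>)"] int by simp
  also have "integral {2*pi..2*pi + \<alpha>} (\<lambda>\<tau>. \<phi> (cis \<tau>)) = integral {0..\<alpha>} (\<lambda>\<tau>. \<phi> (cis \<tau>))"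
    using shift[of 0 "2*pi" \<alpha>] by (simp add: cis_mult[symmetric] add.commute)
  also have "integral {\<alpha>..2*pi} (\<lambda>\<tau>. \<phi> (cis \<tau>)) + integral {0..\<alpha>} (\<lambda>\<tau>. \<phi> (cis \<tau>))
      = integral {0..2*pi} (\<lambda>\<tau>. \<phi> (cis \<tau>))"
    using \<alpha> Henstock_Kurzweil_Integration.integral_combine[of 0 \<alpha> "2*pi" "\<lambda>\<tau>. \<phi> (cis \<tau>)"] int by simp
  finally show ?thesis .
qed

lemma nn_integral_interval:
  fixes F :: "real \<Rightarrow> real"
  assumes F: "continuous_on {a..b} F" "\<And>\<tau>. 0 \<le> F \<tau>"
  shows "(\<integral>\<^sup>+\<tau>. ennreal (F \<tau>) \<partial>restrict_space lborel {a..b}) = ennreal (integral {a..b} F)"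
proof -
  have si: "set_integrable lborel {a..b} F"
    by (rule borel_integrable_atLeastAtMost'[OF F(1)])
  have "integrable lborel (\<lambda>\<tau>. indicator {a..b} \<tau> * F \<tau>)"
    and eq: "(LINT \<tau>:{a..b}|lborel. F \<tau>) = integral {a..b} F"
    using si set_borel_integral_eq_integral(2)[OF si] by (auto simp: set_integrable_def)
  then have "(\<integral>\<^sup>+\<tau>. ennreal (indicator {a..b} \<tau> * F \<tau>) \<partial>lborel)
      = ennreal (\<integral>\<tau>. indicator {a..b} \<tau> * F \<tau> \<partial>lborel)"
    using F by (intro nn_integral_eq_integral) auto
  also have "(\<integral>\<tau>. indicator {a..b} \<tau> * F \<tau> \<partial>lborel) = integral {a..b} F"
    using eq by (simp add: set_lebesgue_integral_def)
  also have "(\<integral>\<^sup>+\<tau>. ennreal (indicator {a..b} \<tau> * F \<tau>) \<partial>lborel) = (\<integral>\<^sup>+\<tau>. ennreal (F \<tau>) \<partial>restrict_space lborel {a..b})"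
    by (subst nn_integral_restrict_space) (auto intro!: nn_integral_cong split: split_indicator)
  finally show ?thesis .
qed

lemma nn_integral_rotations:
  assumes "continuous_on {0..2*pi} F" "\<And>\<tau>. 0 \<le> F \<tau>"
  shows "(\<integral>\<^sup>+\<tau>. ennreal (F \<tau>) \<partial>rotations) = ennreal (integral {0..2*pi} F)"
  unfolding rotations_def by (rule nn_integral_interval[OF assms])

lemma continuous_on_poisson_integrand:
  assumes "continuous_on (sphere 0 1) \<phi>" "cmod z < 1"
  shows "continuous_on S (\<lambda>\<tau>. \<phi> (cis \<tau>) * poisson_kernel z \<tau>)"
  unfolding poisson_kernel_def using cis_minus_nonzero[OF assms(2)]
  by (intro continuous_intros continuous_on_cis_compose[OF assms(1)]) auto

lemma poisson_eq_integral:
  assumes "continuous_on (sphere 0 1) \<phi>" "cmod z < 1"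
  shows "poisson \<phi> z = integral {0..2*pi} (\<lambda>\<tau>. \<phi> (cis \<tau>) * poisson_kernel z \<tau>) / (2 * pi)"
  using set_borel_integral_eq_integral(2)[OF borel_integrable_atLeastAtMost'[OF continuous_on_poisson_integrand[OF assms]]]
  by (simp add: poisson_def poisson_kernel_def)

lemma poisson_rotate:
  assumes \<phi>: "continuous_on (sphere 0 1) \<phi>" and z: "cmod z < 1" and \<zeta>: "cmod \<zeta> = 1"
  shows "poisson \<phi> (\<zeta> * z) = poisson (\<lambda>\<xi>. \<phi> (\<zeta> * \<xi>)) z"
proof -
  have \<zeta>z: "cmod (\<zeta> * z) < 1" using z \<zeta> by (simp add: norm_mult)
  have \<phi>': "continuous_on (sphere 0 1) (\<lambda>\<xi>. \<phi> (\<zeta> * \<xi>))"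
    by (rule continuous_on_compose2[OF \<phi>]) (auto intro!: continuous_intros simp: norm_mult \<zeta>)
  let ?g = "\<lambda>\<xi>. \<phi> \<xi> * ((1 - (cmod (\<zeta> * z))\<^sup>2) / (cmod (\<xi> - \<zeta> * z))\<^sup>2)"
  have ne: "\<xi> - \<zeta> * z \<noteq> 0" if "cmod \<xi> = 1" for \<xi>
    using \<zeta>z that by auto
  have g: "continuous_on (sphere 0 1) ?g"
    using ne by (intro continuous_intros \<phi>) auto
  have "integral {0..2*pi} (\<lambda>\<tau>. \<phi> (cis \<tau>) * poisson_kernel (\<zeta> * z) \<tau>)
      = integral {0..2*pi} (\<lambda>\<tau>. ?g (\<zeta> * cis \<tau>))"
    using integral_cis_rotate[OF g \<zeta>] by (simp add: poisson_kernel_def)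
  also have "\<dots> = integral {0..2*pi} (\<lambda>\<tau>. \<phi> (\<zeta> * cis \<tau>) * poisson_kernel z \<tau>)"
  proof (rule arg_cong[where f = "integral {0..2*pi}"], rule ext)
    fix \<tau>
    have "cmod (\<zeta> * cis \<tau> - \<zeta> * z) = cmod (cis \<tau> - z)"
      by (simp add: right_diff_distrib[symmetric] norm_mult \<zeta>)
    then show "?g (\<zeta> * cis \<tau>) = \<phi> (\<zeta> * cis \<tau>) * poisson_kernel z \<tau>"
      by (simp add: poisson_kernel_def norm_mult \<zeta>)
  qed
  finally show ?thesis
    by (simp add: poisson_eq_integral[OF \<phi> \<zeta>z] poisson_eq_integral[OF \<phi>' z])
qed

section \<open>Symmetry of the mixed partial derivatives\<close>

lemma norm_increment_le:
  fixes p :: "real \<Rightarrow> complex"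
  assumes h: "0 < h" and p: "\<And>t. 0 \<le> t \<Longrightarrow> t \<le> h \<Longrightarrow> (p has_vector_derivative p' t) (at t)"
    and B: "\<And>t. 0 \<le> t \<Longrightarrow> t \<le> h \<Longrightarrow> cmod (p' t) \<le> B"
  shows "cmod (p h - p 0) \<le> B * h"
proof -
  have "continuous_on {0..h} p"
    by (intro continuous_at_imp_continuous_on ballI has_vector_derivative_continuous[OF p]) auto
  then obtain t where t: "t \<in> {0<..<h}" "cmod (p h - p 0) \<le> cmod ((h - 0) *\<^sub>R p' t)"
    using mvt_general[OF h, of p "\<lambda>t v. v *\<^sub>R p' t"] p
    by (auto simp: has_vector_derivative_def)
  note t(2)
  also have "cmod ((h - 0) *\<^sub>R p' t) \<le> B * h"
    using B[of t] t h by (simp add: mult.commute mult_left_mono)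
  finally show ?thesis .
qed

definition directional_derivative :: "complex set \<Rightarrow> complex \<Rightarrow> (complex \<Rightarrow> complex) \<Rightarrow> (complex \<Rightarrow> complex) \<Rightarrow> bool" where
  "directional_derivative S a f g \<longleftrightarrow> (\<forall>z\<in>S. ((\<lambda>t. f (z + of_real t * a)) has_vector_derivative g z) (at 0))"

lemma directional_derivativeD:
  assumes "directional_derivative S a f g" "z + of_real s * a \<in> S"
  shows "((\<lambda>t. f (z + of_real t * a)) has_vector_derivative g (z + of_real s * a)) (at s)"
proof -
  have "((\<lambda>t. f (z + of_real s * a + of_real t * a)) has_vector_derivative g (z + of_real s * a)) (at (s - s))"
    using assms by (simp add: directional_derivative_def)
  moreover have "((\<lambda>t. t - s) has_vector_derivative 1) (at s)"
    by (auto intro!: derivative_eq_intros)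
  ultimately have "((\<lambda>t. f (z + of_real s * a + of_real t * a)) \<circ> (\<lambda>t. t - s)
      has_vector_derivative (1 *\<^sub>R g (z + of_real s * a))) (at s)"
    by (intro vector_diff_chain_at)
  then show ?thesis by (simp add: o_def algebra_simps)
qed

text \<open>Two applications of the mean value inequality, in the direction \<open>a\<close> and inside it in the direction \<open>b\<close>. The
  second difference is symmetric in \<open>a\<close> and \<open>b\<close>, hence so are the mixed derivatives.\<close>

lemma second_difference_quotient:
  assumes S: "open S" "z \<in> S" and f: "directional_derivative S a f g" and g: "directional_derivative S b g G"
    and G: "continuous_on S G"
  shows "((\<lambda>h. (f (z + of_real h * a + of_real h * b) - f (z + of_real h * a)
      - f (z + of_real h * b) + f z) / (of_real h)\<^sup>2) \<longlongrightarrow> G z) (at_right (0::real))"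
proof (rule tendstoI)
  fix e :: real assume e: "0 < e"
  have "continuous (at z) G" using G S continuous_on_eq_continuous_at by blast
  then obtain d1 where d1: "0 < d1" "\<And>w. dist w z < d1 \<Longrightarrow> dist (G w) (G z) < e / 2"
    using e unfolding continuous_at_eps_delta by (meson half_gt_zero)
  obtain d2 where d2: "0 < d2" "ball z d2 \<subseteq> S" using S openE by blast
  define d where "d = min d1 d2 / (cmod a + cmod b + 1)"
  have ab: "0 < cmod a + cmod b + 1" by (simp add: add_nonneg_pos)
  have d: "0 < d" unfolding d_def using d1 d2 ab by simp
  have est: "dist ((f (z + of_real h * a + of_real h * b) - f (z + of_real h * a)
      - f (z + of_real h * b) + f z) / (of_real h)\<^sup>2) (G z) < e" if h: "0 < h" "h < d" for h
  proof -
    have near: "z + of_real s * a + of_real t * b \<in> S"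
      "cmod (G (z + of_real s * a + of_real t * b) - G z) \<le> e / 2"
      if "0 \<le> s" "s \<le> h" "0 \<le> t" "t \<le> h" for s t :: real
    proof -
      have "cmod (of_real s * a + of_real t * b) \<le> s * cmod a + t * cmod b"
        using that norm_triangle_ineq[of "of_real s * a" "of_real t * b"] by (simp add: norm_mult)
      also have "\<dots> \<le> h * cmod a + h * cmod b"
        using that by (intro add_mono mult_right_mono) auto
      also have "\<dots> < h * (cmod a + cmod b + 1)" using h by (simp add: algebra_simps)
      also have "\<dots> < min d1 d2" using h ab by (simp add: d_def pos_less_divide_eq)
      finally have "dist (z + of_real s * a + of_real t * b) z < min d1 d2"
        by (simp add: dist_norm add.assoc)
      then show "z + of_real s * a + of_real t * b \<in> S"
        "cmod (G (z + of_real s * a + of_real t * b) - G z) \<le> e / 2"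
        using d1(2)[of "z + of_real s * a + of_real t * b"] d2(2)
        by (auto simp: dist_commute dist_norm[of "G _"] norm_minus_commute subset_eq)
    qed
    have inner: "cmod (g (z + of_real s * a + of_real h * b) - g (z + of_real s * a) - of_real h * G z)
        \<le> e / 2 * h" if s: "0 \<le> s" "s \<le> h" for s
    proof -
      let ?p = "\<lambda>t. g ((z + of_real s * a) + of_real t * b) - of_real t * G z"
      have "cmod (?p h - ?p 0) \<le> e / 2 * h"
      proof (rule norm_increment_le[OF h(1)])
        fix t :: real assume t: "0 \<le> t" "t \<le> h"
        have "((\<lambda>t. of_real t * G z) has_vector_derivative G z) (at t)"
          by (auto intro!: derivative_eq_intros)
        then show "(?p has_vector_derivative G ((z + of_real s * a) + of_real t * b) - G z) (at t)"
          using near(1)[OF s t] by (intro has_vector_derivative_diff directional_derivativeD[OF g]) auto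
      qed (use near(2)[OF s] in auto)
      moreover have "?p h - ?p 0 = g (z + of_real s * a + of_real h * b) - g (z + of_real s * a) - of_real h * G z"
        by (simp add: algebra_simps)
      ultimately show ?thesis by (simp only:)
    qed
    let ?q = "\<lambda>s. f ((z + of_real h * b) + of_real s * a) - f (z + of_real s * a) - of_real s * (of_real h * G z)"
    have "cmod (?q h - ?q 0) \<le> (e / 2 * h) * h"
    proof (rule norm_increment_le[OF h(1)])
      fix s :: real assume s: "0 \<le> s" "s \<le> h"
      have "((\<lambda>t. of_real t * (of_real h * G z)) has_vector_derivative of_real h * G z) (at s)"
        by (auto intro!: derivative_eq_intros)
      then show "(?q has_vector_derivative g ((z + of_real h * b) + of_real s * a) - g (z + of_real s * a)
          - of_real h * G z) (at s)"
        using near(1)[OF s, of h] near(1)[OF s, of 0] h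
        by (intro has_vector_derivative_diff directional_derivativeD[OF f]) (auto simp: add_ac)
    qed (use inner in \<open>auto simp: add_ac\<close>)
    moreover have "?q h - ?q 0 = (f (z + of_real h * a + of_real h * b) - f (z + of_real h * a)
      - f (z + of_real h * b) + f z) - (of_real h)\<^sup>2 * G z"
      by (simp add: add_ac power2_eq_square algebra_simps)
    ultimately have "cmod ((f (z + of_real h * a + of_real h * b) - f (z + of_real h * a)
      - f (z + of_real h * b) + f z) - (of_real h)\<^sup>2 * G z) \<le> (e / 2 * h) * h"
      by (simp only:)
    moreover have "(e / 2 * h) * h = e / 2 * h\<^sup>2" by (simp add: power2_eq_square)
    ultimately have "cmod ((f (z + of_real h * a + of_real h * b) - f (z + of_real h * a)
      - f (z + of_real h * b) + f z) - (of_real h)\<^sup>2 * G z) \<le> e / 2 * h\<^sup>2"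
      by (simp only:)
    moreover have "(f (z + of_real h * a + of_real h * b) - f (z + of_real h * a)
      - f (z + of_real h * b) + f z) / (of_real h)\<^sup>2 - G z = ((f (z + of_real h * a + of_real h * b) - f (z + of_real h * a)
      - f (z + of_real h * b) + f z) - (of_real h)\<^sup>2 * G z) / (of_real h)\<^sup>2"
      using h by (simp add: diff_divide_distrib)
    ultimately have "dist ((f (z + of_real h * a + of_real h * b) - f (z + of_real h * a)
      - f (z + of_real h * b) + f z) / (of_real h)\<^sup>2) (G z) \<le> e / 2"
      using h by (simp add: dist_norm norm_divide norm_power divide_le_eq)
    also have "\<dots> < e" using e by simp
    finally show ?thesis .
  qed
  show "\<forall>\<^sub>F h in at_right 0. dist ((f (z + of_real h * a + of_real h * b) - f (z + of_real h * a)
      - f (z + of_real h * b) + f z) / (of_real h)\<^sup>2) (G z) < e"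
    using d est by (auto simp: eventually_at_right_field)
qed

lemma mixed_directional_derivatives_eq:
  assumes S: "open S" "z \<in> S" and f: "directional_derivative S a f g" "directional_derivative S b f k"
    and g: "directional_derivative S b g G" and k: "directional_derivative S a k H"
    and cont: "continuous_on S G" "continuous_on S H"
  shows "G z = H z"
proof -
  have "((\<lambda>h. (f (z + of_real h * b + of_real h * a) - f (z + of_real h * b)
      - f (z + of_real h * a) + f z) / (of_real h)\<^sup>2) \<longlongrightarrow> H z) (at_right (0::real))"
    by (rule second_difference_quotient[OF S f(2) k cont(2)])
  also have "(\<lambda>h. (f (z + of_real h * b + of_real h * a) - f (z + of_real h * b)
      - f (z + of_real h * a) + f z) / (of_real h)\<^sup>2) =
    (\<lambda>h. (f (z + of_real h * a + of_real h * b) - f (z + of_real h * a)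
      - f (z + of_real h * b) + f z) / (of_real h)\<^sup>2)"
    by (rule ext) (simp add: add.commute add.left_commute)
  finally show ?thesis
    by (rule tendsto_unique[OF trivial_limit_at_right_real second_difference_quotient[OF S f(1) g cont(1)]])
qed

section \<open>Harmonic maps as \<open>h + cnj g\<close>\<close>

lemma has_derivative_partials:
  assumes "f differentiable (at z)"
  shows "(f has_derivative (\<lambda>v. of_real (Re v) * partial_x f z + of_real (Im v) * partial_y f z)) (at z)"
proof -
  obtain D where D: "(f has_derivative D) (at z)" using assms by (auto simp: differentiable_def)
  interpret D: bounded_linear D using D by (rule has_derivative_bounded_linear)
  have dir: "((\<lambda>t. f (z + of_real t * a)) has_vector_derivative D a) (at 0)" for a
  proof -
    have line: "((\<lambda>t::real. z + of_real t * a) has_derivative (\<lambda>t. of_real t * a)) (at 0)"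
      by (auto intro!: derivative_eq_intros)
    have "((\<lambda>t. f (z + of_real t * a)) has_derivative (\<lambda>t. D (of_real t * a))) (at 0)"
      by (rule has_derivative_compose[OF line]) (simp add: D)
    then show ?thesis
      by (simp add: has_vector_derivative_def D.scaleR flip: scaleR_conv_of_real)
  qed
  have p: "partial_x f z = D 1" "partial_y f z = D \<i>"
    using dir[of 1] dir[of \<i>] by (simp_all add: partial_x_def partial_y_def vector_derivative_at mult.commute)
  have "D v = of_real (Re v) * D 1 + of_real (Im v) * D \<i>" for v
  proof -
    have v: "v = Re v *\<^sub>R 1 + Im v *\<^sub>R \<i>" by (simp add: complex_eq_iff)
    have "D (Re v *\<^sub>R 1 + Im v *\<^sub>R \<i>) = of_real (Re v) * D 1 + of_real (Im v) * D \<i>"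
      unfolding D.add D.scaleR by (simp only: scaleR_conv_of_real)
    then show ?thesis by (simp only: v[symmetric])
  qed
  then have "(\<lambda>v. of_real (Re v) * partial_x f z + of_real (Im v) * partial_y f z) = D"
    unfolding p by (intro ext) (rule sym)
  then show ?thesis using D by (simp only:)
qed

lemma directional_partials:
  assumes "\<And>z. z \<in> S \<Longrightarrow> f differentiable (at z)"
  shows "directional_derivative S 1 f (partial_x f)" "directional_derivative S \<i> f (partial_y f)"
proof -
  have "((\<lambda>t. f (z + of_real t * a)) has_vector_derivative
      (of_real (Re a) * partial_x f z + of_real (Im a) * partial_y f z)) (at 0)" if "z \<in> S" for z a
  proof -
    have line: "((\<lambda>t::real. z + of_real t * a) has_derivative (\<lambda>t. of_real t * a)) (at 0)"
      by (auto intro!: derivative_eq_intros)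
    have "((\<lambda>t. f (z + of_real t * a)) has_derivative
        (\<lambda>t. of_real (Re (of_real t * a)) * partial_x f z + of_real (Im (of_real t * a)) * partial_y f z)) (at 0)"
      by (rule has_derivative_compose[OF line]) (simp add: has_derivative_partials[OF assms[OF that]])
    then show ?thesis
      by (simp add: has_vector_derivative_def scaleR_conv_of_real algebra_simps)
  qed
  from this[of _ 1] this[of _ \<i>]
  show "directional_derivative S 1 f (partial_x f)" "directional_derivative S \<i> f (partial_y f)"
    by (simp_all add: directional_derivative_def)
qed

lemma holomorphic_if_cauchy_riemann:
  assumes S: "open S" and F: "\<And>z. z \<in> S \<Longrightarrow>
      (F has_derivative (\<lambda>v. of_real (Re v) * A z + of_real (Im v) * B z)) (at z)"
    and CR: "\<And>z. z \<in> S \<Longrightarrow> B z = \<i> * A z"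
  shows "F holomorphic_on S"
proof (rule holomorphic_onI)
  fix z assume z: "z \<in> S"
  have "of_real (Re v) * A z + of_real (Im v) * B z = A z * v" for v
    using CR[OF z] by (simp add: complex_eq_iff algebra_simps)
  then have "(F has_field_derivative A z) (at z)"
    using F[OF z] by (simp add: has_field_derivative_def)
  then show "F field_differentiable (at z within S)"
    using field_differentiable_at_within field_differentiable_def by blast
qed

text \<open>By the symmetry of the mixed partial derivatives, Laplace's equation is the Cauchy--Riemann system for
  \<open>f\<^sub>z\<close> and for the conjugate of the other Wirtinger derivative. The functions \<open>h\<close> and \<open>g\<close> are their primitives,
  up to a constant.\<close>

lemma harmonic_decomposition:
  assumes f: "harmonic_on (ball 0 1) f"
  obtains h g where "h holomorphic_on ball 0 1" "g holomorphic_on ball 0 1"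
    "\<And>z. z \<in> ball 0 1 \<Longrightarrow> f z = h z + cnj (g z)"
    "\<And>z. z \<in> ball 0 1 \<Longrightarrow> deriv h z = wirtinger f z"
    "\<And>z. z \<in> ball 0 1 \<Longrightarrow> deriv g z = cnj (wirtinger_bar f z)"
proof -
  let ?D = "ball (0::complex) 1"
  let ?fx = "partial_x f" and ?fy = "partial_y f"
  have diff: "\<And>z. z \<in> ?D \<Longrightarrow> f differentiable (at z)"
    "\<And>z. z \<in> ?D \<Longrightarrow> ?fx differentiable (at z)" "\<And>z. z \<in> ?D \<Longrightarrow> ?fy differentiable (at z)"
    and cont: "continuous_on ?D (partial_y ?fx)" "continuous_on ?D (partial_x ?fy)"
    and lap: "\<And>z. z \<in> ?D \<Longrightarrow> partial_x ?fx z + partial_y ?fy z = 0"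
    using f by (auto simp: harmonic_on_def C1_on_def)
  have mixed: "partial_y ?fx z = partial_x ?fy z" if "z \<in> ?D" for z
    by (rule mixed_directional_derivatives_eq[OF open_ball that directional_partials[OF diff(1)]
          directional_partials(2)[OF diff(2)] directional_partials(1)[OF diff(3)] cont])
  have lap': "partial_y ?fy z = - partial_x ?fx z" if "z \<in> ?D" for z
    using lap[OF that] by (simp add: add_eq_0_iff)
  note dfx = has_derivative_partials[OF diff(2)] and dfy = has_derivative_partials[OF diff(3)]
  have W: "wirtinger f holomorphic_on ?D"
  proof (rule holomorphic_if_cauchy_riemann[OF open_ball])
    fix z assume z: "z \<in> ?D"
    have "((\<lambda>z. (?fx z - \<i> * ?fy z) * (1/2)) has_derivative (\<lambda>v.
        ((of_real (Re v) * partial_x ?fx z + of_real (Im v) * partial_y ?fx z)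
          - \<i> * (of_real (Re v) * partial_x ?fy z + of_real (Im v) * partial_y ?fy z)) * (1/2))) (at z)"
      by (intro derivative_intros dfx[OF z] dfy[OF z])
    then show "(wirtinger f has_derivative (\<lambda>v. of_real (Re v) * ((partial_x ?fx z - \<i> * partial_x ?fy z) / 2)
        + of_real (Im v) * ((partial_y ?fx z - \<i> * partial_y ?fy z) / 2))) (at z)"
      by (simp add: wirtinger_def[abs_def] algebra_simps add_divide_distrib diff_divide_distrib)
    show "(partial_y ?fx z - \<i> * partial_y ?fy z) / 2 = \<i> * ((partial_x ?fx z - \<i> * partial_x ?fy z) / 2)"
      using mixed[OF z] lap'[OF z] by (simp add: field_simps)
  qed
  have V: "(\<lambda>z. cnj (wirtinger_bar f z)) holomorphic_on ?D"
  proof (rule holomorphic_if_cauchy_riemann[OF open_ball])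
    fix z assume z: "z \<in> ?D"
    have "((\<lambda>z. cnj (?fx z) * (1/2) - \<i> * cnj (?fy z) * (1/2)) has_derivative (\<lambda>v.
        cnj (of_real (Re v) * partial_x ?fx z + of_real (Im v) * partial_y ?fx z) * (1/2)
          - \<i> * cnj (of_real (Re v) * partial_x ?fy z + of_real (Im v) * partial_y ?fy z) * (1/2))) (at z)"
      by (intro derivative_intros dfx[OF z] dfy[OF z])
    then show "((\<lambda>z. cnj (wirtinger_bar f z)) has_derivative
        (\<lambda>v. of_real (Re v) * cnj ((partial_x ?fx z + \<i> * partial_x ?fy z) / 2)
        + of_real (Im v) * cnj ((partial_y ?fx z + \<i> * partial_y ?fy z) / 2))) (at z)"
      by (simp add: wirtinger_bar_def field_simps)
    show "cnj ((partial_y ?fx z + \<i> * partial_y ?fy z) / 2)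
        = \<i> * cnj ((partial_x ?fx z + \<i> * partial_x ?fy z) / 2)"
      using mixed[OF z] lap'[OF z] by (simp add: field_simps)
  qed
  obtain h0 where h0: "\<And>z. z \<in> ?D \<Longrightarrow> (h0 has_field_derivative wirtinger f z) (at z within ?D)"
    using holomorphic_convex_primitive'[OF convex_ball open_ball W] by blast
  obtain g where g: "\<And>z. z \<in> ?D \<Longrightarrow> (g has_field_derivative cnj (wirtinger_bar f z)) (at z within ?D)"
    using holomorphic_convex_primitive'[OF convex_ball open_ball V] by blast
  have "((\<lambda>z. f z - h0 z - cnj (g z)) has_derivative (\<lambda>v. 0)) (at z within ?D)" if z: "z \<in> ?D" for z
  proof -
    have "((\<lambda>z. f z - h0 z - cnj (g z)) has_derivative
      (\<lambda>v. (of_real (Re v) * ?fx z + of_real (Im v) * ?fy z) - wirtinger f z * v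
          - cnj (cnj (wirtinger_bar f z) * v))) (at z within ?D)"
      using h0[OF z] g[OF z] has_derivative_at_withinI[OF has_derivative_partials[OF diff(1)[OF z]]]
      unfolding has_field_derivative_def by (intro derivative_intros) auto
    moreover have "(of_real (Re v) * ?fx z + of_real (Im v) * ?fy z) - wirtinger f z * v
          - cnj (cnj (wirtinger_bar f z) * v) = 0" for v
      by (simp add: wirtinger_def wirtinger_bar_def complex_eq_iff field_simps)
    ultimately show ?thesis by simp
  qed
  then have "\<exists>c. \<forall>z\<in>?D. f z - h0 z - cnj (g z) = c"
    by (rule has_derivative_zero_constant[OF convex_ball])
  then obtain c where c: "\<And>z. z \<in> ?D \<Longrightarrow> f z - h0 z - cnj (g z) = c" by blast
  have h: "((\<lambda>z. h0 z + c) has_field_derivative wirtinger f z) (at z within ?D)" if "z \<in> ?D" for z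
    using DERIV_add[OF h0[OF that] DERIV_const[of c]] by simp
  show ?thesis
  proof
    show "(\<lambda>z. h0 z + c) holomorphic_on ?D" "g holomorphic_on ?D"
      using h g unfolding holomorphic_on_def field_differentiable_def by blast+
    show "f z = h0 z + c + cnj (g z)" if "z \<in> ?D" for z
      using c[OF that] by (simp add: algebra_simps)
    show "deriv (\<lambda>z. h0 z + c) z = wirtinger f z" "deriv g z = cnj (wirtinger_bar f z)" if "z \<in> ?D" for z
      using h[OF that] g[OF that] that by (auto simp: at_within_open[OF _ open_ball] intro!: DERIV_imp_deriv)
  qed
qed

section \<open>Quasiregularity at every point\<close>

text \<open>The exceptional set is open, and a nonempty open set is not negligible.\<close>

lemma nonneg_on_open_if_AE:
  fixes e :: "'a::euclidean_space \<Rightarrow> real"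
  assumes S: "open S" and e: "continuous_on S e" and AE: "AE z in lebesgue_on S. 0 \<le> e z" and z: "z \<in> S"
  shows "0 \<le> e z"
proof (rule ccontr)
  assume "\<not> 0 \<le> e z"
  define U where "U = S \<inter> e -` {..<0}"
  have U: "open U" unfolding U_def by (rule continuous_open_preimage[OF e S]) simp
  have "S \<in> sets lebesgue" using S by auto
  then have "AE z in lebesgue. z \<in> S \<longrightarrow> 0 \<le> e z"
    using AE by (simp add: AE_restrict_space_iff)
  then have "AE z in lebesgue. z \<notin> U" by eventually_elim (auto simp: U_def)
  moreover have "U \<in> sets lebesgue" using U by auto
  ultimately have "negligible U"
    using AE_iff_null_sets negligible_iff_null_sets by blast
  then have "U = {}" using open_not_negligible[OF U] by blast
  with z \<open>\<not> 0 \<le> e z\<close> show False by (auto simp: U_def)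
qed

text \<open>For a \<open>C\<^sup>1\<close> map the distortion inequality, which holds almost everywhere, holds everywhere by continuity;
  division by the operator norm of the derivative, the sum on its left hand side, makes it linear.\<close>

lemma quasiregular_everywhere:
  assumes C1: "C1_on S f" and S: "open S" and K: "quasiregular_on K S f" and z: "z \<in> S"
  shows "cmod (wirtinger f z) + cmod (wirtinger_bar f z)
    \<le> K * (cmod (wirtinger f z) - cmod (wirtinger_bar f z))"
proof -
  let ?a = "\<lambda>z. cmod (wirtinger f z)" and ?b = "\<lambda>z. cmod (wirtinger_bar f z)"
  have cont: "continuous_on S (wirtinger f)" "continuous_on S (wirtinger_bar f)"
    using C1 unfolding C1_on_def wirtinger_def[abs_def] wirtinger_bar_def[abs_def]
    by (auto intro!: continuous_intros)
  have "0 \<le> K * jacobian_planar f z - (?a z + ?b z)\<^sup>2"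
  proof (rule nonneg_on_open_if_AE[OF S _ _ z])
    show "continuous_on S (\<lambda>z. K * jacobian_planar f z - (?a z + ?b z)\<^sup>2)"
      unfolding jacobian_planar_def by (intro continuous_intros cont)
    show "AE z in lebesgue_on S. 0 \<le> K * jacobian_planar f z - (?a z + ?b z)\<^sup>2"
      using K by (simp add: quasiregular_on_def)
  qed
  then have le: "(?a z + ?b z) * (?a z + ?b z) \<le> (?a z + ?b z) * (K * (?a z - ?b z))"
    by (simp add: jacobian_planar_def power2_eq_square algebra_simps)
  show ?thesis
  proof (cases "?a z + ?b z = 0")
    case True
    then have "?a z = 0" "?b z = 0" using norm_ge_zero[of "wirtinger f z"] norm_ge_zero[of "wirtinger_bar f z"] by linarith+
    then show ?thesis by simp
  next
    case False
    then have "0 < ?a z + ?b z" by (simp add: add_nonneg_eq_0_iff order_less_le)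
    then show ?thesis using le by (metis mult_le_cancel_left_pos)
  qed
qed

section \<open>Pointwise estimates\<close>

lemma poisson_kernel_integral:
  assumes "cmod z < 1"
  shows "(poisson_kernel z has_integral 2 * pi) {0..2*pi}"
  using real_part_boundary_formulas(2)[where u = "\<lambda>_. 1" and L = "\<lambda>_. 1" and z = z] assms by simp

lemma derivative_kernel_integral:
  assumes "cmod z < 1"
  shows "((\<lambda>\<tau>. cis \<tau> / (cis \<tau> - z)\<^sup>2) has_integral 0) {0..2*pi}"
  using real_part_boundary_formulas(1)[where u = "\<lambda>_. 1" and L = "\<lambda>_. 1" and z = z] assms by simp

lemma norm_derivative_kernel: "cmod (cis \<tau> / (cis \<tau> - z)\<^sup>2) = 1 / (cmod (cis \<tau> - z))\<^sup>2"
  by (simp add: norm_divide norm_power)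

lemma continuous_on_div_dist_square:
  assumes "continuous_on {0..2*pi} a" "cmod z < 1"
  shows "continuous_on {0..2*pi} (\<lambda>\<tau>. a \<tau> / (cmod (cis \<tau> - z))\<^sup>2)"
  using cis_minus_nonzero[OF assms(2)] by (intro continuous_intros assms) auto

context
  fixes f h g :: "complex \<Rightarrow> complex"
  assumes cont: "continuous_on (cball 0 1) f"
    and h: "h holomorphic_on ball 0 1" and g: "g holomorphic_on ball 0 1"
    and f_eq: "\<And>z. z \<in> ball 0 1 \<Longrightarrow> f z = h z + cnj (g z)"
begin

lemma continuous_norm: "continuous_on (sphere 0 1) (\<lambda>\<xi>. cmod (f \<xi>))"
  by (intro continuous_intros continuous_on_subset[OF cont]) auto

text \<open>The function \<open>Re (w f)\<close> is the real part of the holomorphic function \<open>w h + cnj w g\<close>, whose derivative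
  encodes the gradient of \<open>Re (w f)\<close>.\<close>

lemma directional_real_part:
  assumes z: "cmod z < 1"
  shows "((\<lambda>\<tau>. of_real (Re (w * f (cis \<tau>))) * (cis \<tau> / (cis \<tau> - z)\<^sup>2)) has_integral
      (pi * (w * deriv h z + cnj w * deriv g z))) {0..2*pi}"
    and "((\<lambda>\<tau>. Re (w * f (cis \<tau>)) * poisson_kernel z \<tau>) has_integral (2 * pi * Re (w * f z))) {0..2*pi}"
proof -
  define L where "L = (\<lambda>z. w * h z + cnj w * g z)"
  have L: "L holomorphic_on ball 0 1" unfolding L_def by (intro holomorphic_intros h g)
  have u: "continuous_on (cball 0 1) (\<lambda>z. Re (w * f z))" by (intro continuous_intros cont)
  have "deriv L z = w * deriv h z + cnj w * deriv g z"
    unfolding L_def using h g z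
    by (intro DERIV_imp_deriv) (auto intro!: derivative_eq_intros holomorphic_derivI[where S = "ball 0 1"])
  moreover have "Re (w * f x) = Re (L x)" if "x \<in> ball 0 1" for x
    unfolding L_def f_eq[OF that] by (simp add: algebra_simps)
  ultimately show "((\<lambda>\<tau>. of_real (Re (w * f (cis \<tau>))) * (cis \<tau> / (cis \<tau> - z)\<^sup>2)) has_integral
      (pi * (w * deriv h z + cnj w * deriv g z))) {0..2*pi}"
    and "((\<lambda>\<tau>. Re (w * f (cis \<tau>)) * poisson_kernel z \<tau>) has_integral (2 * pi * Re (w * f z))) {0..2*pi}"
    using real_part_boundary_formulas[OF u L _ z] by auto
qed

lemma obtain_aligning_rotation:
  obtains w where "cmod w = 1" "w * f z = of_real (cmod (f z))"
proof (cases "f z = 0")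
  case True
  then show ?thesis using that[of 1] by simp
next
  case False
  show ?thesis
  proof (rule that[of "cnj (f z) / of_real (cmod (f z))"])
    show "cmod (cnj (f z) / of_real (cmod (f z))) = 1" using False by (simp add: norm_divide)
    show "cnj (f z) / of_real (cmod (f z)) * f z = of_real (cmod (f z))"
      using False complex_norm_square[of "f z"] by (simp add: field_simps power2_eq_square)
  qed
qed

lemma poisson_norm_integral:
  assumes z: "cmod z < 1"
  shows "((\<lambda>\<tau>. cmod (f (cis \<tau>)) * poisson_kernel z \<tau>) has_integral (2 * pi * poisson (\<lambda>\<xi>. cmod (f \<xi>)) z)) {0..2*pi}"
  using integrable_continuous_interval[OF continuous_on_poisson_integrand[OF continuous_norm z]]
  by (simp add: poisson_eq_integral[OF continuous_norm z] has_integral_integrable_integral)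

text \<open>For the unimodular \<open>w\<close> with \<open>w f(z) = \<bar>f(z)\<bar>\<close>, the function \<open>Re (w f)\<close> is the Poisson integral of its boundary
  values, lies below \<open>\<bar>f\<bar>\<close> on the circle and equals \<open>\<bar>f\<bar>\<close> at \<open>z\<close>.\<close>

lemma norm_le_poisson:
  assumes z: "cmod z < 1"
  shows "cmod (f z) \<le> poisson (\<lambda>\<xi>. cmod (f \<xi>)) z"
proof -
  obtain w where w: "cmod w = 1" "w * f z = of_real (cmod (f z))" by (rule obtain_aligning_rotation)
  have "2 * pi * Re (w * f z) \<le> 2 * pi * poisson (\<lambda>\<xi>. cmod (f \<xi>)) z"
  proof (rule has_integral_le[OF directional_real_part(2)[OF z] poisson_norm_integral[OF z]])
    fix \<tau>
    have "Re (w * f (cis \<tau>)) \<le> cmod (f (cis \<tau>))"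
      using complex_Re_le_cmod[of "w * f (cis \<tau>)"] w(1) by (simp add: norm_mult)
    then show "Re (w * f (cis \<tau>)) * poisson_kernel z \<tau> \<le> cmod (f (cis \<tau>)) * poisson_kernel z \<tau>"
      by (intro mult_right_mono poisson_kernel_nonneg z)
  qed
  then show ?thesis by (simp add: w(2))
qed

text \<open>Let \<open>w\<close> be unimodular with \<open>w f(z) = \<bar>f(z)\<bar>\<close>. Then \<open>\<psi> = \<bar>f\<bar> - Re (w f)\<close> is nonnegative on the circle and
  its Poisson integral at \<open>z\<close> is the defect \<open>P[\<bar>f\<bar>](z) - \<bar>f(z)\<bar>\<close>. The modulus of the derivative kernel is the
  Poisson kernel divided by \<open>1 - \<bar>z\<bar>\<^sup>2\<close>, so the gradient of the Poisson integral of \<open>\<psi>\<close> is at most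
  \<open>2 / (1 - \<bar>z\<bar>\<^sup>2)\<close> times the defect. What remains of the gradient of \<open>Re (w f)\<close> comes from \<open>\<bar>f\<bar>\<close>, from which a
  constant \<open>c\<close> can be subtracted because the kernel has mean zero. The left hand side is the least possible
  gradient of \<open>Re (w f)\<close> over all unimodular \<open>w\<close>, up to sign.\<close>

lemma derivative_gap_le:
  assumes z: "cmod z < 1"
  shows "cmod (deriv h z) - cmod (deriv g z)
    \<le> integral {0..2*pi} (\<lambda>\<tau>. \<bar>cmod (f (cis \<tau>)) - c\<bar> / (cmod (cis \<tau> - z))\<^sup>2) / pi
      + 2 / (1 - (cmod z)\<^sup>2) * (poisson (\<lambda>\<xi>. cmod (f \<xi>)) z - cmod (f z))"
proof -
  obtain w where w: "cmod w = 1" "w * f z = of_real (cmod (f z))" by (rule obtain_aligning_rotation)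
  let ?k = "\<lambda>\<tau>. cis \<tau> / (cis \<tau> - z)\<^sup>2"
  let ?u = "\<lambda>\<tau>. Re (w * f (cis \<tau>))" and ?\<phi> = "\<lambda>\<tau>. cmod (f (cis \<tau>))"
  have sq: "0 < 1 - (cmod z)\<^sup>2" using z by (simp add: abs_square_less_1)
  let ?G = "w * deriv h z + cnj w * deriv g z"
  have "cmod (deriv h z) - cmod (deriv g z) \<le> cmod ?G"
    using norm_diff_ineq[of "w * deriv h z" "cnj w * deriv g z"] w(1) by (simp add: norm_mult)
  moreover have "pi * cmod ?G
      \<le> integral {0..2*pi} (\<lambda>\<tau>. \<bar>?\<phi> \<tau> - c\<bar> / (cmod (cis \<tau> - z))\<^sup>2)
        + 1 / (1 - (cmod z)\<^sup>2) * (2 * pi * poisson (\<lambda>\<xi>. cmod (f \<xi>)) z - 2 * pi * Re (w * f z))"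
    (is "_ \<le> ?A + ?B")
  proof -
    have "((\<lambda>\<tau>. of_real (?u \<tau>) * ?k \<tau> - of_real c * ?k \<tau>) has_integral (pi * ?G - of_real c * 0)) {0..2*pi}"
      by (intro has_integral_diff directional_real_part(1)[OF z] has_integral_mult_right derivative_kernel_integral[OF z])
    then have 1: "((\<lambda>\<tau>. of_real (?u \<tau> - c) * ?k \<tau>) has_integral (pi * ?G)) {0..2*pi}"
      by (simp add: left_diff_distrib diff_divide_distrib)
    have "continuous_on {0..2*pi} (\<lambda>\<tau>. \<bar>?\<phi> \<tau> - c\<bar> / (cmod (cis \<tau> - z))\<^sup>2)"
      by (intro continuous_on_div_dist_square[OF _ z] continuous_intros continuous_on_cis_compose[OF continuous_norm])
    then have 2: "((\<lambda>\<tau>. \<bar>?\<phi> \<tau> - c\<bar> / (cmod (cis \<tau> - z))\<^sup>2) has_integral ?A) {0..2*pi}"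
      by (intro integrable_integral integrable_continuous_interval)
    have 3: "((\<lambda>\<tau>. 1 / (1 - (cmod z)\<^sup>2) * (?\<phi> \<tau> * poisson_kernel z \<tau> - ?u \<tau> * poisson_kernel z \<tau>)) has_integral ?B) {0..2*pi}"
      by (intro has_integral_mult_right has_integral_diff poisson_norm_integral[OF z] directional_real_part(2)[OF z])
    note 4 = has_integral_add[OF 2 3]
    have "cmod (integral {0..2*pi} (\<lambda>\<tau>. of_real (?u \<tau> - c) * ?k \<tau>))
      \<le> integral {0..2*pi} (\<lambda>\<tau>. \<bar>?\<phi> \<tau> - c\<bar> / (cmod (cis \<tau> - z))\<^sup>2
          + 1 / (1 - (cmod z)\<^sup>2) * (?\<phi> \<tau> * poisson_kernel z \<tau> - ?u \<tau> * poisson_kernel z \<tau>))"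
    proof (rule Henstock_Kurzweil_Integration.integral_norm_bound_integral)
      fix \<tau>
      have "?u \<tau> \<le> ?\<phi> \<tau>"
        using complex_Re_le_cmod[of "w * f (cis \<tau>)"] w(1) by (simp add: norm_mult)
      \<comment> \<open>The part \<open>?\<phi> \<tau> - ?u \<tau>\<close> is nonnegative, so its kernel integral is exactly a multiple of the defect.\<close>
      then have "\<bar>?u \<tau> - c\<bar> \<le> \<bar>?\<phi> \<tau> - c\<bar> + (?\<phi> \<tau> - ?u \<tau>)" by simp
      then have "\<bar>?u \<tau> - c\<bar> / (cmod (cis \<tau> - z))\<^sup>2 \<le> (\<bar>?\<phi> \<tau> - c\<bar> + (?\<phi> \<tau> - ?u \<tau>)) / (cmod (cis \<tau> - z))\<^sup>2"
        by (intro divide_right_mono) auto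
      also have "\<dots> = \<bar>?\<phi> \<tau> - c\<bar> / (cmod (cis \<tau> - z))\<^sup>2
          + 1 / (1 - (cmod z)\<^sup>2) * (?\<phi> \<tau> * poisson_kernel z \<tau> - ?u \<tau> * poisson_kernel z \<tau>)"
      proof -
        have "x / N = 1 / (1 - s) * (x * ((1 - s) / N))" if "1 - s \<noteq> 0" for x N s :: real
          using that by simp
        then show ?thesis
          using sq unfolding poisson_kernel_def left_diff_distrib[symmetric] add_divide_distrib
          by (metis less_irrefl)
      qed
      finally show "cmod (of_real (?u \<tau> - c) * ?k \<tau>) \<le> \<bar>?\<phi> \<tau> - c\<bar> / (cmod (cis \<tau> - z))\<^sup>2
          + 1 / (1 - (cmod z)\<^sup>2) * (?\<phi> \<tau> * poisson_kernel z \<tau> - ?u \<tau> * poisson_kernel z \<tau>)"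
        unfolding norm_mult norm_derivative_kernel norm_of_real by simp
    qed (use 1 4 in \<open>blast+\<close>)
    then show ?thesis
      unfolding integral_unique[OF 1] integral_unique[OF 4] by (simp add: norm_mult)
  qed
  ultimately have "pi * (cmod (deriv h z) - cmod (deriv g z)) \<le> ?A + ?B"
    by (meson mult_left_mono order_trans pi_ge_zero)
  then have "cmod (deriv h z) - cmod (deriv g z) \<le> (?A + ?B) / pi"
    by (simp add: field_simps)
  also have "(?A + ?B) / pi = ?A / pi
      + 2 / (1 - (cmod z)\<^sup>2) * (poisson (\<lambda>\<xi>. cmod (f \<xi>)) z - cmod (f z))"
    by (simp add: w(2) add_divide_distrib diff_divide_distrib right_diff_distrib)
  finally show ?thesis .
qed

end

text \<open>Rotating \<open>f\<close> instead of the point puts the kernel at a real point \<open>r\<close>. The same kernel then serves all angles,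
  as Minkowski's inequality requires. The constant is the value of \<open>\<bar>f\<bar>\<close> at the radial projection.\<close>

lemma derivative_gap_le_rotated:
  fixes f h g :: "complex \<Rightarrow> complex"
  assumes cont: "continuous_on (cball 0 1) f"
    and h: "h holomorphic_on ball 0 1" and g: "g holomorphic_on ball 0 1"
    and f_eq: "\<And>z. z \<in> ball 0 1 \<Longrightarrow> f z = h z + cnj (g z)"
    and \<zeta>: "cmod \<zeta> = 1" and r: "0 \<le> r" "r < 1"
  shows "cmod (deriv h (\<zeta> * of_real r)) - cmod (deriv g (\<zeta> * of_real r))
    \<le> integral {0..2*pi} (\<lambda>\<tau>. \<bar>cmod (f (\<zeta> * cis \<tau>)) - cmod (f \<zeta>)\<bar> / (cmod (cis \<tau> - of_real r))\<^sup>2) / pi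
      + 2 / (1 - r\<^sup>2) * (poisson (\<lambda>\<xi>. cmod (f \<xi>)) (\<zeta> * of_real r) - cmod (f (\<zeta> * of_real r)))"
proof -
  have z: "cmod (of_real r :: complex) < 1" using r by simp
  have rot: "\<zeta> * z \<in> ball 0 1" if "z \<in> ball 0 1" for z using that \<zeta> by (simp add: norm_mult)
  have cont': "continuous_on (cball 0 1) (\<lambda>z. f (\<zeta> * z))"
    by (rule continuous_on_compose2[OF cont]) (use \<zeta> in \<open>auto intro!: continuous_intros simp: norm_mult\<close>)
  have holo: "(\<lambda>z. F (\<zeta> * z)) holomorphic_on ball 0 1"
    and deriv: "cmod (deriv (\<lambda>z. F (\<zeta> * z)) (of_real r)) = cmod (deriv F (\<zeta> * of_real r))"
    if F: "F holomorphic_on ball 0 1" for F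
  proof -
    have D: "((\<lambda>z. F (\<zeta> * z)) has_field_derivative (deriv F (\<zeta> * z) * \<zeta>)) (at z)" if "z \<in> ball 0 1" for z
      by (rule DERIV_chain2[where g = "\<lambda>z. \<zeta> * z", OF holomorphic_derivI[OF F open_ball rot[OF that]]])
         (auto intro!: derivative_eq_intros)
    then show "(\<lambda>z. F (\<zeta> * z)) holomorphic_on ball 0 1"
      unfolding holomorphic_on_open[OF open_ball] by blast
    show "cmod (deriv (\<lambda>z. F (\<zeta> * z)) (of_real r)) = cmod (deriv F (\<zeta> * of_real r))"
      using DERIV_imp_deriv[OF D, of "of_real r"] z \<zeta> by (simp add: norm_mult)
  qed
  have "continuous_on (sphere 0 1) (\<lambda>\<xi>. cmod (f \<xi>))"
    by (intro continuous_intros continuous_on_subset[OF cont]) auto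
  note rotate = poisson_rotate[OF this z \<zeta>]
  show ?thesis
    using derivative_gap_le[OF cont' holo[OF h] holo[OF g] f_eq[OF rot] z, of "cmod (f \<zeta>)"]
    by (simp add: deriv[OF h] deriv[OF g] rotate)
qed

text \<open>The Poisson kernel is a probability density up to the factor \<open>2 \<pi>\<close>, so the defect is the average of
  \<open>\<bar>f(\<xi>)\<bar> - \<bar>f(z)\<bar> \<le> \<bar>f(\<xi>) - f(z)\<bar>\<close>.\<close>

lemma poisson_minus_norm_le:
  assumes cont: "continuous_on (cball 0 1) (f :: complex \<Rightarrow> complex)"
    and \<zeta>: "cmod \<zeta> = 1" and r: "0 \<le> r" "r < 1"
  shows "poisson (\<lambda>\<xi>. cmod (f \<xi>)) (\<zeta> * of_real r) - cmod (f (\<zeta> * of_real r))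
    \<le> integral {0..2*pi} (\<lambda>\<tau>. cmod (f (\<zeta> * cis \<tau>) - f (\<zeta> * of_real r)) / (cmod (cis \<tau> - of_real r))\<^sup>2)
        * (1 - r\<^sup>2) / (2 * pi)"
proof -
  have z: "cmod (of_real r :: complex) < 1" using r by simp
  have cont': "continuous_on (cball 0 1) (\<lambda>z. f (\<zeta> * z))"
    by (rule continuous_on_compose2[OF cont]) (use \<zeta> in \<open>auto intro!: continuous_intros simp: norm_mult\<close>)
  have phi: "continuous_on (sphere 0 1) (\<lambda>\<xi>. cmod (f \<xi>))" 
    by (intro continuous_intros continuous_on_subset[OF cont]) auto
  have phi': "continuous_on (sphere 0 1) (\<lambda>\<xi>. cmod (f (\<zeta> * \<xi>)))"
    by (intro continuous_intros continuous_on_subset[OF cont']) auto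
  have diff: "continuous_on (sphere 0 1) (\<lambda>\<xi>. cmod (f (\<zeta> * \<xi>) - f (\<zeta> * of_real r)))"
    by (intro continuous_intros continuous_on_subset[OF cont']) auto
  have "integral {0..2*pi} (\<lambda>\<tau>. cmod (f (\<zeta> * cis \<tau>)) * poisson_kernel (of_real r) \<tau>)
      - cmod (f (\<zeta> * of_real r)) * (2 * pi)
      = integral {0..2*pi} (\<lambda>\<tau>. cmod (f (\<zeta> * cis \<tau>)) * poisson_kernel (of_real r) \<tau>
          - cmod (f (\<zeta> * of_real r)) * poisson_kernel (of_real r) \<tau>)"
    by (rule integral_unique[symmetric])
       (intro has_integral_diff has_integral_mult_right poisson_kernel_integral[OF z] integrable_integral
         integrable_continuous_interval continuous_on_poisson_integrand[OF phi' z])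
  also have "\<dots> \<le> integral {0..2*pi} (\<lambda>\<tau>. cmod (f (\<zeta> * cis \<tau>) - f (\<zeta> * of_real r)) * poisson_kernel (of_real r) \<tau>)"
  proof (rule integral_le)
    show "(\<lambda>\<tau>. cmod (f (\<zeta> * cis \<tau>)) * poisson_kernel (of_real r) \<tau>
          - cmod (f (\<zeta> * of_real r)) * poisson_kernel (of_real r) \<tau>) integrable_on {0..2*pi}"
      using poisson_kernel_integral[OF z]
      by (intro integrable_diff integrable_on_mult_right has_integral_integrable
        integrable_continuous_interval continuous_on_poisson_integrand[OF phi' z])
    show "(\<lambda>\<tau>. cmod (f (\<zeta> * cis \<tau>) - f (\<zeta> * of_real r)) * poisson_kernel (of_real r) \<tau>) integrable_on {0..2*pi}"
      by (intro integrable_continuous_interval continuous_on_poisson_integrand[OF diff z])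
    fix \<tau>
    have "cmod (f (\<zeta> * cis \<tau>)) - cmod (f (\<zeta> * of_real r)) \<le> cmod (f (\<zeta> * cis \<tau>) - f (\<zeta> * of_real r))"
      by (rule norm_triangle_ineq2)
    then show "cmod (f (\<zeta> * cis \<tau>)) * poisson_kernel (of_real r) \<tau>
          - cmod (f (\<zeta> * of_real r)) * poisson_kernel (of_real r) \<tau>
        \<le> cmod (f (\<zeta> * cis \<tau>) - f (\<zeta> * of_real r)) * poisson_kernel (of_real r) \<tau>"
      by (simp only: left_diff_distrib[symmetric]) (intro mult_right_mono poisson_kernel_nonneg z)
  qed
  also have "\<dots> = integral {0..2*pi} (\<lambda>\<tau>. cmod (f (\<zeta> * cis \<tau>) - f (\<zeta> * of_real r)) / (cmod (cis \<tau> - of_real r))\<^sup>2) * (1 - r\<^sup>2)"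
    using r by (subst integral_mult_left[symmetric]) (simp add: poisson_kernel_def)
  finally have "2 * pi * poisson (\<lambda>\<xi>. cmod (f (\<zeta> * \<xi>))) (of_real r) - cmod (f (\<zeta> * of_real r)) * (2 * pi) \<le> \<dots>"
    by (simp add: poisson_eq_integral[OF phi' z])
  then show ?thesis
    unfolding poisson_rotate[OF phi z \<zeta>] by (subst pos_le_divide_eq) (auto simp: mult.commute right_diff_distrib)
qed

section \<open>From pointwise estimates to \<open>L\<^sup>p\<close> estimates\<close>

lemma Lp_bounded_if_Lp_diff:
  assumes "\<And>\<eta>. Lp_diff p F (cis \<eta> * a) (cis \<eta> * b) \<le> ennreal B" "0 \<le> B"
  shows "Lp_bounded p (\<lambda>\<eta>. norm (F (cis \<eta> * a) - F (cis \<eta> * b))) B"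
  using assms(1)[of 0] assms by (auto simp: Lp_bounded_def Lp_diff_def)

lemma Lp_diff_le_if_Lp_bounded:
  assumes "Lp_bounded p (\<lambda>\<eta>. norm (F (cis \<eta> * a) - F (cis \<eta> * b))) B"
  shows "Lp_diff p F a b \<le> ennreal B"
proof (cases "p = \<infinity>")
  case True
  then have "norm (F (cis 0 * a) - F (cis 0 * b)) \<le> B"
    using assms unfolding Lp_bounded_def by meson
  then show ?thesis using True by (simp add: Lp_diff_def ennreal_leI)
qed (use assms in \<open>simp add: Lp_bounded_def Lp_diff_def\<close>)

lemma measurable_pair_restrict_lborel:
  fixes G :: "real \<Rightarrow> real \<Rightarrow> real"
  assumes "continuous_on (UNIV \<times> S) (\<lambda>(\<eta>, t). G \<eta> t)"
  shows "(\<lambda>(\<eta>, t). G \<eta> t) \<in> borel_measurable (borel \<Otimes>\<^sub>M restrict_space lborel S)"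
proof -
  have "(\<lambda>x. x) \<in> (borel :: real measure) \<Otimes>\<^sub>M restrict_space lborel S \<rightarrow>\<^sub>M restrict_space borel (UNIV \<times> S)"
  proof (rule measurable_restrict_space2)
    show "(\<lambda>x. x) \<in> space (borel \<Otimes>\<^sub>M restrict_space lborel S) \<rightarrow> UNIV \<times> S"
      by (auto simp: space_pair_measure space_restrict_space)
    have "(\<lambda>x. x) \<in> restrict_space lborel S \<rightarrow>\<^sub>M borel"
      by (rule measurable_restrict_space1) simp
    then have "(\<lambda>x. (fst x, snd x)) \<in> (borel :: real measure) \<Otimes>\<^sub>M restrict_space lborel S \<rightarrow>\<^sub>M borel \<Otimes>\<^sub>M borel"
      by (intro measurable_Pair measurable_fst measurable_compose[OF measurable_snd])
    then show "(\<lambda>x. x) \<in> (borel :: real measure) \<Otimes>\<^sub>M restrict_space lborel S \<rightarrow>\<^sub>M borel"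
      unfolding borel_prod by simp
  qed
  from measurable_compose[OF this borel_measurable_continuous_on_restrict[OF assms]]
  show ?thesis by simp
qed

lemma borel_measurable_restrict_lborel:
  fixes m :: "real \<Rightarrow> real"
  assumes "continuous_on S m"
  shows "m \<in> borel_measurable (restrict_space lborel S)"
  using borel_measurable_continuous_on_restrict[OF assms]
  by (simp cong: measurable_cong_sets add: sets_restrict_space_cong[of lborel borel])

lemma integral_nonneg_everywhere:
  fixes F :: "real \<Rightarrow> real"
  assumes "\<And>x. 0 \<le> F x"
  shows "0 \<le> integral S F"
  using assms by (cases "F integrable_on S") (auto simp: not_integrable_integral intro: Henstock_Kurzweil_Integration.integral_nonneg)

lemma dist_cis_pos:
  assumes "0 \<le> r" "r < 1"
  shows "0 < cmod (cis \<tau> - of_real r)"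
  using dist_cis_ge[OF assms, of \<tau>] assms by linarith

text \<open>The step common to both implications: a modulus of continuity \<open>B \<omega>\<close> of the slices is averaged against
  \<open>1 / \<bar>e\<^sup>i\<^sup>\<tau> - r\<bar>\<^sup>2\<close>.\<close>

lemma Lp_bounded_kernel_average:
  fixes F :: "real \<Rightarrow> real \<Rightarrow> real"
  assumes p: "1 \<le> p" and \<omega>: "majorant \<omega>" and r: "0 \<le> r" "r < 1"
    and C: "0 \<le> C" "(\<integral>\<^sup>+\<tau>. ennreal (\<omega> (cmod (cis \<tau> - of_real r)) / (cmod (cis \<tau> - of_real r))\<^sup>2) \<partial>rotations)
      \<le> ennreal (C * (\<omega> (1 - r) / (1 - r)))"
    and F: "continuous_on UNIV (\<lambda>(\<eta>, \<tau>). F \<eta> \<tau>)" "\<And>\<eta> \<tau>. 0 \<le> F \<eta> \<tau>"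
    and B: "0 \<le> B" "\<And>\<tau>. Lp_bounded p (\<lambda>\<eta>. F \<eta> \<tau>) (B * \<omega> (cmod (cis \<tau> - of_real r)))"
  shows "Lp_bounded p (\<lambda>\<eta>. integral {0..2*pi} (\<lambda>\<tau>. F \<eta> \<tau> / (cmod (cis \<tau> - of_real r))\<^sup>2))
    (B * C * (\<omega> (1 - r) / (1 - r)))"
proof -
  define s where "s = (\<lambda>\<tau>. cmod (cis \<tau> - of_real r))"
  have s: "0 < s \<tau>" for \<tau> unfolding s_def by (rule dist_cis_pos[OF r])
  have s_cont: "continuous_on T s" for T unfolding s_def by (intro continuous_intros)
  have s_cont2: "continuous_on T (\<lambda>x. s (snd x))" for T :: "(real \<times> real) set"
    unfolding s_def by (intro continuous_intros)
  have \<omega>s: "0 \<le> \<omega> (s \<tau>)" for \<tau> using majorant_nonneg[OF \<omega>] s by (simp add: less_imp_le)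
  have slice_cont: "continuous_on T (\<lambda>\<eta>. F \<eta> \<tau>)" "continuous_on T (\<lambda>\<tau>. F \<eta> \<tau>)" for T \<eta> \<tau>
  proof -
    have "continuous_on T (\<lambda>\<eta>. (\<lambda>(\<eta>, \<tau>). F \<eta> \<tau>) (\<eta>, \<tau>))" "continuous_on T (\<lambda>\<tau>. (\<lambda>(\<eta>, \<tau>). F \<eta> \<tau>) (\<eta>, \<tau>))"
      by (rule continuous_on_compose2[OF F(1)]; auto intro!: continuous_intros)+
    then show "continuous_on T (\<lambda>\<eta>. F \<eta> \<tau>)" "continuous_on T (\<lambda>\<tau>. F \<eta> \<tau>)" by simp_all
  qed
  have G_cont: "continuous_on (UNIV \<times> {0..2*pi}) (\<lambda>(\<eta>, \<tau>). F \<eta> \<tau> / (s \<tau>)\<^sup>2)"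
    using F(1) s s_cont2 unfolding case_prod_unfold
    by (intro continuous_intros continuous_on_subset[OF F(1)[unfolded case_prod_unfold]]) (auto simp: less_imp_neq[THEN not_sym])
  have m_cont: "continuous_on {0..2*pi} (\<lambda>\<tau>. B * \<omega> (s \<tau>) / (s \<tau>)\<^sup>2)"
    using s by (intro continuous_intros s_cont continuous_on_majorant[OF \<omega>]) (auto simp: less_imp_le less_imp_neq[THEN not_sym])
  have "Lp_bounded p (\<lambda>\<eta>. integral {0..2*pi} (\<lambda>\<tau>. F \<eta> \<tau> / (s \<tau>)\<^sup>2)) (B * C * (\<omega> (1 - r) / (1 - r)))"
  proof (rule Lp_bounded_integral[OF p finite_measure_rotations, where G = "\<lambda>\<eta> \<tau>. F \<eta> \<tau> / (s \<tau>)\<^sup>2"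
        and m = "\<lambda>\<tau>. B * \<omega> (s \<tau>) / (s \<tau>)\<^sup>2"])
    show "(\<lambda>(\<eta>, \<tau>). F \<eta> \<tau> / (s \<tau>)\<^sup>2) \<in> borel_measurable (borel \<Otimes>\<^sub>M rotations)"
      unfolding rotations_def by (rule measurable_pair_restrict_lborel[OF G_cont])
    show m_meas: "(\<lambda>\<tau>. B * \<omega> (s \<tau>) / (s \<tau>)\<^sup>2) \<in> borel_measurable rotations"
      unfolding rotations_def by (rule borel_measurable_restrict_lborel[OF m_cont])
    show "0 \<le> F \<eta> t / (s t)\<^sup>2" "0 \<le> B * \<omega> (s t) / (s t)\<^sup>2" for \<eta> t
      using F(2) \<omega>s B by auto
    show "0 \<le> B * C * (\<omega> (1 - r) / (1 - r))"
      using B C r majorant_nonneg[OF \<omega>, of "1 - r"] by simp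
    have "continuous_on {0..2*pi} (\<lambda>\<tau>. \<omega> (s \<tau>) / (s \<tau>)\<^sup>2)"
      using s by (intro continuous_intros s_cont continuous_on_majorant[OF \<omega>]) (auto simp: less_imp_le less_imp_neq[THEN not_sym])
    then have meas: "(\<lambda>\<tau>. \<omega> (s \<tau>) / (s \<tau>)\<^sup>2) \<in> borel_measurable rotations"
      unfolding rotations_def by (rule borel_measurable_restrict_lborel)
    have "(\<integral>\<^sup>+\<tau>. ennreal (B * \<omega> (s \<tau>) / (s \<tau>)\<^sup>2) \<partial>rotations)
        = ennreal B * (\<integral>\<^sup>+\<tau>. ennreal (\<omega> (s \<tau>) / (s \<tau>)\<^sup>2) \<partial>rotations)"
      using meas B by (subst nn_integral_cmult[symmetric]) (auto simp: ennreal_mult'[symmetric])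
    also have "\<dots> \<le> ennreal B * ennreal (C * (\<omega> (1 - r) / (1 - r)))"
      using C(2) by (intro mult_left_mono) (auto simp: s_def)
    also have "\<dots> = ennreal (B * C * (\<omega> (1 - r) / (1 - r)))"
      using B by (simp add: ennreal_mult'[symmetric] mult.assoc)
    finally show "(\<integral>\<^sup>+\<tau>. ennreal (B * \<omega> (s \<tau>) / (s \<tau>)\<^sup>2) \<partial>rotations) \<le> ennreal (B * C * (\<omega> (1 - r) / (1 - r)))" .
    show "Lp_bounded p (\<lambda>\<eta>. F \<eta> t / (s t)\<^sup>2) (B * \<omega> (s t) / (s t)\<^sup>2)" for t
    proof -
      have "Lp_bounded p (\<lambda>\<eta>. F \<eta> t) (B * \<omega> (s t))"
        using B(2) by (simp add: s_def)
      then have "Lp_bounded p (\<lambda>\<eta>. 1 / (s t)\<^sup>2 * F \<eta> t) (1 / (s t)\<^sup>2 * (B * \<omega> (s t)))"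
        using B(1) \<omega>s F(2) by (intro Lp_bounded_cmult[OF p] borel_measurable_continuous_onI slice_cont) auto
      then show ?thesis by simp
    qed
    show "0 \<le> integral {0..2*pi} (\<lambda>\<tau>. F \<eta> \<tau> / (s \<tau>)\<^sup>2)" for \<eta>
      using F(2) by (intro integral_nonneg_everywhere) auto
    show "ennreal (integral {0..2*pi} (\<lambda>\<tau>. F \<eta> \<tau> / (s \<tau>)\<^sup>2)) \<le> (\<integral>\<^sup>+\<tau>. ennreal (F \<eta> \<tau> / (s \<tau>)\<^sup>2) \<partial>rotations)" for \<eta>
      using s F(2) by (subst nn_integral_rotations) 
        (auto intro!: continuous_intros s_cont slice_cont simp: less_imp_neq[THEN not_sym])
  qed
  then show ?thesis unfolding s_def .
qed

lemma continuous_on_integral_rotations: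
  fixes F :: "real \<Rightarrow> real \<Rightarrow> real"
  assumes "continuous_on UNIV (\<lambda>(\<eta>, \<tau>). F \<eta> \<tau>)"
  shows "continuous_on UNIV (\<lambda>\<eta>. integral {0..2*pi} (F \<eta>))"
  using integral_continuous_on_param[of UNIV 0 "2*pi" F] continuous_on_subset[OF assms] by simp

lemma continuous_on_rotated:
  fixes F :: "complex \<Rightarrow> 'a::topological_space"
  assumes "continuous_on (cball 0 1) F" "continuous_on T a" "\<And>x. x \<in> T \<Longrightarrow> cmod (a x) \<le> 1"
  shows "continuous_on T (\<lambda>x. F (a x))"
  by (rule continuous_on_compose2[OF assms(1,2)]) (use assms(3) in auto)

lemma polar_form:
  obtains \<zeta> r where "cmod \<zeta> = 1" "0 \<le> r" "r = cmod z" "z = \<zeta> * of_real r"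
proof -
  obtain t where "z = rcis (cmod z) t" using rcis_cmod_Arg[of z] by metis
  then show ?thesis using that[of "cis t" "cmod z"] by (simp add: rcis_def mult.commute)
qed

subsection \<open>Smoothness of \<open>f\<close> controls the Poisson defect\<close>

text \<open>The defect compares \<open>f\<close> with its boundary values, so the estimate in the open disk is carried to the closed
  disk along the dilations with factors \<open>n / (n + 1)\<close>, which do not increase distances.\<close>

lemma Lp_bounded_closed_disk:
  assumes p: "1 \<le> p" and \<omega>: "majorant \<omega>" and M: "0 \<le> M"
    and cont: "continuous_on (cball 0 1) (f :: complex \<Rightarrow> complex)"
    and bound: "\<And>a b. a \<in> ball 0 1 \<Longrightarrow> b \<in> ball 0 1 \<Longrightarrow>
      Lp_bounded p (\<lambda>\<eta>. cmod (f (cis \<eta> * a) - f (cis \<eta> * b))) (M * \<omega> (cmod (a - b)))"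
    and ab: "a \<in> cball 0 1" "b \<in> cball 0 1"
  shows "Lp_bounded p (\<lambda>\<eta>. cmod (f (cis \<eta> * a) - f (cis \<eta> * b))) (M * \<omega> (cmod (a - b)))"
proof (rule Lp_bounded_tendsto[OF p])
  let ?\<rho> = "\<lambda>n. of_nat n / of_nat (Suc n) :: complex"
  have \<rho>: "cmod (?\<rho> n) < 1" for n
    by (simp add: norm_divide del: of_nat_Suc)
  have in_ball: "?\<rho> n * a \<in> ball 0 1" if "a \<in> cball 0 1" for n a
  proof -
    have "cmod (?\<rho> n) * cmod a \<le> cmod (?\<rho> n) * 1" using that by (intro mult_left_mono) auto
    then show ?thesis using \<rho>[of n] unfolding mem_ball_0 norm_mult by simp
  qed
  have rot: "cis \<eta> * a \<in> cball 0 1" if "a \<in> cball 0 1" for \<eta> a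
    using that by (simp add: norm_mult)
  have lim: "(\<lambda>n. f (cis \<eta> * (?\<rho> n * a))) \<longlonglongrightarrow> f (cis \<eta> * a)" if a: "a \<in> cball 0 1" for \<eta> a
  proof (rule continuous_on_tendsto_compose[OF cont])
    have "(\<lambda>n. cis \<eta> * (?\<rho> n * a)) \<longlonglongrightarrow> cis \<eta> * (1 * a)"
      by (intro tendsto_intros LIMSEQ_n_over_Suc_n)
    then show "(\<lambda>n. cis \<eta> * (?\<rho> n * a)) \<longlonglongrightarrow> cis \<eta> * a" by simp
    show "cis \<eta> * a \<in> cball 0 1" by (rule rot[OF a])
    show "\<forall>\<^sub>F n in sequentially. cis \<eta> * (?\<rho> n * a) \<in> cball 0 1"
      using in_ball[OF a] by (intro always_eventually allI rot) (auto simp: less_imp_le)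
  qed
  show "(\<lambda>n. cmod (f (cis \<eta> * (?\<rho> n * a)) - f (cis \<eta> * (?\<rho> n * b)))) \<longlonglongrightarrow> cmod (f (cis \<eta> * a) - f (cis \<eta> * b))" for \<eta>
    by (intro tendsto_intros lim ab)
  show "(\<lambda>n::nat. M * \<omega> (cmod (a - b))) \<longlonglongrightarrow> M * \<omega> (cmod (a - b))" by simp
  show "Lp_bounded p (\<lambda>\<eta>. cmod (f (cis \<eta> * (?\<rho> n * a)) - f (cis \<eta> * (?\<rho> n * b)))) (M * \<omega> (cmod (a - b)))" for n
  proof (rule Lp_bounded_mono[OF p bound[OF in_ball[OF ab(1)] in_ball[OF ab(2)]]])
    show "0 \<le> M * \<omega> (cmod (?\<rho> n * a - ?\<rho> n * b))" using M majorant_nonneg[OF \<omega>] by simp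
    have "cmod (?\<rho> n * a - ?\<rho> n * b) \<le> cmod (a - b)"
      unfolding right_diff_distrib[symmetric] norm_mult
      using \<rho>[of n] by (intro mult_left_le_one_le) auto
    then show "M * \<omega> (cmod (?\<rho> n * a - ?\<rho> n * b)) \<le> M * \<omega> (cmod (a - b))"
      using M by (intro mult_left_mono majorant_mono[OF \<omega>]) auto
  qed auto
  show "0 \<le> M * \<omega> (cmod (a - b))" for n :: nat using M majorant_nonneg[OF \<omega>] by simp
  have rot_cont: "continuous_on UNIV (\<lambda>\<eta>. f (cis \<eta> * c))" if "c \<in> ball 0 1" for c
    using that by (intro continuous_on_rotated[OF cont] continuous_intros) (auto simp: norm_mult)
  show "(\<lambda>\<eta>. cmod (f (cis \<eta> * (?\<rho> n * a)) - f (cis \<eta> * (?\<rho> n * b)))) \<in> borel_measurable borel" for n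
    by (intro borel_measurable_continuous_onI continuous_on_norm continuous_on_diff rot_cont in_ball ab)
qed auto

lemma poisson_defect_bound:
  assumes p: "1 \<le> p" and \<omega>: "majorant \<omega>"
    and C: "0 \<le> C" "\<And>r. 0 \<le> r \<Longrightarrow> r < 1 \<Longrightarrow>
      (\<integral>\<^sup>+\<tau>. ennreal (\<omega> (cmod (cis \<tau> - of_real r)) / (cmod (cis \<tau> - of_real r))\<^sup>2) \<partial>rotations)
      \<le> ennreal (C * (\<omega> (1 - r) / (1 - r)))"
    and cont: "continuous_on (cball 0 1) (f :: complex \<Rightarrow> complex)"
    and le: "\<And>z. cmod z < 1 \<Longrightarrow> cmod (f z) \<le> poisson (\<lambda>\<xi>. cmod (f \<xi>)) z"
    and M: "0 \<le> M" and bound: "\<And>a b. a \<in> cball 0 1 \<Longrightarrow> b \<in> cball 0 1 \<Longrightarrow>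
      Lp_bounded p (\<lambda>\<eta>. cmod (f (cis \<eta> * a) - f (cis \<eta> * b))) (M * \<omega> (cmod (a - b)))"
    and z: "z \<in> ball 0 1"
  shows "Lp_bounded p (\<lambda>\<eta>. poisson (\<lambda>\<xi>. cmod (f \<xi>)) (cis \<eta> * z) - cmod (f (cis \<eta> * z)))
    (M * C / pi * \<omega> (1 - cmod z))"
proof -
  obtain \<zeta> r where \<zeta>: "cmod \<zeta> = 1" and r: "0 \<le> r" "r = cmod z" and z_eq: "z = \<zeta> * of_real r"
    by (rule polar_form)
  have r1: "r < 1" using z r by simp
  define c where "c = (1 - r\<^sup>2) / (2 * pi)"
  have c_eq: "c = (1 - r) * (1 + r) / (2 * pi)" by (simp add: c_def power2_eq_square algebra_simps)
  have c: "0 \<le> c" unfolding c_eq using r r1 by simp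
  define F where "F = (\<lambda>\<eta> \<tau>. c * cmod (f (cis \<eta> * (\<zeta> * cis \<tau>)) - f (cis \<eta> * (\<zeta> * of_real r))))"
  have F_cont: "continuous_on UNIV (\<lambda>(\<eta>, \<tau>). F \<eta> \<tau>)"
    unfolding F_def case_prod_unfold
    by (intro continuous_intros continuous_on_rotated[OF cont]) (use \<zeta> r r1 in \<open>auto simp: norm_mult\<close>)
  have F_slice: "Lp_bounded p (\<lambda>\<eta>. F \<eta> \<tau>) (c * M * \<omega> (cmod (cis \<tau> - of_real r)))" for \<tau>
  proof -
    have meas: "(\<lambda>\<eta>. cmod (f (cis \<eta> * (\<zeta> * cis \<tau>)) - f (cis \<eta> * (\<zeta> * of_real r)))) \<in> borel_measurable borel"
      by (intro borel_measurable_continuous_onI continuous_intros continuous_on_rotated[OF cont])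
         (use \<zeta> r r1 in \<open>auto simp: norm_mult\<close>)
    have "Lp_bounded p (\<lambda>\<eta>. cmod (f (cis \<eta> * (\<zeta> * cis \<tau>)) - f (cis \<eta> * (\<zeta> * of_real r))))
        (M * \<omega> (cmod (\<zeta> * cis \<tau> - \<zeta> * of_real r)))"
      using \<zeta> r r1 by (intro bound) (auto simp: norm_mult)
    moreover have "cmod (\<zeta> * cis \<tau> - \<zeta> * of_real r) = cmod (cis \<tau> - of_real r)"
      by (simp add: right_diff_distrib[symmetric] norm_mult \<zeta>)
    ultimately show ?thesis
      unfolding F_def mult.assoc using c M majorant_nonneg[OF \<omega>] meas
      by (intro Lp_bounded_cmult[OF p]) auto
  qed
  have avg: "Lp_bounded p (\<lambda>\<eta>. integral {0..2*pi} (\<lambda>\<tau>. F \<eta> \<tau> / (cmod (cis \<tau> - of_real r))\<^sup>2))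
    (c * M * C * (\<omega> (1 - r) / (1 - r)))"
    using c M by (intro Lp_bounded_kernel_average[OF p \<omega> r(1) r1 C(1) C(2)[OF r(1) r1] F_cont _ _ F_slice])
      (auto simp: F_def)
  have \<omega>0: "0 \<le> \<omega> (1 - r)" using r1 majorant_nonneg[OF \<omega>] by simp
  show ?thesis
  proof (rule Lp_bounded_mono[OF p avg])
    show "0 \<le> c * M * C * (\<omega> (1 - r) / (1 - r))" using c M C \<omega>0 r1 by simp
    fix \<eta>
    have cz: "cmod (cis \<eta> * z) < 1" using z by (simp add: norm_mult)
    show "0 \<le> poisson (\<lambda>\<xi>. cmod (f \<xi>)) (cis \<eta> * z) - cmod (f (cis \<eta> * z))"
      using le[OF cz] by simp
    have "cmod (cis \<eta> * \<zeta>) = 1" using \<zeta> by (simp add: norm_mult)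
    from poisson_minus_norm_le[OF cont this r(1) r1]
    have "poisson (\<lambda>\<xi>. cmod (f \<xi>)) (cis \<eta> * z) - cmod (f (cis \<eta> * z))
      \<le> integral {0..2*pi} (\<lambda>\<tau>. cmod (f (cis \<eta> * (\<zeta> * cis \<tau>)) - f (cis \<eta> * (\<zeta> * of_real r)))
            / (cmod (cis \<tau> - of_real r))\<^sup>2) * (1 - r\<^sup>2) / (2 * pi)"
      by (simp only: z_eq mult.assoc)
    also have "\<dots> = c * integral {0..2*pi} (\<lambda>\<tau>. cmod (f (cis \<eta> * (\<zeta> * cis \<tau>)) - f (cis \<eta> * (\<zeta> * of_real r)))
            / (cmod (cis \<tau> - of_real r))\<^sup>2)"
      by (simp add: c_def)
    also have "\<dots> = integral {0..2*pi} (\<lambda>\<tau>. F \<eta> \<tau> / (cmod (cis \<tau> - of_real r))\<^sup>2)"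
      by (subst integral_mult_right[symmetric]) (simp add: F_def)
    finally show "poisson (\<lambda>\<xi>. cmod (f \<xi>)) (cis \<eta> * z) - cmod (f (cis \<eta> * z))
      \<le> integral {0..2*pi} (\<lambda>\<tau>. F \<eta> \<tau> / (cmod (cis \<tau> - of_real r))\<^sup>2)" .
    have "c / (1 - r) = (1 + r) / (2 * pi)" using r1 by (simp add: c_eq)
    also have "\<dots> \<le> 1 / pi" using r1 by (simp add: field_simps)
    finally have "M * C * \<omega> (1 - r) * (c / (1 - r)) \<le> M * C * \<omega> (1 - r) * (1 / pi)"
      using M C \<omega>0 by (intro mult_left_mono) auto
    then show "c * M * C * (\<omega> (1 - r) / (1 - r)) \<le> M * C / pi * \<omega> (1 - cmod z)"
      by (simp add: r(2)[symmetric] mult_ac)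
  qed
qed

subsection \<open>The Poisson defect controls the derivative\<close>

text \<open>Quasiregularity bounds the whole derivative by \<open>K\<close> times the gap that the pointwise estimate controls. Its first
  term is an average of boundary differences of \<open>\<bar>f\<bar>\<close> at distance at most \<open>2 \<bar>e\<^sup>i\<^sup>\<tau> - r\<bar>\<close>, where \<open>\<omega>\<close> at most
  doubles; its second term is the defect divided by a quantity of size \<open>1 - r\<close>.\<close>

lemma derivative_Lp_bound:
  fixes f h g :: "complex \<Rightarrow> complex"
  assumes p: "1 \<le> p" and \<omega>: "majorant \<omega>"
    and C: "0 \<le> C" "\<And>r. 0 \<le> r \<Longrightarrow> r < 1 \<Longrightarrow>
      (\<integral>\<^sup>+\<tau>. ennreal (\<omega> (cmod (cis \<tau> - of_real r)) / (cmod (cis \<tau> - of_real r))\<^sup>2) \<partial>rotations)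
      \<le> ennreal (C * (\<omega> (1 - r) / (1 - r)))"
    and cont: "continuous_on (cball 0 1) f"
    and h: "h holomorphic_on ball 0 1" and g: "g holomorphic_on ball 0 1"
    and f_eq: "\<And>z. z \<in> ball 0 1 \<Longrightarrow> f z = h z + cnj (g z)"
    and K: "0 \<le> K" "\<And>z. z \<in> ball 0 1 \<Longrightarrow>
      cmod (deriv h z) + cmod (deriv g z) \<le> K * (cmod (deriv h z) - cmod (deriv g z))"
    and M: "0 \<le> M" "\<And>\<xi>1 \<xi>2. cmod \<xi>1 = 1 \<Longrightarrow> cmod \<xi>2 = 1 \<Longrightarrow>
      Lp_bounded p (\<lambda>\<eta>. \<bar>cmod (f (cis \<eta> * \<xi>1)) - cmod (f (cis \<eta> * \<xi>2))\<bar>) (M * \<omega> (cmod (\<xi>1 - \<xi>2)))"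
    and M': "0 \<le> M'" "\<And>z. z \<in> ball 0 1 \<Longrightarrow>
      Lp_bounded p (\<lambda>\<eta>. poisson (\<lambda>\<xi>. cmod (f \<xi>)) (cis \<eta> * z) - cmod (f (cis \<eta> * z))) (M' * \<omega> (1 - cmod z))"
    and z: "z \<in> ball 0 1"
  shows "Lp_bounded p (\<lambda>\<eta>. cmod (deriv h (cis \<eta> * z)) + cmod (deriv g (cis \<eta> * z)))
    (K * (2 * M * C / pi + 2 * M') * (\<omega> (1 - cmod z) / (1 - cmod z)))"
proof -
  obtain \<zeta> r where \<zeta>: "cmod \<zeta> = 1" and r: "0 \<le> r" "r = cmod z" and z_eq: "z = \<zeta> * of_real r"
    by (rule polar_form)
  have r1: "r < 1" using z r by simp
  define d where "d = 1 - r"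
  have d: "0 < d" using r1 by (simp add: d_def)
  define W where "W = \<omega> d / d"
  have W: "0 \<le> W" using d majorant_nonneg[OF \<omega>, of d] by (simp add: W_def)
  have sq: "1 - r\<^sup>2 = d * (1 + r)" by (simp add: d_def power2_eq_square algebra_simps)
  have sq_pos: "0 < 1 - r\<^sup>2" unfolding sq by (rule mult_pos_pos[OF d]) (use r(1) in linarith)

  define F where "F = (\<lambda>\<eta> \<tau>. K / pi * \<bar>cmod (f (cis \<eta> * (\<zeta> * cis \<tau>))) - cmod (f (cis \<eta> * \<zeta>))\<bar>)"
  have F_cont: "continuous_on UNIV (\<lambda>(\<eta>, \<tau>). F \<eta> \<tau>)"
    unfolding F_def case_prod_unfold
    by (intro continuous_intros continuous_on_rotated[OF cont]) (use \<zeta> in \<open>auto simp: norm_mult\<close>)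
  have F_slice: "Lp_bounded p (\<lambda>\<eta>. F \<eta> \<tau>) (K / pi * (2 * M) * \<omega> (cmod (cis \<tau> - of_real r)))" for \<tau>
  proof -
    have meas: "(\<lambda>\<eta>. \<bar>cmod (f (cis \<eta> * (\<zeta> * cis \<tau>))) - cmod (f (cis \<eta> * \<zeta>))\<bar>) \<in> borel_measurable borel"
      by (intro borel_measurable_continuous_onI continuous_intros continuous_on_rotated[OF cont])
         (use \<zeta> in \<open>auto simp: norm_mult\<close>)
    have bd: "Lp_bounded p (\<lambda>\<eta>. \<bar>cmod (f (cis \<eta> * (\<zeta> * cis \<tau>))) - cmod (f (cis \<eta> * \<zeta>))\<bar>)
        (M * \<omega> (cmod (\<zeta> * cis \<tau> - \<zeta>)))"
      using \<zeta> by (intro M) (auto simp: norm_mult)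
    have eq: "cmod (\<zeta> * cis \<tau> - \<zeta>) = cmod (cis \<tau> - 1)"
    proof -
      have "\<zeta> * cis \<tau> - \<zeta> = \<zeta> * (cis \<tau> - 1)" by (simp add: algebra_simps)
      then show ?thesis by (simp add: norm_mult \<zeta>)
    qed
    have le: "M * \<omega> (cmod (cis \<tau> - 1)) \<le> 2 * M * \<omega> (cmod (cis \<tau> - of_real r))"
      using mult_left_mono[OF majorant_double[OF \<omega> norm_ge_zero norm_cis_minus_1_le[OF r(1) r1]] M(1)]
      by (simp add: mult_ac)
    have "Lp_bounded p (\<lambda>\<eta>. \<bar>cmod (f (cis \<eta> * (\<zeta> * cis \<tau>))) - cmod (f (cis \<eta> * \<zeta>))\<bar>)
        (2 * M * \<omega> (cmod (cis \<tau> - of_real r)))"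
      using M(1) majorant_nonneg[OF \<omega>] by (intro Lp_bounded_mono[OF p bd[unfolded eq] _ _ _ le]) auto
    then show ?thesis
      unfolding F_def mult.assoc[of "K / pi"] using K M majorant_nonneg[OF \<omega>] meas
      by (intro Lp_bounded_cmult[OF p]) auto
  qed
  let ?I = "\<lambda>\<eta>. integral {0..2*pi} (\<lambda>\<tau>. F \<eta> \<tau> / (cmod (cis \<tau> - of_real r))\<^sup>2)"
  let ?J = "\<lambda>\<eta>. poisson (\<lambda>\<xi>. cmod (f \<xi>)) (cis \<eta> * z) - cmod (f (cis \<eta> * z))"
  have I: "Lp_bounded p ?I (K / pi * (2 * M) * C * W)"
    using K M unfolding W_def d_def
    by (intro Lp_bounded_kernel_average[OF p \<omega> r(1) r1 C(1) C(2)[OF r(1) r1] F_cont _ _ F_slice])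
       (auto simp: F_def)
  have I0: "0 \<le> ?I \<eta>" for \<eta>
    using K by (intro integral_nonneg_everywhere) (auto simp: F_def)
  have "continuous_on UNIV ?I"
  proof (rule continuous_on_integral_rotations)
    show "continuous_on UNIV (\<lambda>(\<eta>, \<tau>). F \<eta> \<tau> / (cmod (cis \<tau> - of_real r))\<^sup>2)"
      using dist_cis_pos[OF r(1) r1] F_cont unfolding case_prod_unfold
      by (intro continuous_intros) auto
  qed
  then have I_meas: "?I \<in> borel_measurable borel" by (rule borel_measurable_continuous_onI)
  have phi: "continuous_on (sphere 0 1) (\<lambda>\<xi>. cmod (f \<xi>))"
    by (intro continuous_intros continuous_on_subset[OF cont]) auto
  have J0: "0 \<le> ?J \<eta>" for \<eta>
    using norm_le_poisson[OF cont h g f_eq, of "cis \<eta> * z"] z by (simp add: norm_mult)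
  have J_meas: "?J \<in> borel_measurable borel"
  proof -
    have "continuous_on UNIV (\<lambda>\<eta>. integral {0..2*pi} (\<lambda>\<tau>. cmod (f (cis \<eta> * cis \<tau>)) * poisson_kernel z \<tau>))"
    proof (rule continuous_on_integral_rotations)
      have "continuous_on UNIV (\<lambda>x :: real \<times> real. poisson_kernel z (snd x))"
        unfolding poisson_kernel_def using cis_minus_nonzero[of z] z by (intro continuous_intros) auto
      then show "continuous_on UNIV (\<lambda>(\<eta>, \<tau>). cmod (f (cis \<eta> * cis \<tau>)) * poisson_kernel z \<tau>)"
        unfolding case_prod_unfold
        by (intro continuous_intros continuous_on_rotated[OF cont]) (auto simp: norm_mult)
    qed
    moreover have "poisson (\<lambda>\<xi>. cmod (f \<xi>)) (cis \<eta> * z)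
        = integral {0..2*pi} (\<lambda>\<tau>. cmod (f (cis \<eta> * cis \<tau>)) * poisson_kernel z \<tau>) / (2 * pi)" for \<eta>
    proof -
      have "continuous_on (sphere 0 1) (\<lambda>\<xi>. cmod (f (cis \<eta> * \<xi>)))"
        by (intro continuous_intros continuous_on_rotated[OF cont]) (auto simp: norm_mult)
      then show ?thesis using z by (subst poisson_rotate[OF phi]) (auto simp: poisson_eq_integral)
    qed
    moreover have "continuous_on UNIV (\<lambda>\<eta>. cmod (f (cis \<eta> * z)))"
      using z by (intro continuous_intros continuous_on_rotated[OF cont]) (auto simp: norm_mult)
    ultimately have "continuous_on UNIV ?J" by (auto intro!: continuous_intros)
    then show ?thesis by (rule borel_measurable_continuous_onI)
  qed
  have J: "Lp_bounded p (\<lambda>\<eta>. K * (2 / (1 - r\<^sup>2)) * ?J \<eta>) (K * (2 / (1 - r\<^sup>2)) * (M' * \<omega> d))"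
    using M'(2)[OF z] M'(1) K sq_pos d majorant_nonneg[OF \<omega>, of d] J_meas J0
    by (intro Lp_bounded_cmult[OF p]) (auto simp: d_def r)
  have sum: "Lp_bounded p (\<lambda>\<eta>. ?I \<eta> + K * (2 / (1 - r\<^sup>2)) * ?J \<eta>)
      (K / pi * (2 * M) * C * W + K * (2 / (1 - r\<^sup>2)) * (M' * \<omega> d))"
    using K M M' C W sq_pos d majorant_nonneg[OF \<omega>, of d] I0 J0 J_meas
    by (intro Lp_bounded_add[OF p I J] I_meas) (auto intro!: mult_nonneg_nonneg)
  show ?thesis
  proof (rule Lp_bounded_mono[OF p sum])
    show "0 \<le> K / pi * (2 * M) * C * W + K * (2 / (1 - r\<^sup>2)) * (M' * \<omega> d)"
      using K M M' C W sq_pos d majorant_nonneg[OF \<omega>, of d] by (auto intro!: add_nonneg_nonneg mult_nonneg_nonneg)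
    fix \<eta>
    show "0 \<le> cmod (deriv h (cis \<eta> * z)) + cmod (deriv g (cis \<eta> * z))" by simp
    have \<zeta>': "cmod (cis \<eta> * \<zeta>) = 1" using \<zeta> by (simp add: norm_mult)
    have eq: "cis \<eta> * \<zeta> * of_real r = cis \<eta> * z" by (simp add: z_eq mult.assoc)
    have "cis \<eta> * z \<in> ball 0 1" using z by (simp add: norm_mult)
    then have "cmod (deriv h (cis \<eta> * z)) + cmod (deriv g (cis \<eta> * z))
        \<le> K * (cmod (deriv h (cis \<eta> * z)) - cmod (deriv g (cis \<eta> * z)))"
      by (rule K(2))
    also have "\<dots> \<le> K * (integral {0..2*pi} (\<lambda>\<tau>. \<bar>cmod (f (cis \<eta> * \<zeta> * cis \<tau>)) - cmod (f (cis \<eta> * \<zeta>))\<bar>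
          / (cmod (cis \<tau> - of_real r))\<^sup>2) / pi + 2 / (1 - r\<^sup>2) * ?J \<eta>)"
      using derivative_gap_le_rotated[OF cont h g f_eq \<zeta>' r(1) r1] K(1)
      unfolding eq by (intro mult_left_mono) auto
    also have "\<dots> = K / pi * integral {0..2*pi} (\<lambda>\<tau>. \<bar>cmod (f (cis \<eta> * \<zeta> * cis \<tau>)) - cmod (f (cis \<eta> * \<zeta>))\<bar>
          / (cmod (cis \<tau> - of_real r))\<^sup>2) + K * (2 / (1 - r\<^sup>2)) * ?J \<eta>"
      by (simp add: distrib_left)
    also have "K / pi * integral {0..2*pi} (\<lambda>\<tau>. \<bar>cmod (f (cis \<eta> * \<zeta> * cis \<tau>)) - cmod (f (cis \<eta> * \<zeta>))\<bar>
          / (cmod (cis \<tau> - of_real r))\<^sup>2) = ?I \<eta>"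
      by (subst integral_mult_right[symmetric]) (simp add: F_def mult.assoc)
    finally show "cmod (deriv h (cis \<eta> * z)) + cmod (deriv g (cis \<eta> * z)) \<le> ?I \<eta> + K * (2 / (1 - r\<^sup>2)) * ?J \<eta>" .
    have "d * 1 \<le> 1 - r\<^sup>2" unfolding sq using d r(1) by (intro mult_left_mono) auto
    then have "2 / (1 - r\<^sup>2) * \<omega> d \<le> 2 / d * \<omega> d"
      using d majorant_nonneg[OF \<omega>, of d] by (intro mult_right_mono frac_le) auto
    then have "K * M' * (2 / (1 - r\<^sup>2) * \<omega> d) \<le> K * M' * (2 * W)"
      using K M' by (intro mult_left_mono) (auto simp: W_def)
    then show "K / pi * (2 * M) * C * W + K * (2 / (1 - r\<^sup>2)) * (M' * \<omega> d)
        \<le> K * (2 * M * C / pi + 2 * M') * (\<omega> (1 - cmod z) / (1 - cmod z))"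
      unfolding r(2)[symmetric] d_def[symmetric] W_def[symmetric] by (simp add: algebra_simps)
  qed
qed

subsection \<open>The derivative controls the smoothness of \<open>f\<close>\<close>

text \<open>The integral runs over \<open>(0, 1]\<close> since in radial directions the available bound for the derivative is singular at
  \<open>u = 0\<close>.\<close>

lemma norm_difference_le_integral:
  fixes f h g :: "complex \<Rightarrow> complex"
  assumes h: "h holomorphic_on ball 0 1" and g: "g holomorphic_on ball 0 1"
    and f_eq: "\<And>z. z \<in> ball 0 1 \<Longrightarrow> f z = h z + cnj (g z)"
    and ab: "a \<in> ball 0 1" "b \<in> ball 0 1"
  shows "ennreal (cmod (f a - f b))
    \<le> (\<integral>\<^sup>+u. ennreal (cmod (b - a) * (cmod (deriv h (a + of_real u * (b - a)))
        + cmod (deriv g (a + of_real u * (b - a))))) \<partial>restrict_space lborel {0<..1})"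
proof -
  let ?\<gamma> = "\<lambda>u::real. a + of_real u * (b - a)"
  let ?D = "\<lambda>u. cmod (deriv h (?\<gamma> u)) + cmod (deriv g (?\<gamma> u))"
  have \<gamma>: "?\<gamma> u \<in> ball 0 1" if "u \<in> {0..1}" for u
  proof -
    have "(1 - u) *\<^sub>R a + u *\<^sub>R b \<in> ball 0 1"
      using that by (intro convexD[OF convex_ball ab]) auto
    then show ?thesis by (simp add: scaleR_conv_of_real algebra_simps)
  qed
  let ?q' = "\<lambda>u. deriv h (?\<gamma> u) * (b - a) + cnj (deriv g (?\<gamma> u) * (b - a))"
  have q: "((\<lambda>u. f (?\<gamma> u)) has_vector_derivative ?q' u) (at u within {0..1})" if u: "u \<in> {0..1}" for u
  proof -
    have line: "(?\<gamma> has_vector_derivative (b - a)) (at u within {0..1})"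
      by (auto intro!: derivative_eq_intros)
    have chain: "((\<lambda>u. F (?\<gamma> u)) has_vector_derivative (deriv F (?\<gamma> u) * (b - a))) (at u within {0..1})"
      if F: "F holomorphic_on ball 0 1" for F
      using field_vector_diff_chain_within[OF line has_field_derivative_at_within[OF holomorphic_derivI[OF F open_ball \<gamma>[OF u]]]]
      by (simp add: o_def mult.commute)
    have "((\<lambda>u. h (?\<gamma> u) + cnj (g (?\<gamma> u))) has_vector_derivative ?q' u) (at u within {0..1})"
      by (intro has_vector_derivative_add has_vector_derivative_cnj chain h g)
    then show ?thesis
      by (rule has_vector_derivative_transform[OF u, rotated]) (use f_eq[OF \<gamma>] in auto)
  qed
  have int: "(?q' has_integral (f b - f a)) {0..1}"
    using fundamental_theorem_of_calculus[OF zero_le_one q] by simp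
  have D_cont: "continuous_on {0..1} (\<lambda>u. cmod (b - a) * ?D u)"
  proof -
    have dF: "continuous_on {0..1} (\<lambda>u. deriv F (?\<gamma> u))" if F: "F holomorphic_on ball 0 1" for F
    proof (rule continuous_on_compose2[OF holomorphic_on_imp_continuous_on[OF holomorphic_deriv[OF F open_ball]]])
      show "continuous_on {0..1} ?\<gamma>" by (intro continuous_intros)
    qed (use \<gamma> in auto)
    show ?thesis
      by (intro continuous_on_mult continuous_on_add continuous_on_norm continuous_on_const dF h g)
  qed
  have "cmod (integral {0..1} ?q') \<le> integral {0..1} (\<lambda>u. cmod (b - a) * ?D u)"
  proof (rule Henstock_Kurzweil_Integration.integral_norm_bound_integral)
    show "?q' integrable_on {0..1}" using int by blast
    show "(\<lambda>u. cmod (b - a) * ?D u) integrable_on {0..1}"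
      by (rule integrable_continuous_interval[OF D_cont])
    show "cmod (?q' u) \<le> cmod (b - a) * ?D u" for u
      using norm_triangle_ineq[of "deriv h (?\<gamma> u) * (b - a)" "cnj (deriv g (?\<gamma> u) * (b - a))"]
      unfolding norm_mult complex_mod_cnj by (simp only: distrib_left mult.commute[of "cmod (b - a)"])
  qed
  then have "cmod (f a - f b) \<le> integral {0..1} (\<lambda>u. cmod (b - a) * ?D u)"
    using int by (simp add: integral_unique norm_minus_commute)
  then have "ennreal (cmod (f a - f b)) \<le> ennreal (integral {0..1} (\<lambda>u. cmod (b - a) * ?D u))"
    by (rule ennreal_leI)
  also have "\<dots> = (\<integral>\<^sup>+u. ennreal (cmod (b - a) * ?D u) \<partial>restrict_space lborel {0..1})"
    by (rule nn_integral_interval[symmetric, OF D_cont]) simp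
  also have "\<dots> = (\<integral>\<^sup>+u. ennreal (cmod (b - a) * ?D u) * indicator {0..1} u \<partial>lborel)"
    by (subst nn_integral_restrict_space) auto
  also have "\<dots> = (\<integral>\<^sup>+u. ennreal (cmod (b - a) * ?D u) * indicator {0<..1} u \<partial>lborel)"
    by (rule nn_integral_cong_AE, rule AE_mp[OF AE_lborel_singleton[of "0::real"] AE_I2])
       (auto split: split_indicator)
  also have "\<dots> = (\<integral>\<^sup>+u. ennreal (cmod (b - a) * ?D u) \<partial>restrict_space lborel {0<..1})"
    by (subst nn_integral_restrict_space) auto
  finally show ?thesis .
qed

lemma Lp_bounded_segment:
  fixes f h g :: "complex \<Rightarrow> complex"
  assumes p: "1 \<le> p"
    and h: "h holomorphic_on ball 0 1" and g: "g holomorphic_on ball 0 1"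
    and f_eq: "\<And>z. z \<in> ball 0 1 \<Longrightarrow> f z = h z + cnj (g z)"
    and ab: "a \<in> ball 0 1" "b \<in> ball 0 1"
    and m: "continuous_on {0<..1} m" "\<And>u. u \<in> {0<..1} \<Longrightarrow> 0 \<le> m u"
      "\<And>u. u \<in> {0<..1} \<Longrightarrow> Lp_bounded p (\<lambda>\<eta>. cmod (deriv h (cis \<eta> * (a + of_real u * (b - a))))
          + cmod (deriv g (cis \<eta> * (a + of_real u * (b - a))))) (m u)"
    and A: "0 \<le> A" "(\<integral>\<^sup>+u. ennreal (cmod (b - a) * m u) \<partial>restrict_space lborel {0<..1}) \<le> ennreal A"
  shows "Lp_bounded p (\<lambda>\<eta>. cmod (f (cis \<eta> * a) - f (cis \<eta> * b))) A"
proof -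
  let ?\<gamma> = "\<lambda>u::real. a + of_real u * (b - a)"
  let ?D = "\<lambda>z. cmod (deriv h z) + cmod (deriv g z)"
  have \<gamma>: "cis \<eta> * ?\<gamma> u \<in> ball 0 1" if "u \<in> {0<..1}" for u \<eta>
  proof -
    have "(1 - u) *\<^sub>R a + u *\<^sub>R b \<in> ball 0 1"
      using that by (intro convexD[OF convex_ball ab]) auto
    then have "?\<gamma> u \<in> ball 0 1" by (simp add: scaleR_conv_of_real algebra_simps)
    then show ?thesis unfolding mem_ball_0 norm_mult by simp
  qed
  have D_cont: "continuous_on (ball 0 1) ?D"
    by (intro continuous_intros holomorphic_on_imp_continuous_on holomorphic_deriv h g open_ball)
  have G_cont: "continuous_on (UNIV \<times> {0<..1}) (\<lambda>(\<eta>, u). cmod (b - a) * ?D (cis \<eta> * ?\<gamma> u))"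
  proof -
    have "continuous_on (UNIV \<times> {0<..1}) (\<lambda>x :: real \<times> real. ?D (cis (fst x) * ?\<gamma> (snd x)))"
    proof (rule continuous_on_compose2[OF D_cont])
      show "continuous_on (UNIV \<times> {0<..1}) (\<lambda>x :: real \<times> real. cis (fst x) * ?\<gamma> (snd x))"
        by (intro continuous_intros)
      show "(\<lambda>x :: real \<times> real. cis (fst x) * ?\<gamma> (snd x)) ` (UNIV \<times> {0<..1}) \<subseteq> ball 0 1"
        using \<gamma> by fastforce
    qed
    then show ?thesis unfolding case_prod_unfold by (intro continuous_on_mult continuous_on_const)
  qed
  show ?thesis
  proof (rule Lp_bounded_integral[OF p, where N = "restrict_space lborel {0<..1::real}"
        and G = "\<lambda>\<eta> u. cmod (b - a) * ?D (cis \<eta> * ?\<gamma> u)" and m = "\<lambda>u. cmod (b - a) * m u"])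
    show "finite_measure (restrict_space lborel {0<..1::real})"
      by (rule finite_measure_restrict_lborel) auto
    show "(\<lambda>(\<eta>, u). cmod (b - a) * ?D (cis \<eta> * ?\<gamma> u)) \<in> borel_measurable (borel \<Otimes>\<^sub>M restrict_space lborel {0<..1})"
      by (rule measurable_pair_restrict_lborel[OF G_cont])
    show "(\<lambda>u. cmod (b - a) * m u) \<in> borel_measurable (restrict_space lborel {0<..1})"
      by (intro borel_measurable_restrict_lborel continuous_intros m)
    fix \<eta> :: real
    have rot: "cis \<eta> * a \<in> ball 0 1" "cis \<eta> * b \<in> ball 0 1" using ab by (auto simp: norm_mult)
    have line: "cis \<eta> * a + of_real u * (cis \<eta> * b - cis \<eta> * a) = cis \<eta> * ?\<gamma> u" for u :: real
      by (simp add: algebra_simps)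
    have len: "cmod (cis \<eta> * b - cis \<eta> * a) = cmod (b - a)"
      by (simp add: right_diff_distrib[symmetric] norm_mult)
    show "ennreal (cmod (f (cis \<eta> * a) - f (cis \<eta> * b)))
        \<le> (\<integral>\<^sup>+u. ennreal (cmod (b - a) * ?D (cis \<eta> * ?\<gamma> u)) \<partial>restrict_space lborel {0<..1})"
      using norm_difference_le_integral[OF h g f_eq rot] unfolding line len .
  next
    fix u :: real assume u: "u \<in> space (restrict_space lborel {0<..1})"
    then have u': "u \<in> {0<..1}" by (simp add: space_restrict_space)
    have "continuous_on UNIV (\<lambda>\<eta>. ?D (cis \<eta> * ?\<gamma> u))"
      by (rule continuous_on_compose2[OF D_cont]) (use \<gamma>[OF u'] in \<open>auto intro!: continuous_intros\<close>)
    then show "Lp_bounded p (\<lambda>\<eta>. cmod (b - a) * ?D (cis \<eta> * ?\<gamma> u)) (cmod (b - a) * m u)"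
      using m(2,3)[OF u'] by (intro Lp_bounded_cmult[OF p] borel_measurable_continuous_onI) auto
  qed (use A m(2) in \<open>auto simp: space_restrict_space\<close>)
qed

text \<open>On the segment between two points near the circle the distance to the circle can be much smaller than the
  distance of the points. So both points are first moved radially inwards by \<open>\<delta> = min \<bar>z\<^sub>1 - z\<^sub>2\<bar> \<delta>\<^sub>1\<close>. Along a radius
  the derivative bound integrates to \<open>\<integral> \<omega>(t) / t \<le> M\<^sub>0 \<omega>(\<delta>)\<close> by regularity, and the segment between the moved points
  stays at distance at least \<open>\<delta>\<close> from the circle. The cap \<open>\<delta>\<^sub>1\<close> keeps \<open>\<delta>\<close> in the range of the regularity
  condition; it costs the factor \<open>2 / \<delta>\<^sub>1\<close> for points that are far apart.\<close>

lemma smoothness_from_derivative: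
  fixes f h g :: "complex \<Rightarrow> complex"
  assumes p: "1 \<le> p" and \<omega>: "regular_majorant \<omega>"
    and h: "h holomorphic_on ball 0 1" and g: "g holomorphic_on ball 0 1"
    and f_eq: "\<And>z. z \<in> ball 0 1 \<Longrightarrow> f z = h z + cnj (g z)"
    and B: "0 \<le> B" "\<And>z. z \<in> ball 0 1 \<Longrightarrow>
      Lp_bounded p (\<lambda>\<eta>. cmod (deriv h (cis \<eta> * z)) + cmod (deriv g (cis \<eta> * z)))
        (B * (\<omega> (1 - cmod z) / (1 - cmod z)))"
  shows "\<exists>M>0. \<forall>z1\<in>ball 0 1. \<forall>z2\<in>ball 0 1.
    Lp_bounded p (\<lambda>\<eta>. cmod (f (cis \<eta> * z1) - f (cis \<eta> * z2))) (M * \<omega> (cmod (z1 - z2)))"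
proof -
  from \<omega> obtain \<delta>0 M0 where maj: "majorant \<omega>" and \<delta>0: "0 < \<delta>0" and M0: "0 < M0"
    and dini: "\<And>\<delta>. 0 < \<delta> \<Longrightarrow> \<delta> < \<delta>0 \<Longrightarrow>
      (\<integral>\<^sup>+t\<in>{0<..\<delta>}. ennreal (\<omega> t / t) \<partial>lborel) \<le> ennreal (M0 * \<omega> \<delta>)"
    unfolding regular_majorant_def by blast
  define \<delta>1 where "\<delta>1 = min (\<delta>0 / 2) (1 / 2)"
  have \<delta>1: "0 < \<delta>1" "\<delta>1 < \<delta>0" "\<delta>1 < 1" using \<delta>0 by (auto simp: \<delta>1_def)
  define M where "M = B * M0 + B * (1 + 2 / \<delta>1) + B * M0 + 1"
  have M: "0 < M" unfolding M_def using B M0 \<delta>1 by (simp add: add_nonneg_pos)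

  have deriv_le: "Lp_bounded p (\<lambda>\<eta>. cmod (deriv h (cis \<eta> * z)) + cmod (deriv g (cis \<eta> * z))) (B * (\<omega> t / t))"
    if t: "0 < t" "t \<le> 1 - cmod z" for z t
  proof (rule Lp_bounded_mono[OF p B(2)])
    show "B * (\<omega> (1 - cmod z) / (1 - cmod z)) \<le> B * (\<omega> t / t)"
      using t by (intro mult_left_mono majorant_ratio[OF maj] B)
    show "0 \<le> B * (\<omega> (1 - cmod z) / (1 - cmod z))" "z \<in> ball 0 1"
      using t B majorant_nonneg[OF maj] by auto
  qed auto

  have radial: "Lp_bounded p (\<lambda>\<eta>. cmod (f (cis \<eta> * z) - f (cis \<eta> * (of_real (1 - \<delta>) * z)))) (B * M0 * \<omega> \<delta>)"
    if z: "z \<in> ball 0 1" and \<delta>: "0 < \<delta>" "\<delta> \<le> \<delta>1" for z \<delta>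
  proof (rule Lp_bounded_segment[OF p h g f_eq z, where m = "\<lambda>u. B * (\<omega> (\<delta> * u) / (\<delta> * u))"])
    have point: "z + of_real u * (of_real (1 - \<delta>) * z - z) = of_real (1 - \<delta> * u) * z" for u :: real
      by (simp add: algebra_simps)
    have len: "cmod (of_real (1 - \<delta>) * z - z) = \<delta> * cmod z"
    proof -
      have "of_real (1 - \<delta>) * z - z = of_real (- \<delta>) * z" by (simp add: algebra_simps)
      then show ?thesis using \<delta> by (simp only: norm_mult norm_of_real abs_minus_cancel abs_of_pos)
    qed
    have shrink: "cmod (of_real (1 - s) * z) \<le> 1 - s" if "0 \<le> s" "s \<le> 1" for s :: real
      using that z mult_left_le[of "cmod z" "1 - s"] by (simp add: norm_mult del: of_real_diff)
    show "of_real (1 - \<delta>) * z \<in> ball 0 1"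
      using shrink[of \<delta>] \<delta> \<delta>1 by (simp del: of_real_diff)
    show "continuous_on {0<..1} (\<lambda>u. B * (\<omega> (\<delta> * u) / (\<delta> * u)))"
      using \<delta> by (intro continuous_intros continuous_on_majorant[OF maj]) auto
    show "0 \<le> B * M0 * \<omega> \<delta>" using B M0 \<delta> majorant_nonneg[OF maj, of \<delta>] by simp
    have "(\<integral>\<^sup>+u. ennreal (cmod (of_real (1 - \<delta>) * z - z) * (B * (\<omega> (\<delta> * u) / (\<delta> * u)))) \<partial>restrict_space lborel {0<..1})
      \<le> (\<integral>\<^sup>+u. ennreal B * ennreal (\<omega> (\<delta> * u) / u) \<partial>restrict_space lborel {0<..1})"
    proof (rule nn_integral_mono)
      fix u :: real assume "u \<in> space (restrict_space lborel {0<..1})"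
      then have u: "0 < u" "u \<le> 1" by (auto simp: space_restrict_space)
      have len': "cmod (of_real (1 - \<delta>) * z - z) \<le> \<delta>"
        unfolding len using z \<delta> by (simp add: mult_left_le)
      have "cmod (of_real (1 - \<delta>) * z - z) * (B * (\<omega> (\<delta> * u) / (\<delta> * u))) \<le> \<delta> * (B * (\<omega> (\<delta> * u) / (\<delta> * u)))"
        using len' B u \<delta> majorant_nonneg[OF maj, of "\<delta> * u"] by (intro mult_right_mono) auto
      also have "\<dots> = B * (\<omega> (\<delta> * u) / u)" using \<delta> u by simp
      finally show "ennreal (cmod (of_real (1 - \<delta>) * z - z) * (B * (\<omega> (\<delta> * u) / (\<delta> * u))))
          \<le> ennreal B * ennreal (\<omega> (\<delta> * u) / u)"
        using B by (simp add: ennreal_mult'[symmetric] ennreal_leI)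
    qed
    also have "\<dots> = ennreal B * (\<integral>\<^sup>+u. ennreal (\<omega> (\<delta> * u) / u) \<partial>restrict_space lborel {0<..1})"
    proof (rule nn_integral_cmult)
      have "continuous_on {0<..1} (\<lambda>u. \<omega> (\<delta> * u) / u)"
        using \<delta> by (intro continuous_intros continuous_on_majorant[OF maj]) auto
      then show "(\<lambda>u. ennreal (\<omega> (\<delta> * u) / u)) \<in> borel_measurable (restrict_space lborel {0<..1})"
        using borel_measurable_restrict_lborel by measurable
    qed
    also have "\<dots> = ennreal B * (\<integral>\<^sup>+t\<in>{0<..\<delta>}. ennreal (\<omega> t / t) \<partial>lborel)"
      by (simp only: radial_majorant_integral[OF maj \<delta>(1)])
    also have "\<dots> \<le> ennreal B * ennreal (M0 * \<omega> \<delta>)"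
      using \<delta> \<delta>1 by (intro mult_left_mono dini) auto
    also have "\<dots> = ennreal (B * M0 * \<omega> \<delta>)"
      using B by (simp add: ennreal_mult'[symmetric] mult.assoc)
    finally show "(\<integral>\<^sup>+u. ennreal (cmod (of_real (1 - \<delta>) * z - z) * (B * (\<omega> (\<delta> * u) / (\<delta> * u)))) \<partial>restrict_space lborel {0<..1})
      \<le> ennreal (B * M0 * \<omega> \<delta>)" .
    fix u :: real assume "u \<in> {0<..1}"
    then have u: "0 < u" "u \<le> 1" by auto
    show "0 \<le> B * (\<omega> (\<delta> * u) / (\<delta> * u))" using B u \<delta> majorant_nonneg[OF maj, of "\<delta> * u"] by simp
    have "\<delta> * u \<le> 1" using u \<delta> \<delta>1 by (intro mult_le_one) auto
    then show "Lp_bounded p (\<lambda>\<eta>. cmod (deriv h (cis \<eta> * (z + of_real u * (of_real (1 - \<delta>) * z - z))))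
        + cmod (deriv g (cis \<eta> * (z + of_real u * (of_real (1 - \<delta>) * z - z))))) (B * (\<omega> (\<delta> * u) / (\<delta> * u)))"
      unfolding point using u \<delta> shrink[of "\<delta> * u"] by (intro deriv_le) auto
  qed

  have "Lp_bounded p (\<lambda>\<eta>. cmod (f (cis \<eta> * z1) - f (cis \<eta> * z2))) (M * \<omega> (cmod (z1 - z2)))"
    if z: "z1 \<in> ball 0 1" "z2 \<in> ball 0 1" for z1 z2
  proof (cases "z1 = z2")
    case True
    then show ?thesis
      using p maj by (cases "p = \<infinity>") (auto simp: Lp_bounded_def Lp_bounded_finite_iff[unfolded Lp_bounded_def] majorant_def circle_Lp_def)
  next
    case False
    define l where "l = cmod (z1 - z2)"
    define \<delta> where "\<delta> = min l \<delta>1"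
    have l: "0 < l" using False by (simp add: l_def)
    have \<delta>: "0 < \<delta>" "\<delta> \<le> \<delta>1" "\<delta> \<le> l" "\<delta> < 1" using l \<delta>1 by (auto simp: \<delta>_def)
    have \<omega>l: "0 \<le> \<omega> l" "\<omega> \<delta> \<le> \<omega> l" "0 \<le> \<omega> \<delta>"
      using l \<delta> majorant_nonneg[OF maj] majorant_mono[OF maj] by auto
    define w where "w = (\<lambda>z :: complex. of_real (1 - \<delta>) * z)"
    have w_norm: "cmod (w z) = (1 - \<delta>) * cmod z" for z
      using \<delta> unfolding w_def norm_mult norm_of_real by simp
    have w_in: "cmod (w z) \<le> 1 - \<delta>" if "z \<in> ball 0 1" for z
      unfolding w_norm using that \<delta> by (simp add: mult_left_le)
    have w_ball: "w z \<in> ball 0 1" if "z \<in> ball 0 1" for z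
      using w_in[OF that] \<delta> by simp
    have cross: "Lp_bounded p (\<lambda>\<eta>. cmod (f (cis \<eta> * w z1) - f (cis \<eta> * w z2))) (B * (1 + 2 / \<delta>1) * \<omega> l)"
    proof (rule Lp_bounded_segment[OF p h g f_eq w_ball[OF z(1)] w_ball[OF z(2)], where m = "\<lambda>u. B * (\<omega> \<delta> / \<delta>)"])
      show "0 \<le> B * (1 + 2 / \<delta>1) * \<omega> l" using B \<delta>1 \<omega>l by simp
      fix u :: real assume "u \<in> {0<..1}"
      then have u: "0 \<le> u" "u \<le> 1" by auto
      show "0 \<le> B * (\<omega> \<delta> / \<delta>)" using B \<omega>l \<delta> by simp
      have "(1 - u) *\<^sub>R w z1 + u *\<^sub>R w z2 \<in> cball 0 (1 - \<delta>)"
        using u w_in z by (intro convexD[OF convex_cball]) auto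
      then have "cmod (w z1 + of_real u * (w z2 - w z1)) \<le> 1 - \<delta>"
        by (simp add: scaleR_conv_of_real algebra_simps)
      then show "Lp_bounded p (\<lambda>\<eta>. cmod (deriv h (cis \<eta> * (w z1 + of_real u * (w z2 - w z1))))
        + cmod (deriv g (cis \<eta> * (w z1 + of_real u * (w z2 - w z1))))) (B * (\<omega> \<delta> / \<delta>))"
        using \<delta> by (intro deriv_le) auto
    next
      have dist_w: "cmod (w z2 - w z1) \<le> l" "cmod (w z2 - w z1) \<le> 2"
      proof -
        have "cmod (w z2 - w z1) = (1 - \<delta>) * l"
          using w_norm[of "z2 - z1"] by (simp add: w_def l_def right_diff_distrib norm_minus_commute)
        then show "cmod (w z2 - w z1) \<le> l" using \<delta> l by (simp add: mult_left_le_one_le)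
        also have "l \<le> cmod z1 + cmod z2" unfolding l_def by (rule norm_triangle_ineq4)
        finally show "cmod (w z2 - w z1) \<le> 2" using z by simp
      qed
      have "cmod (w z2 - w z1) * (\<omega> \<delta> / \<delta>) \<le> (1 + 2 / \<delta>1) * \<omega> l"
      proof (cases "\<delta> = l")
        case True
        have "cmod (w z2 - w z1) * (\<omega> \<delta> / \<delta>) \<le> l * (\<omega> l / l)"
          using True dist_w \<omega>l l by (intro mult_mono) auto
        also have "\<dots> = \<omega> l" using l by simp
        also have "\<dots> \<le> (1 + 2 / \<delta>1) * \<omega> l"
          using \<omega>l \<delta>1 by (simp add: distrib_right)
        finally show ?thesis .
      next
        case False
        then have "\<delta> = \<delta>1" by (auto simp: \<delta>_def min_def split: if_splits)
        then have "cmod (w z2 - w z1) * (\<omega> \<delta> / \<delta>) \<le> 2 * (\<omega> l / \<delta>1)"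
          using dist_w \<omega>l \<delta>1 by (intro mult_mono frac_le) auto
        also have "\<dots> \<le> (1 + 2 / \<delta>1) * \<omega> l"
          using \<omega>l by (simp add: distrib_right)
        finally show ?thesis .
      qed
      from mult_left_mono[OF this B(1)]
      have "cmod (w z2 - w z1) * (B * (\<omega> \<delta> / \<delta>)) \<le> B * (1 + 2 / \<delta>1) * \<omega> l"
        by (simp only: mult_ac)
      moreover have "emeasure (restrict_space lborel {0<..1::real}) (space (restrict_space lborel {0<..1})) = 1"
        by (simp add: emeasure_restrict_space space_restrict_space)
      ultimately show "(\<integral>\<^sup>+u. ennreal (cmod (w z2 - w z1) * (B * (\<omega> \<delta> / \<delta>))) \<partial>restrict_space lborel {0<..1::real})
          \<le> ennreal (B * (1 + 2 / \<delta>1) * \<omega> l)"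
        by (simp only: nn_integral_const mult_1_right ennreal_leI)
    qed (auto intro!: continuous_intros)
    have meas: "(\<lambda>\<eta>. cmod (f (cis \<eta> * a) - f (cis \<eta> * b))) \<in> borel_measurable borel"
      if "a \<in> ball 0 1" "b \<in> ball 0 1" for a b
    proof -
      have "continuous_on (ball 0 1) (\<lambda>z. h z + cnj (g z))"
        by (intro continuous_intros holomorphic_on_imp_continuous_on h g)
      then have f_cont: "continuous_on (ball 0 1) f" by (rule continuous_on_eq) (simp add: f_eq)
      have "continuous_on UNIV (\<lambda>\<eta>. f (cis \<eta> * c))" if "c \<in> ball 0 1" for c
        by (rule continuous_on_compose2[OF f_cont]) (use that in \<open>auto intro!: continuous_intros simp: norm_mult\<close>)
      then show ?thesis
        using that by (intro borel_measurable_continuous_onI continuous_on_norm continuous_on_diff)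
    qed
    have rad: "Lp_bounded p (\<lambda>\<eta>. cmod (f (cis \<eta> * z) - f (cis \<eta> * w z))) (B * M0 * \<omega> l)"
      if "z \<in> ball 0 1" for z
      unfolding w_def using B M0 \<omega>l \<delta>
      by (intro Lp_bounded_mono[OF p radial[OF that \<delta>(1,2)]]) (auto intro!: mult_left_mono)
    have sum: "Lp_bounded p (\<lambda>\<eta>. (cmod (f (cis \<eta> * z1) - f (cis \<eta> * w z1)) + cmod (f (cis \<eta> * w z1) - f (cis \<eta> * w z2)))
        + cmod (f (cis \<eta> * z2) - f (cis \<eta> * w z2))) ((B * M0 * \<omega> l + B * (1 + 2 / \<delta>1) * \<omega> l) + B * M0 * \<omega> l)"
      using B M0 \<omega>l \<delta>1 z w_ball
      by (intro Lp_bounded_add[OF p] rad cross borel_measurable_add meas) (auto intro!: add_nonneg_nonneg mult_nonneg_nonneg)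
    show ?thesis
      unfolding l_def[symmetric]
    proof (rule Lp_bounded_mono[OF p sum])
      show "0 \<le> (B * M0 * \<omega> l + B * (1 + 2 / \<delta>1) * \<omega> l) + B * M0 * \<omega> l"
        using B M0 \<omega>l \<delta>1 by (auto intro!: add_nonneg_nonneg mult_nonneg_nonneg)
      show "(B * M0 * \<omega> l + B * (1 + 2 / \<delta>1) * \<omega> l) + B * M0 * \<omega> l \<le> M * \<omega> l"
        using \<omega>l by (simp add: M_def distrib_right)
      fix \<eta>
      show "cmod (f (cis \<eta> * z1) - f (cis \<eta> * z2))
        \<le> (cmod (f (cis \<eta> * z1) - f (cis \<eta> * w z1)) + cmod (f (cis \<eta> * w z1) - f (cis \<eta> * w z2)))
          + cmod (f (cis \<eta> * z2) - f (cis \<eta> * w z2))"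
        using norm_triangle_ineq[of "f (cis \<eta> * z1) - f (cis \<eta> * w z1)" "f (cis \<eta> * w z1) - f (cis \<eta> * z2)"]
          norm_triangle_ineq[of "f (cis \<eta> * w z1) - f (cis \<eta> * w z2)" "f (cis \<eta> * w z2) - f (cis \<eta> * z2)"]
        by (simp add: norm_minus_commute[of "f (cis \<eta> * z2)"])
    qed simp
  qed
  with M show ?thesis by blast
qed

section \<open>Smoothness is equivalent to the bound for the Poisson defect\<close>

theorem theorem2p7:
  fixes p :: ennreal and \<omega> :: "real \<Rightarrow> real" and f :: "complex \<Rightarrow> complex" and K :: real
  assumes "1 \<le> p"
    and "regular_majorant \<omega>"
    and "harmonic_on (ball 0 1) f"
    and "continuous_on (cball 0 1) f"
    and "(\<lambda>\<xi>. cmod (f \<xi>)) \<in> Lambda_circle \<omega> p"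
    and "1 \<le> K"
    and "quasiregular_on K (ball 0 1) f"
  shows "f \<in> Lambda_disk \<omega> p \<longleftrightarrow>
    (\<exists>M>0. \<forall>z\<in>ball 0 1.
       if p = \<infinity>
       then poisson (\<lambda>\<xi>. cmod (f \<xi>)) z - cmod (f z) \<le> M * \<omega> (1 - cmod z)
       else circle_Lp (enn2real p)
              (\<lambda>\<eta>. poisson (\<lambda>\<xi>. cmod (f \<xi>)) (z * cis \<eta>) - cmod (f (z * cis \<eta>)))
            \<le> ennreal (M * \<omega> (1 - cmod z)))"
proof -
  note p = assms(1) and cont = assms(4)
  have \<omega>: "majorant \<omega>" using assms(2) by (simp add: regular_majorant_def)
  obtain h g where h: "h holomorphic_on ball 0 1" and g: "g holomorphic_on ball 0 1"
    and f_eq: "\<And>z. z \<in> ball 0 1 \<Longrightarrow> f z = h z + cnj (g z)"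
    and dh: "\<And>z. z \<in> ball 0 1 \<Longrightarrow> deriv h z = wirtinger f z"
    and dg: "\<And>z. z \<in> ball 0 1 \<Longrightarrow> deriv g z = cnj (wirtinger_bar f z)"
    using harmonic_decomposition[OF assms(3)] by blast
  have K: "cmod (deriv h z) + cmod (deriv g z) \<le> K * (cmod (deriv h z) - cmod (deriv g z))"
    if "z \<in> ball 0 1" for z
    using quasiregular_everywhere[OF _ open_ball assms(7) that] assms(3)
    by (simp add: dh[OF that] dg[OF that] harmonic_on_def)
  obtain C where C: "0 < C" "\<And>r. 0 \<le> r \<Longrightarrow> r < 1 \<Longrightarrow>
      (\<integral>\<^sup>+\<tau>. ennreal (\<omega> (cmod (cis \<tau> - of_real r)) / (cmod (cis \<tau> - of_real r))\<^sup>2) \<partial>rotations)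
      \<le> ennreal (C * (\<omega> (1 - r) / (1 - r)))"
    by (rule kernel_majorant[OF assms(2)]) blast
  let ?P = "poisson (\<lambda>\<xi>. cmod (f \<xi>))"

  \<comment> \<open>A condition on all points of the disk is also a condition on all their rotations. This turns the pointwise
    conditions for \<open>p = \<infinity>\<close> into suprema over the angle and gives all exponents one form.\<close>
  have D1_iff: "f \<in> Lambda_disk \<omega> p \<longleftrightarrow> (\<exists>M>0. \<forall>z1\<in>ball 0 1. \<forall>z2\<in>ball 0 1.
    Lp_bounded p (\<lambda>\<eta>. cmod (f (cis \<eta> * z1) - f (cis \<eta> * z2))) (M * \<omega> (cmod (z1 - z2))))"
  proof -
    have "continuous_on (ball 0 1) f" by (rule continuous_on_subset[OF cont]) auto
    then have borel: "f \<in> borel_measurable (restrict_space borel (ball 0 1))"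
      by (rule borel_measurable_continuous_on_restrict)
    have "(\<forall>z1\<in>ball 0 1. \<forall>z2\<in>ball 0 1. Lp_diff p f z1 z2 \<le> ennreal (M * \<omega> (cmod (z1 - z2))))
      \<longleftrightarrow> (\<forall>z1\<in>ball 0 1. \<forall>z2\<in>ball 0 1.
        Lp_bounded p (\<lambda>\<eta>. cmod (f (cis \<eta> * z1) - f (cis \<eta> * z2))) (M * \<omega> (cmod (z1 - z2))))" if "0 < M" for M
    proof (intro iffI ballI)
      fix z1 z2 :: complex assume z: "z1 \<in> ball 0 1" "z2 \<in> ball 0 1"
      assume H: "\<forall>z1\<in>ball 0 1. \<forall>z2\<in>ball 0 1. Lp_diff p f z1 z2 \<le> ennreal (M * \<omega> (cmod (z1 - z2)))"
      show "Lp_bounded p (\<lambda>\<eta>. cmod (f (cis \<eta> * z1) - f (cis \<eta> * z2))) (M * \<omega> (cmod (z1 - z2)))"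
      proof (rule Lp_bounded_if_Lp_diff)
        fix \<eta>
        have "cis \<eta> * z1 \<in> ball 0 1" "cis \<eta> * z2 \<in> ball 0 1" using z by (auto simp: norm_mult)
        moreover have "cmod (cis \<eta> * z1 - cis \<eta> * z2) = cmod (z1 - z2)"
          by (simp add: right_diff_distrib[symmetric] norm_mult)
        ultimately show "Lp_diff p f (cis \<eta> * z1) (cis \<eta> * z2) \<le> ennreal (M * \<omega> (cmod (z1 - z2)))"
          using H by metis
      qed (use that majorant_nonneg[OF \<omega>] in simp)
    qed (blast intro: Lp_diff_le_if_Lp_bounded)
    with borel show ?thesis unfolding Lambda_disk_def by auto
  qed
  have D2_iff: "(\<forall>z\<in>ball 0 1.
       if p = \<infinity> then ?P z - cmod (f z) \<le> M * \<omega> (1 - cmod z)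
       else circle_Lp (enn2real p) (\<lambda>\<eta>. ?P (z * cis \<eta>) - cmod (f (z * cis \<eta>))) \<le> ennreal (M * \<omega> (1 - cmod z)))
    \<longleftrightarrow> (\<forall>z\<in>ball 0 1. Lp_bounded p (\<lambda>\<eta>. ?P (cis \<eta> * z) - cmod (f (cis \<eta> * z))) (M * \<omega> (1 - cmod z)))" for M
  proof (cases "p = \<infinity>")
    case True
    have "(\<forall>z\<in>ball 0 1. ?P z - cmod (f z) \<le> M * \<omega> (1 - cmod z)) \<longleftrightarrow>
      (\<forall>z\<in>ball 0 1. \<forall>\<eta>. ?P (cis \<eta> * z) - cmod (f (cis \<eta> * z)) \<le> M * \<omega> (1 - cmod z))"
    proof (intro iffI ballI allI)
      fix z :: complex and \<eta> :: real assume z: "z \<in> ball 0 1"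
      assume H: "\<forall>z\<in>ball 0 1. ?P z - cmod (f z) \<le> M * \<omega> (1 - cmod z)"
      have "cis \<eta> * z \<in> ball 0 1" "cmod (cis \<eta> * z) = cmod z" using z by (auto simp: norm_mult)
      then show "?P (cis \<eta> * z) - cmod (f (cis \<eta> * z)) \<le> M * \<omega> (1 - cmod z)" using H by metis
    next
      fix z :: complex assume z: "z \<in> ball 0 1"
      assume H: "\<forall>z\<in>ball 0 1. \<forall>\<eta>. ?P (cis \<eta> * z) - cmod (f (cis \<eta> * z)) \<le> M * \<omega> (1 - cmod z)"
      show "?P z - cmod (f z) \<le> M * \<omega> (1 - cmod z)"
        using H[rule_format, OF z, of 0] by simp
    qed
    then show ?thesis using True by (simp add: Lp_bounded_def)
  next
    case False
    then show ?thesis by (simp add: Lp_bounded_def mult.commute)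
  qed

  show ?thesis
    unfolding D1_iff D2_iff
  proof
    assume "\<exists>M>0. \<forall>z1\<in>ball 0 1. \<forall>z2\<in>ball 0 1.
      Lp_bounded p (\<lambda>\<eta>. cmod (f (cis \<eta> * z1) - f (cis \<eta> * z2))) (M * \<omega> (cmod (z1 - z2)))"
    then obtain M where M: "0 < M" and bound: "\<And>z1 z2. z1 \<in> ball 0 1 \<Longrightarrow> z2 \<in> ball 0 1 \<Longrightarrow>
      Lp_bounded p (\<lambda>\<eta>. cmod (f (cis \<eta> * z1) - f (cis \<eta> * z2))) (M * \<omega> (cmod (z1 - z2)))" by blast
    have "Lp_bounded p (\<lambda>\<eta>. ?P (cis \<eta> * z) - cmod (f (cis \<eta> * z))) (M * C / pi * \<omega> (1 - cmod z))"
      if "z \<in> ball 0 1" for z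
      using M C that
      by (intro poisson_defect_bound[OF p \<omega> _ _ cont norm_le_poisson[OF cont h g f_eq] _
            Lp_bounded_closed_disk[OF p \<omega> _ cont bound]]) auto
    moreover have "0 < M * C / pi" using M C by simp
    ultimately show "\<exists>M>0. \<forall>z\<in>ball 0 1.
      Lp_bounded p (\<lambda>\<eta>. ?P (cis \<eta> * z) - cmod (f (cis \<eta> * z))) (M * \<omega> (1 - cmod z))" by blast
  next
    assume "\<exists>M>0. \<forall>z\<in>ball 0 1.
      Lp_bounded p (\<lambda>\<eta>. ?P (cis \<eta> * z) - cmod (f (cis \<eta> * z))) (M * \<omega> (1 - cmod z))"
    then obtain M' where M': "0 < M'" and defect: "\<And>z. z \<in> ball 0 1 \<Longrightarrow>
      Lp_bounded p (\<lambda>\<eta>. ?P (cis \<eta> * z) - cmod (f (cis \<eta> * z))) (M' * \<omega> (1 - cmod z))" by blast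
    obtain M where M: "0 < M" and circle: "\<And>\<xi>1 \<xi>2. \<xi>1 \<in> sphere 0 1 \<Longrightarrow> \<xi>2 \<in> sphere 0 1 \<Longrightarrow>
      Lp_diff p (\<lambda>\<xi>. cmod (f \<xi>)) \<xi>1 \<xi>2 \<le> ennreal (M * \<omega> (cmod (\<xi>1 - \<xi>2)))"
      using assms(5) unfolding Lambda_circle_def by blast
    have boundary: "Lp_bounded p (\<lambda>\<eta>. \<bar>cmod (f (cis \<eta> * \<xi>1)) - cmod (f (cis \<eta> * \<xi>2))\<bar>) (M * \<omega> (cmod (\<xi>1 - \<xi>2)))"
      if \<xi>: "cmod \<xi>1 = 1" "cmod \<xi>2 = 1" for \<xi>1 \<xi>2
      unfolding real_norm_def[symmetric]
    proof (rule Lp_bounded_if_Lp_diff)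
      fix \<eta>
      have "cis \<eta> * \<xi>1 \<in> sphere 0 1" "cis \<eta> * \<xi>2 \<in> sphere 0 1" using \<xi> by (auto simp: norm_mult)
      moreover have "cmod (cis \<eta> * \<xi>1 - cis \<eta> * \<xi>2) = cmod (\<xi>1 - \<xi>2)"
        by (simp add: right_diff_distrib[symmetric] norm_mult)
      ultimately show "Lp_diff p (\<lambda>\<xi>. cmod (f \<xi>)) (cis \<eta> * \<xi>1) (cis \<eta> * \<xi>2) \<le> ennreal (M * \<omega> (cmod (\<xi>1 - \<xi>2)))"
        using circle by metis
    qed (use M majorant_nonneg[OF \<omega>] in simp)
    have K0: "0 \<le> K" using assms(6) by simp
    show "\<exists>M>0. \<forall>z1\<in>ball 0 1. \<forall>z2\<in>ball 0 1.
      Lp_bounded p (\<lambda>\<eta>. cmod (f (cis \<eta> * z1) - f (cis \<eta> * z2))) (M * \<omega> (cmod (z1 - z2)))"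
    proof (rule smoothness_from_derivative[OF p assms(2) h g f_eq])
      show "0 \<le> K * (2 * M * C / pi + 2 * M')" using K0 M M' C by simp
      show "Lp_bounded p (\<lambda>\<eta>. cmod (deriv h (cis \<eta> * z)) + cmod (deriv g (cis \<eta> * z)))
        (K * (2 * M * C / pi + 2 * M') * (\<omega> (1 - cmod z) / (1 - cmod z)))" if "z \<in> ball 0 1" for z
        by (rule derivative_Lp_bound[OF p \<omega> less_imp_le[OF C(1)] C(2) cont h g f_eq K0 K
              less_imp_le[OF M] boundary less_imp_le[OF M'] defect that])
    qed
  qed
qed

end
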